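(* Let $\pi_1:V_1\to X_1$ and $\pi_2:V_2\to X_2$ be finite-dimensional locally trivial diffeological vector pseudo-bundles, let $(\tilde f,f)$ be a gluing of the former to the latter such that $f$ and $\tilde f^*$ are diffeomorphisms (of their domains with their images), and let $g_1,g_2$ be pseudo-metrics on $V_1,V_2$ compatible with this gluing. Let $v\in C\ell(V_2^*,g_2^* )\cup_{(\tilde F^* )^{C\ell}}C\ell(V_1^*,g_1^* )$ and $e\in\bigwedge(V_2)\cup_{\tilde f^{\bigwedge}}\bigwedge(V_1)$ lie over the same point of $X_2\cup_{f^{-1}}X_1$. Then $$\left(\Phi_{\cup,*}^{\bigwedge}\circ(\Phi^{\bigwedge})^{-1}\right)(c_{*,\cup}(v)(e))=\tilde c_{*,\cup}\left(\Phi^{C\ell( * )}(v)\right)\left((\Phi_{\cup,*}^{\bigwedge}\circ(\Phi^{\bigwedge})^{-1})(e)\right).$$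
   Context: Diffeological spaces, plots, smooth maps, and the subset, quotient, product, disjoint union and functional diffeologies are in the usual sense of Souriau. $E^*$ denotes the space of smooth linear maps $E\to\mathbb R$ on a diffeological vector space $E$, with the functional diffeology. Pseudo-bundles. A diffeological vector pseudo-bundle is a smooth surjective map $\pi:V\to X$ of diffeological spaces with a vector space structure on each fibre such that fibrewise addition $V\times_XV\to V$, scalar multiplication $\mathbb R\times V\to V$ and the zero section are smooth. The dual pseudo-bundle is $V^*=\bigcup_{x}(\pi^{-1}(x))^*$ with projection $\pi^*$; $q:U'\to V^*$ is a plot iff for every plot $p:U\to V$ the map $(u',u)\mapsto q(u')(p(u))$ is smooth on the set where $q(u')$ and $p(u)$ lie over the same point. $V\oplus V'$ is $V\times_XV'$ with the subset diffeology; $V\otimes V'$ is the fibrewise tensor product, with the finest pseudo-bundle diffeology making $V\times_XV'\to V\otimes V'$ smooth. A pseudo-metric on $V$ (finite-dimensional fibres) is a smooth section $g$ of $V^*\otimes V^*$ such that each $g(x)$ is a symmetric positive semi-definite form of rank $\dim((\pi^{-1}(x))^* )$. The dual pseudo-metric $g^*$ on $V^*$ is defined by $g^*(x)(\Psi_g(v),\Psi_g(w))=g(x)(v,w)$, where $\Psi_g(v)=g(\pi(v))(v,\cdot)$ (fibrewise surjective onto $V^*$). Gluing. For $h:Z_1\supseteq Y'\to Z_2$ smooth, $Z_1\cup_hZ_2=(Z_1\sqcup Z_2)/(z\sim h(z))$ with the quotient of the disjoint union diffeology. The natural inclusions of $Z_1\setminus Y'$ and of $Z_2$ have disjoint images covering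 it; they are denoted $i_1^{Z_1},i_2^{Z_2}$ for base spaces and $j_1^{Z_1},j_2^{Z_2}$ for total spaces (subscript 1 for the left-hand factor, 2 for the right-hand factor). A gluing $(\tilde f,f)$ consists of a smooth $f:X_1\supseteq Y\to X_2$ and a smooth fibrewise linear lift $\tilde f:\pi_1^{-1}(Y)\to V_2$; it yields the pseudo-bundle $V_1\cup_{\tilde f}V_2\to X_1\cup_fX_2$. The map $\tilde f^*:(\pi_2^* )^{-1}(f(Y))\to V_1^*$ is $\xi\mapsto\xi\circ\tilde f|_{\pi_1^{-1}(y)}$ for $\xi\in(\pi_2^{-1}(f(y)))^*$; it lifts $f^{-1}$ and gives the gluing $V_2^*\cup_{\tilde f^*}V_1^*\to X_2\cup_{f^{-1}}X_1$. Pseudo-metrics $g_1,g_2$ are compatible with $(\tilde f,f)$ if $g_1(y)(v,w)=g_2(f(y))(\tilde f(v),\tilde f(w))$ for all $y\in Y$, $v,w\in\pi_1^{-1}(y)$. $\widetilde{g^*}$ is the pseudo-metric on $V_2^*\cup_{\tilde f^*}V_1^*$ equal to $g_2^*$ (via $j_1^{V_2^*}$) over $i_1^{X_2}(X_2\setminus f(Y))$ and to $g_1^*$ (via $j_2^{V_1^*}$) over $i_2^{X_1}(X_1)$. The diffeomorphism $\Phi_{\cup,*}:(V_1\cup_{\tilde f}V_2)^*\to V_2^*\cup_{\tilde f^*}V_1^*$ (which exists under the hypotheses) is $j_2^{V_1^*}\circ(j_1^{V_1})^*$ over $i_1^{X_1}(X_1\setminus Y)$, $j_2^{V_1^*}\circ\tilde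 f^*\circ(j_2^{V_2})^*$ over $i_2^{X_2}(f(Y))$, and $j_1^{V_2^*}\circ(j_2^{V_2})^*$ over $i_2^{X_2}(X_2\setminus f(Y))$, where $(j_i^{V_i})^*$ is fibrewise pre-composition with $j_i^{V_i}$. Clifford algebras. The dimensions of all fibres are assumed bounded. $C\ell(V,g)=\bigcup_xC\ell(\pi^{-1}(x),g(x))$, where the Clifford algebra is the quotient of the tensor algebra by the relations $v\otimes w+w\otimes v+2g(x)(v,w)=0$, with the quotient diffeology from the pseudo-bundle $T(V)$ of tensor algebras (finite direct sums of tensor powers, up to the maximal fibre dimension, suffice). $(\tilde F^* )^{C\ell}$ is the fibrewise algebra homomorphism, from the part of $C\ell(V_2^*,g_2^* )$ over $f(Y)$ to $C\ell(V_1^*,g_1^* )$, induced by $\tilde f^*$. $\Phi^{C\ell( * )}:C\ell(V_2^*,g_2^* )\cup_{(\tilde F^* )^{C\ell}}C\ell(V_1^*,g_1^* )\to C\ell(V_2^*\cup_{\tilde f^*}V_1^*,\widetilde{g^*})$ is $(j_1^{V_2^*})^{C\ell}\circ(j_1^{C\ell(V_2^*,g_2^* )})^{-1}$ over $i_1^{X_2}(X_2\setminus f(Y))$ and $(j_2^{V_1^*})^{C\ell}\circ(j_2^{C\ell(V_1^*,g_1^* )})^{-1}$ over $i_2^{X_1}(X_1)$, where $(\cdot)^{C\ell}$ is the fibrewise algebra extension. Exterior algebras. $\mathrm{Alt}(v_1\otimes\cdots\otimes v_n)=\frac1{n!}\sum_\sigma\mathrm{sgn}(\sigma)v_{\sigma(1)}\otimes\cdots\otimes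 v_{\sigma(n)}$ (fibrewise), $\bigwedge_n(V)=\mathrm{Alt}(V^{\otimes n})$, $\bigwedge_*(V)=\bigoplus_n\bigwedge_n(V)$, $v_1\wedge\cdots\wedge v_n=\mathrm{Alt}(v_1\otimes\cdots\otimes v_n)$; $\bigwedge(V):=\bigwedge_*(V^* )$. $\tilde f^{\bigwedge}$ is the restriction of $\bigoplus_n(\tilde f^* )^{\otimes n}$ to the part of $\bigwedge(V_2)$ over $f(Y)$, with values in $\bigwedge(V_1)$. $\Phi_{\cup,*}^{\bigwedge}:\bigwedge(V_1\cup_{\tilde f}V_2)\to\bigwedge_*(V_2^*\cup_{\tilde f^*}V_1^* )$ is the restriction of $\bigoplus_n\Phi_{\cup,*}^{\otimes n}$. Let $\Phi_{\cup,\otimes}^{(\otimes n)}:(V_2^*\cup_{\tilde f^*}V_1^* )^{\otimes n}\to(V_2^* )^{\otimes n}\cup_{(\tilde f^* )^{\otimes n}}(V_1^* )^{\otimes n}$ be determined by $\Phi_{\cup,\otimes}^{(\otimes n)}\circ(j_1^{V_2^*})^{\otimes n}=j_1^{(V_2^* )^{\otimes n}}$ and $\Phi_{\cup,\otimes}^{(\otimes n)}\circ(j_2^{V_1^*})^{\otimes n}=j_2^{(V_1^* )^{\otimes n}}$, and let $\Phi_{\cup,\oplus}$ be the analogous natural identification of $\bigoplus_n\bigl((V_2^* )^{\otimes n}\cup_{(\tilde f^* )^{\otimes n}}(V_1^* )^{\otimes n}\bigr)$ with $\bigl(\bigoplus_n(V_2^* )^{\otimes n}\bigr)\cup\bigl(\bigoplus_n(V_1^*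 )^{\otimes n}\bigr)$ (glued along $\bigoplus_n(\tilde f^* )^{\otimes n}$). Then $\Phi^{\bigwedge}:\bigwedge(V_1\cup_{\tilde f}V_2)\to\bigwedge(V_2)\cup_{\tilde f^{\bigwedge}}\bigwedge(V_1)$ is the restriction of $\Phi_{\cup,\oplus}\circ\bigoplus_n(\Phi_{\cup,\otimes}^{(\otimes n)}\circ\Phi_{\cup,*}^{\otimes n})$, $n$ ranging from $0$ to the maximal dimension of fibres of the dual pseudo-bundles. Actions. The standard Clifford action of $C\ell(V,g)$ on $\bigwedge_*(V)$ is the fibrewise algebra homomorphism into endomorphisms determined on $v\in V$ by $c(v)(v_1\wedge\cdots\wedge v_k)=v\wedge v_1\wedge\cdots\wedge v_k-\sum_{j=1}^k(-1)^{j+1}g(\pi(v))(v,v_j)\,v_1\wedge\cdots\wedge v_{j-1}\wedge v_{j+1}\wedge\cdots\wedge v_k$. $c_i^*$ is the standard action of $C\ell(V_i^*,g_i^* )$ on $\bigwedge(V_i)$, $i=1,2$. $c_{*,\cup}$ is the action of $C\ell(V_2^*,g_2^* )\cup_{(\tilde F^* )^{C\ell}}C\ell(V_1^*,g_1^* )$ on $\bigwedge(V_2)\cup_{\tilde f^{\bigwedge}}\bigwedge(V_1)$ with $c_{*,\cup}(v)(e)=j_1^{\bigwedge(V_2)}\bigl(c_2^*((j_1^{C\ell(V_2^*,g_2^* )})^{-1}(v))((j_1^{\bigwedge(V_2)})^{-1}(e))\bigr)$ over $i_1^{X_2}(X_2\setminus f(Y))$ and $c_{*,\cup}(v)(e)=j_2^{\bigwedge(V_1)}\bigl(c_1^*((j_2^{C\ell(V_1^*,g_1^*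 )})^{-1}(v))((j_2^{\bigwedge(V_1)})^{-1}(e))\bigr)$ over $i_2^{X_1}(X_1)$. $\tilde c_{*,\cup}$ is the standard action of $C\ell(V_2^*\cup_{\tilde f^*}V_1^*,\widetilde{g^*})$ on $\bigwedge_*(V_2^*\cup_{\tilde f^*}V_1^* )$. *)

theory Defs
  imports
    "HOL-Analysis.Analysis"
    "HOL-Analysis.Finite_Function_Topology"
    "HOL-Combinatorics.Permutations"
begin

section \<open>Diffeological spaces\<close>

text \<open>Domains of plots are the open subsets of \<open>Euclidean_space n\<close>, for all \<open>n\<close>. Parametrizations
  are total functions whose values outside their domain are irrelevant.\<close>

primrec C_diff :: "nat \<Rightarrow> nat \<Rightarrow> (nat \<Rightarrow> real) set \<Rightarrow> ((nat \<Rightarrow> real) \<Rightarrow> real) \<Rightarrow> bool" where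
  "C_diff 0 n U f \<longleftrightarrow> continuous_map (subtopology (Euclidean_space n) U) euclideanreal f"
| "C_diff (Suc k) n U f \<longleftrightarrow>
     continuous_map (subtopology (Euclidean_space n) U) euclideanreal f \<and>
     (\<forall>i<n. \<exists>f'. (\<forall>u\<in>U. ((\<lambda>t. f (u(i := t))) has_real_derivative f' u) (at (u i))) \<and>
                 C_diff k n U f')"

definition smooth_fun :: "nat \<Rightarrow> (nat \<Rightarrow> real) set \<Rightarrow> ((nat \<Rightarrow> real) \<Rightarrow> real) \<Rightarrow> bool" where
  "smooth_fun n U f \<longleftrightarrow> (\<forall>k. C_diff k n U f)"

record 'a dspace =
  points :: "'a set"
  plot :: "nat \<Rightarrow> (nat \<Rightarrow> real) set \<Rightarrow> ((nat \<Rightarrow> real) \<Rightarrow> 'a) \<Rightarrow> bool"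

definition eucl_dsp :: "nat \<Rightarrow> (nat \<Rightarrow> real) set \<Rightarrow> (nat \<Rightarrow> real) dspace" where
  "eucl_dsp n U = \<lparr>points = U,
     plot = (\<lambda>m W h. openin (Euclidean_space m) W \<and> h ` W \<subseteq> U \<and>
                     (\<forall>i<n. smooth_fun m W (\<lambda>w. h w i)))\<rparr>"

definition real_dsp :: "real dspace" where
  "real_dsp = \<lparr>points = UNIV,
     plot = (\<lambda>m W p. openin (Euclidean_space m) W \<and> smooth_fun m W p)\<rparr>"

text \<open>The second conjunct only says that being a plot does not depend on values outside \<open>U\<close>.\<close>

definition diffeological_space :: "'a dspace \<Rightarrow> bool" where
  "diffeological_space X \<longleftrightarrow>
     (\<forall>n U p. plot X n U p \<longrightarrow> openin (Euclidean_space n) U \<and> p ` U \<subseteq> points X) \<and>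
     (\<forall>n U p q. plot X n U p \<and> (\<forall>u\<in>U. p u = q u) \<longrightarrow> plot X n U q) \<and>
     (\<forall>n U a. openin (Euclidean_space n) U \<and> a \<in> points X \<longrightarrow> plot X n U (\<lambda>_. a)) \<and>
     (\<forall>n U p. openin (Euclidean_space n) U \<and>
        (\<forall>u\<in>U. \<exists>W\<subseteq>U. openin (Euclidean_space n) W \<and> u \<in> W \<and> plot X n W p) \<longrightarrow> plot X n U p) \<and>
     (\<forall>n U p m W h. plot X n U p \<and> plot (eucl_dsp n U) m W h \<longrightarrow> plot X m W (p \<circ> h))"

definition smooth_map :: "'a dspace \<Rightarrow> 'b dspace \<Rightarrow> ('a \<Rightarrow> 'b) \<Rightarrow> bool" where
  "smooth_map X Y h \<longleftrightarrow>
     h ` points X \<subseteq> points Y \<and> (\<forall>n U p. plot X n U p \<longrightarrow> plot Y n U (h \<circ> p))"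

definition diffeomorphism :: "'a dspace \<Rightarrow> 'b dspace \<Rightarrow> ('a \<Rightarrow> 'b) \<Rightarrow> bool" where
  "diffeomorphism X Y h \<longleftrightarrow>
     bij_betw h (points X) (points Y) \<and> smooth_map X Y h \<and>
     smooth_map Y X (the_inv_into (points X) h)"

definition sub_dsp :: "'a dspace \<Rightarrow> 'a set \<Rightarrow> 'a dspace" where
  "sub_dsp X A = \<lparr>points = points X \<inter> A, plot = (\<lambda>n U p. plot X n U p \<and> p ` U \<subseteq> A)\<rparr>"

definition prod_dsp :: "'a dspace \<Rightarrow> 'b dspace \<Rightarrow> ('a \<times> 'b) dspace" where
  "prod_dsp X Y = \<lparr>points = points X \<times> points Y,
     plot = (\<lambda>n U p. plot X n U (fst \<circ> p) \<and> plot Y n U (snd \<circ> p))\<rparr>"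

definition sum_dsp :: "'a dspace \<Rightarrow> 'b dspace \<Rightarrow> ('a + 'b) dspace" where
  "sum_dsp X Y = \<lparr>points = points X <+> points Y,
     plot = (\<lambda>n U p. openin (Euclidean_space n) U \<and>
       (\<forall>u\<in>U. \<exists>W\<subseteq>U. openin (Euclidean_space n) W \<and> u \<in> W \<and>
          ((\<exists>q. plot X n W q \<and> (\<forall>w\<in>W. p w = Inl (q w))) \<or>
           (\<exists>q. plot Y n W q \<and> (\<forall>w\<in>W. p w = Inr (q w))))))\<rparr>"

definition quot_dsp :: "'a dspace \<Rightarrow> ('a \<times> 'a) set \<Rightarrow> 'a set dspace" where
  "quot_dsp X r = \<lparr>points = points X // r,
     plot = (\<lambda>n U p. openin (Euclidean_space n) U \<and>
       (\<forall>u\<in>U. \<exists>W\<subseteq>U. openin (Euclidean_space n) W \<and> u \<in> W \<and>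
          (\<exists>q. plot X n W q \<and> (\<forall>w\<in>W. p w = r `` {q w}))))\<rparr>"

definition D_open :: "'a dspace \<Rightarrow> 'a set \<Rightarrow> bool" where
  "D_open X A \<longleftrightarrow> A \<subseteq> points X \<and>
     (\<forall>n U p. plot X n U p \<longrightarrow> openin (Euclidean_space n) {u \<in> U. p u \<in> A})"


section \<open>Pseudo-bundles\<close>

record ('v, 'x) pbundle =
  tot :: "'v dspace"
  base :: "'x dspace"
  proj :: "'v \<Rightarrow> 'x"
  vadd :: "'v \<Rightarrow> 'v \<Rightarrow> 'v"
  vscale :: "real \<Rightarrow> 'v \<Rightarrow> 'v"
  vzero :: "'x \<Rightarrow> 'v"

definition over :: "('v, 'x) pbundle \<Rightarrow> 'x set \<Rightarrow> 'v set" where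
  "over V A = {v \<in> points (tot V). proj V v \<in> A}"

abbreviation fibre :: "('v, 'x) pbundle \<Rightarrow> 'x \<Rightarrow> 'v set" where
  "fibre V x \<equiv> over V {x}"

definition real_vector_space_on ::
    "'v set \<Rightarrow> ('v \<Rightarrow> 'v \<Rightarrow> 'v) \<Rightarrow> (real \<Rightarrow> 'v \<Rightarrow> 'v) \<Rightarrow> 'v \<Rightarrow> bool" where
  "real_vector_space_on S pl sm ze \<longleftrightarrow>
     ze \<in> S \<and> (\<forall>v\<in>S. \<forall>w\<in>S. pl v w \<in> S) \<and> (\<forall>a. \<forall>v\<in>S. sm a v \<in> S) \<and>
     (\<forall>u\<in>S. \<forall>v\<in>S. \<forall>w\<in>S. pl (pl u v) w = pl u (pl v w)) \<and>
     (\<forall>v\<in>S. \<forall>w\<in>S. pl v w = pl w v) \<and>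
     (\<forall>v\<in>S. pl ze v = v) \<and> (\<forall>v\<in>S. \<exists>w\<in>S. pl v w = ze) \<and>
     (\<forall>a. \<forall>v\<in>S. \<forall>w\<in>S. sm a (pl v w) = pl (sm a v) (sm a w)) \<and>
     (\<forall>a b. \<forall>v\<in>S. sm (a + b) v = pl (sm a v) (sm b v)) \<and>
     (\<forall>a b. \<forall>v\<in>S. sm a (sm b v) = sm (a * b) v) \<and>
     (\<forall>v\<in>S. sm 1 v = v)"

definition pseudo_bundle :: "('v, 'x) pbundle \<Rightarrow> bool" where
  "pseudo_bundle V \<longleftrightarrow>
     diffeological_space (tot V) \<and> diffeological_space (base V) \<and>
     smooth_map (tot V) (base V) (proj V) \<and> proj V ` points (tot V) = points (base V) \<and>
     (\<forall>x\<in>points (base V). real_vector_space_on (fibre V x) (vadd V) (vscale V) (vzero V x)) \<and>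
     smooth_map (sub_dsp (prod_dsp (tot V) (tot V)) {(v, w). proj V v = proj V w}) (tot V)
       (\<lambda>(v, w). vadd V v w) \<and>
     smooth_map (prod_dsp real_dsp (tot V)) (tot V) (\<lambda>(a, v). vscale V a v) \<and>
     smooth_map (base V) (tot V) (vzero V)"

definition linear_fibre ::
    "('v, 'x) pbundle \<Rightarrow> 'x \<Rightarrow> ('w, 'y) pbundle \<Rightarrow> 'y \<Rightarrow> ('v \<Rightarrow> 'w) \<Rightarrow> bool" where
  "linear_fibre V x W y h \<longleftrightarrow>
     h ` fibre V x \<subseteq> fibre W y \<and>
     (\<forall>v\<in>fibre V x. \<forall>w\<in>fibre V x. h (vadd V v w) = vadd W (h v) (h w)) \<and>
     (\<forall>a. \<forall>v\<in>fibre V x. h (vscale V a v) = vscale W a (h v))"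

text \<open>There is no loss of generality in taking the fibre over the given point as the typical
  fibre of the trivialization.\<close>

definition locally_trivial :: "('v, 'x) pbundle \<Rightarrow> bool" where
  "locally_trivial V \<longleftrightarrow>
     (\<forall>x\<in>points (base V). \<exists>A h. D_open (base V) A \<and> x \<in> A \<and>
        diffeomorphism (sub_dsp (tot V) (over V A))
          (prod_dsp (sub_dsp (base V) A) (sub_dsp (tot V) (fibre V x))) h \<and>
        (\<forall>v\<in>over V A. fst (h v) = proj V v) \<and>
        (\<forall>y\<in>A. linear_fibre V y V x (snd \<circ> h)))"

definition vsum :: "('v, 'x) pbundle \<Rightarrow> 'x \<Rightarrow> 'v list \<Rightarrow> 'v" where
  "vsum V x vs = foldr (vadd V) vs (vzero V x)"

definition is_basis :: "('v, 'x) pbundle \<Rightarrow> 'x \<Rightarrow> 'v set \<Rightarrow> 'v list \<Rightarrow> bool" where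
  "is_basis V x S bs \<longleftrightarrow> set bs \<subseteq> S \<and>
     (\<forall>v\<in>S. \<exists>!cs. length cs = length bs \<and> v = vsum V x (map2 (vscale V) cs bs))"

text \<open>The dimension of a linear subspace \<open>S\<close> of the fibre over \<open>x\<close>, when it is finite.\<close>

definition vdim :: "('v, 'x) pbundle \<Rightarrow> 'x \<Rightarrow> 'v set \<Rightarrow> nat" where
  "vdim V x S = (THE n. \<exists>bs. is_basis V x S bs \<and> length bs = n)"

definition bounded_fibre_dim :: "('v, 'x) pbundle \<Rightarrow> bool" where
  "bounded_fibre_dim V \<longleftrightarrow>
     (\<exists>N. \<forall>x\<in>points (base V). \<exists>bs. is_basis V x (fibre V x) bs \<and> length bs \<le> N)"


subsection \<open>The dual pseudo-bundle\<close>

text \<open>A linear form on the fibre over \<open>x\<close> is tagged with \<open>x\<close> and made extensional. The first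
  condition on plots ensures that the projection of the dual is smooth; without it the zero
  functionals over an arbitrary set-theoretic map into the base would form a plot.\<close>

definition dual :: "('v, 'x) pbundle \<Rightarrow> ('x \<times> ('v \<Rightarrow> real), 'x) pbundle" where
  "dual V =
     (let P = {(x, \<phi>). x \<in> points (base V) \<and> \<phi> \<in> extensional (fibre V x) \<and>
             (\<forall>v\<in>fibre V x. \<forall>w\<in>fibre V x. \<phi> (vadd V v w) = \<phi> v + \<phi> w) \<and>
             (\<forall>a. \<forall>v\<in>fibre V x. \<phi> (vscale V a v) = a * \<phi> v) \<and>
             smooth_map (sub_dsp (tot V) (fibre V x)) real_dsp \<phi>}
      in \<lparr>tot = \<lparr>points = P,
                plot = (\<lambda>m U' q. openin (Euclidean_space m) U' \<and> q ` U' \<subseteq> P \<and>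
                   plot (base V) m U' (fst \<circ> q) \<and>
                   (\<forall>n U p. plot (tot V) n U p \<longrightarrow>
                      smooth_map
                        (sub_dsp (prod_dsp (eucl_dsp m U') (eucl_dsp n U))
                           {(u', u). fst (q u') = proj V (p u)})
                        real_dsp (\<lambda>(u', u). snd (q u') (p u))))\<rparr>,
          base = base V,
          proj = fst,
          vadd = (\<lambda>(x, \<phi>) (_, \<psi>). (x, restrict (\<lambda>v. \<phi> v + \<psi> v) (fibre V x))),
          vscale = (\<lambda>a (x, \<phi>). (x, restrict (\<lambda>v. a * \<phi> v) (fibre V x))),
          vzero = (\<lambda>x. (x, restrict (\<lambda>_. 0) (fibre V x)))\<rparr>)"

text \<open>Pre-composition of a linear form with a map \<open>h\<close> defined on the fibre of \<open>V\<close> over \<open>x\<close>.\<close>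

definition precomp :: "('v, 'x) pbundle \<Rightarrow> 'x \<Rightarrow> ('v \<Rightarrow> 'w) \<Rightarrow> 'y \<times> ('w \<Rightarrow> real) \<Rightarrow> 'x \<times> ('v \<Rightarrow> real)" where
  "precomp V x h \<xi> = (x, restrict (snd \<xi> \<circ> h) (fibre V x))"


subsection \<open>Tensor powers\<close>

text \<open>The \<open>n\<close>-th tensor power of a fibre \<open>E\<close> is the free vector space on \<open>n\<close>-tuples of elements of
  \<open>E\<close> modulo the multilinearity relations. Its elements are cosets, tagged with the base point.\<close>

definition tuples :: "('v, 'x) pbundle \<Rightarrow> 'x \<Rightarrow> nat \<Rightarrow> 'v list set" where
  "tuples V x n = {vs. length vs = n \<and> set vs \<subseteq> fibre V x}"

definition multilin_rels :: "('v, 'x) pbundle \<Rightarrow> 'x \<Rightarrow> nat \<Rightarrow> ('v list \<Rightarrow>\<^sub>0 real) set" where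
  "multilin_rels V x n = span
     ({Poly_Mapping.single (us @ [vadd V v w] @ ws) 1
         - Poly_Mapping.single (us @ [v] @ ws) 1 - Poly_Mapping.single (us @ [w] @ ws) 1 |us v w ws.
         us @ [v] @ ws \<in> tuples V x n \<and> us @ [w] @ ws \<in> tuples V x n} \<union>
      {Poly_Mapping.single (us @ [vscale V c v] @ ws) 1
         - c *\<^sub>R Poly_Mapping.single (us @ [v] @ ws) 1 |us c v ws. us @ [v] @ ws \<in> tuples V x n})"

definition tcoset :: "('v, 'x) pbundle \<Rightarrow> 'x \<Rightarrow> nat \<Rightarrow> ('v list \<Rightarrow>\<^sub>0 real) \<Rightarrow> ('v list \<Rightarrow>\<^sub>0 real) set" where
  "tcoset V x n a = (+) a ` multilin_rels V x n"

definition tens :: "('v, 'x) pbundle \<Rightarrow> 'x \<Rightarrow> 'v list \<Rightarrow> 'x \<times> ('v list \<Rightarrow>\<^sub>0 real) set" where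
  "tens V x vs = (x, tcoset V x (length vs) (Poly_Mapping.single vs 1))"

text \<open>The diffeology is the finest one for which the result is a pseudo-bundle and the map
  \<open>(v\<^sub>1, \<dots>, v\<^sub>n) \<mapsto> v\<^sub>1 \<otimes> \<dots> \<otimes> v\<^sub>n\<close> on the \<open>n\<close>-fold fibre product (the base space, if \<open>n = 0\<close>) is
  smooth, i.e. the intersection of all such diffeologies.\<close>

definition tpow :: "('v, 'x) pbundle \<Rightarrow> nat \<Rightarrow> ('x \<times> ('v list \<Rightarrow>\<^sub>0 real) set, 'x) pbundle" where
  "tpow V n =
     (let mk = (\<lambda>D. \<lparr>
        tot = \<lparr>points = {(x, tcoset V x n a) |x a.
                          x \<in> points (base V) \<and> Poly_Mapping.keys a \<subseteq> tuples V x n},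
               plot = D\<rparr>,
        base = base V,
        proj = fst,
        vadd = (\<lambda>(x, A) (_, B). (x, {a + b |a b. a \<in> A \<and> b \<in> B})),
        vscale = (\<lambda>c (x, A). (x, \<Union>a\<in>A. tcoset V x n (c *\<^sub>R a))),
        vzero = (\<lambda>x. (x, tcoset V x n 0))\<rparr>)
      in mk (\<lambda>m U p. \<forall>D. pseudo_bundle (mk D) \<and>
           (\<forall>k W b qs. plot (base V) k W b \<and> length qs = n \<and>
              (\<forall>q\<in>set qs. plot (tot V) k W q \<and> (\<forall>u\<in>W. proj V (q u) = b u)) \<longrightarrow>
              D k W (\<lambda>u. tens V (b u) (map (\<lambda>q. q u) qs)))
           \<longrightarrow> D m U p))"

definition fmul :: "('v list \<Rightarrow>\<^sub>0 real) \<Rightarrow> ('v list \<Rightarrow>\<^sub>0 real) \<Rightarrow> ('v list \<Rightarrow>\<^sub>0 real)" where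
  "fmul a b = (\<Sum>k\<in>Poly_Mapping.keys a. \<Sum>l\<in>Poly_Mapping.keys b.
     Poly_Mapping.single (k @ l) (Poly_Mapping.lookup a k * Poly_Mapping.lookup b l))"

definition tpow_mul :: "('v, 'x) pbundle \<Rightarrow> nat \<Rightarrow> nat \<Rightarrow>
    'x \<times> ('v list \<Rightarrow>\<^sub>0 real) set \<Rightarrow> 'x \<times> ('v list \<Rightarrow>\<^sub>0 real) set \<Rightarrow> 'x \<times> ('v list \<Rightarrow>\<^sub>0 real) set" where
  "tpow_mul V m n = (\<lambda>(x, A) (_, B). (x, \<Union>a\<in>A. \<Union>b\<in>B. tcoset V x (m + n) (fmul a b)))"

text \<open>Maps of pseudo-bundles are given by their action on total spaces; the map of base spaces that
  a fibrewise linear map \<open>h\<close> covers is recovered from its values on the zero section.\<close>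

definition base_map :: "('v, 'x) pbundle \<Rightarrow> ('w, 'y) pbundle \<Rightarrow> ('v \<Rightarrow> 'w) \<Rightarrow> 'x \<Rightarrow> 'y" where
  "base_map V W h x = proj W (h (vzero V x))"

definition push :: "('v \<Rightarrow> 'w) \<Rightarrow> ('v list \<Rightarrow>\<^sub>0 real) \<Rightarrow> ('w list \<Rightarrow>\<^sub>0 real)" where
  "push h a = (\<Sum>k\<in>Poly_Mapping.keys a. Poly_Mapping.single (map h k) (Poly_Mapping.lookup a k))"

definition tpow_map :: "('v, 'x) pbundle \<Rightarrow> ('w, 'y) pbundle \<Rightarrow> nat \<Rightarrow> ('v \<Rightarrow> 'w) \<Rightarrow>
    'x \<times> ('v list \<Rightarrow>\<^sub>0 real) set \<Rightarrow> 'y \<times> ('w list \<Rightarrow>\<^sub>0 real) set" where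
  "tpow_map V W n h = (\<lambda>(x, A).
     let y = base_map V W h x in (y, \<Union>a\<in>A. tcoset W y n (push h a)))"


subsection \<open>Direct sums\<close>

text \<open>All \<open>W n\<close> have the same base. A plot of the direct sum takes values, locally, in a finite
  partial sum, which carries the subset diffeology of the fibre product.\<close>

definition dsum :: "(nat \<Rightarrow> ('t, 'x) pbundle) \<Rightarrow> ('x \<times> (nat \<Rightarrow> 't), 'x) pbundle" where
  "dsum W =
     (let P = {(x, s). x \<in> points (base (W 0)) \<and> (\<forall>n. s n \<in> fibre (W n) x) \<and>
                       finite {n. s n \<noteq> vzero (W n) x}}
      in \<lparr>tot = \<lparr>points = P,
                plot = (\<lambda>m U p. openin (Euclidean_space m) U \<and> p ` U \<subseteq> P \<and>
                   plot (base (W 0)) m U (fst \<circ> p) \<and>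
                   (\<forall>n. plot (tot (W n)) m U (\<lambda>u. snd (p u) n)) \<and>
                   (\<forall>u\<in>U. \<exists>U'\<subseteq>U. openin (Euclidean_space m) U' \<and> u \<in> U' \<and>
                      (\<exists>N. \<forall>w\<in>U'. \<forall>n\<ge>N. snd (p w) n = vzero (W n) (fst (p w)))))\<rparr>,
          base = base (W 0),
          proj = fst,
          vadd = (\<lambda>(x, s) (_, t). (x, \<lambda>n. vadd (W n) (s n) (t n))),
          vscale = (\<lambda>a (x, s). (x, \<lambda>n. vscale (W n) a (s n))),
          vzero = (\<lambda>x. (x, \<lambda>n. vzero (W n) x))\<rparr>)"

definition dsum_in :: "(nat \<Rightarrow> ('t, 'x) pbundle) \<Rightarrow> nat \<Rightarrow> 't \<Rightarrow> 'x \<times> (nat \<Rightarrow> 't)" where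
  "dsum_in W n t =
     (let x = proj (W n) t in (x, \<lambda>m. if m = n then t else vzero (W m) x))"

definition dsum_map :: "(nat \<Rightarrow> ('t, 'y) pbundle) \<Rightarrow> (nat \<Rightarrow> 's \<Rightarrow> 't) \<Rightarrow>
    'x \<times> (nat \<Rightarrow> 's) \<Rightarrow> 'y \<times> (nat \<Rightarrow> 't)" where
  "dsum_map W h = (\<lambda>(x, s). (proj (W 0) (h 0 (s 0)), \<lambda>n. h n (s n)))"


subsection \<open>Pseudo-metrics\<close>

text \<open>An element of \<open>E\<^sup>* \<otimes> E\<^sup>*\<close> is identified with the bilinear form on \<open>E\<close> it induces, so that
  sections of \<open>V\<^sup>* \<otimes> V\<^sup>*\<close> are families of forms.\<close>

definition form_of :: "'x \<times> (('x \<times> ('v \<Rightarrow> real)) list \<Rightarrow>\<^sub>0 real) set \<Rightarrow> 'v \<Rightarrow> 'v \<Rightarrow> real" where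
  "form_of s v w = (THE r. \<exists>a\<in>snd s.
     r = (\<Sum>k\<in>Poly_Mapping.keys a. Poly_Mapping.lookup a k * snd (k ! 0) v * snd (k ! 1) w))"

definition Psi :: "('v, 'x) pbundle \<Rightarrow> ('x \<Rightarrow> 'v \<Rightarrow> 'v \<Rightarrow> real) \<Rightarrow> 'v \<Rightarrow> 'x \<times> ('v \<Rightarrow> real)" where
  "Psi V g v = (proj V v, restrict (g (proj V v) v) (fibre V (proj V v)))"

definition pseudo_metric :: "('v, 'x) pbundle \<Rightarrow> ('x \<Rightarrow> 'v \<Rightarrow> 'v \<Rightarrow> real) \<Rightarrow> bool" where
  "pseudo_metric V g \<longleftrightarrow>
     (\<exists>s. smooth_map (base V) (tot (tpow (dual V) 2)) s \<and>
          (\<forall>x\<in>points (base V). proj (tpow (dual V) 2) (s x) = x \<and>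
             (\<forall>v\<in>fibre V x. \<forall>w\<in>fibre V x. g x v w = form_of (s x) v w))) \<and>
     (\<forall>x\<in>points (base V).
        (\<forall>v\<in>fibre V x. \<forall>w\<in>fibre V x. g x v w = g x w v) \<and>
        (\<forall>v\<in>fibre V x. 0 \<le> g x v v) \<and>
        vdim (dual V) x (Psi V g ` fibre V x) = vdim (dual V) x (fibre (dual V) x))"

definition dual_metric :: "('v, 'x) pbundle \<Rightarrow> ('x \<Rightarrow> 'v \<Rightarrow> 'v \<Rightarrow> real) \<Rightarrow>
    'x \<Rightarrow> 'x \<times> ('v \<Rightarrow> real) \<Rightarrow> 'x \<times> ('v \<Rightarrow> real) \<Rightarrow> real" where
  "dual_metric V g x \<phi> \<psi> =
     (THE r. \<exists>v\<in>fibre V x. \<exists>w\<in>fibre V x. Psi V g v = \<phi> \<and> Psi V g w = \<psi> \<and> r = g x v w)"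


subsection \<open>Clifford algebras\<close>

abbreviation talg :: "('v, 'x) pbundle \<Rightarrow>
    ('x \<times> (nat \<Rightarrow> 'x \<times> ('v list \<Rightarrow>\<^sub>0 real) set), 'x) pbundle" where
  "talg V \<equiv> dsum (tpow V)"

definition talg_mul :: "('v, 'x) pbundle \<Rightarrow>
    'x \<times> (nat \<Rightarrow> 'x \<times> ('v list \<Rightarrow>\<^sub>0 real) set) \<Rightarrow> 'x \<times> (nat \<Rightarrow> 'x \<times> ('v list \<Rightarrow>\<^sub>0 real) set) \<Rightarrow>
    'x \<times> (nat \<Rightarrow> 'x \<times> ('v list \<Rightarrow>\<^sub>0 real) set)" where
  "talg_mul V = (\<lambda>(x, s) (_, t).
     (x, \<lambda>n. vsum (tpow V n) x (map (\<lambda>i. tpow_mul V i (n - i) (s i) (t (n - i))) [0..<Suc n])))"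

definition talg_tens :: "('v, 'x) pbundle \<Rightarrow> 'x \<Rightarrow> 'v list \<Rightarrow>
    'x \<times> (nat \<Rightarrow> 'x \<times> ('v list \<Rightarrow>\<^sub>0 real) set)" where
  "talg_tens V x vs = dsum_in (tpow V) (length vs) (tens V x vs)"

definition talg_map :: "('v, 'x) pbundle \<Rightarrow> ('w, 'y) pbundle \<Rightarrow> ('v \<Rightarrow> 'w) \<Rightarrow>
    'x \<times> (nat \<Rightarrow> 'x \<times> ('v list \<Rightarrow>\<^sub>0 real) set) \<Rightarrow> 'y \<times> (nat \<Rightarrow> 'y \<times> ('w list \<Rightarrow>\<^sub>0 real) set)" where
  "talg_map V W h = dsum_map (tpow W) (\<lambda>n. tpow_map V W n h)"

definition cl_relator where
  "cl_relator V g x v w =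
     vadd (talg V) (talg_mul V (talg_tens V x [v]) (talg_tens V x [w]))
       (vadd (talg V) (talg_mul V (talg_tens V x [w]) (talg_tens V x [v]))
          (vscale (talg V) (2 * g x v w) (talg_tens V x [])))"

inductive_set cl_ideal ::
    "('v, 'x) pbundle \<Rightarrow> ('x \<Rightarrow> 'v \<Rightarrow> 'v \<Rightarrow> real) \<Rightarrow> 'x \<Rightarrow>
     ('x \<times> (nat \<Rightarrow> 'x \<times> ('v list \<Rightarrow>\<^sub>0 real) set)) set"
  for V :: "('v, 'x) pbundle" and g :: "'x \<Rightarrow> 'v \<Rightarrow> 'v \<Rightarrow> real" and x :: 'x where
  zero: "vzero (talg V) x \<in> cl_ideal V g x"
| gen: "\<lbrakk>a \<in> fibre (talg V) x; b \<in> fibre (talg V) x; v \<in> fibre V x; w \<in> fibre V x\<rbrakk>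
         \<Longrightarrow> talg_mul V (talg_mul V a (cl_relator V g x v w)) b \<in> cl_ideal V g x"
| add: "\<lbrakk>s \<in> cl_ideal V g x; t \<in> cl_ideal V g x\<rbrakk> \<Longrightarrow> vadd (talg V) s t \<in> cl_ideal V g x"

definition cl_eqv :: "('v, 'x) pbundle \<Rightarrow> ('x \<Rightarrow> 'v \<Rightarrow> 'v \<Rightarrow> real) \<Rightarrow>
    (('x \<times> (nat \<Rightarrow> 'x \<times> ('v list \<Rightarrow>\<^sub>0 real) set)) \<times> ('x \<times> (nat \<Rightarrow> 'x \<times> ('v list \<Rightarrow>\<^sub>0 real) set))) set" where
  "cl_eqv V g = {(s, vadd (talg V) s t) |s t.
     s \<in> points (tot (talg V)) \<and> t \<in> cl_ideal V g (proj (talg V) s)}"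

definition cl :: "('v, 'x) pbundle \<Rightarrow> ('x \<Rightarrow> 'v \<Rightarrow> 'v \<Rightarrow> real) \<Rightarrow>
    (('x \<times> (nat \<Rightarrow> 'x \<times> ('v list \<Rightarrow>\<^sub>0 real) set)) set, 'x) pbundle" where
  "cl V g = \<lparr>tot = quot_dsp (tot (talg V)) (cl_eqv V g),
     base = base V,
     proj = (\<lambda>C. the_elem (proj (talg V) ` C)),
     vadd = (\<lambda>C D. \<Union>s\<in>C. \<Union>t\<in>D. cl_eqv V g `` {vadd (talg V) s t}),
     vscale = (\<lambda>a C. \<Union>s\<in>C. cl_eqv V g `` {vscale (talg V) a s}),
     vzero = (\<lambda>x. cl_eqv V g `` {vzero (talg V) x})\<rparr>"

definition cl_mul where
  "cl_mul V g C D = (\<Union>s\<in>C. \<Union>t\<in>D. cl_eqv V g `` {talg_mul V s t})"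

definition cl_one where
  "cl_one V g x = cl_eqv V g `` {talg_tens V x []}"

definition cl_vec where
  "cl_vec V g v = cl_eqv V g `` {talg_tens V (proj V v) [v]}"

text \<open>The fibrewise algebra homomorphism into \<open>cl W g'\<close> induced by a fibrewise linear map
  \<open>h\<close> from \<open>V\<close> to \<open>W\<close> that preserves the forms.\<close>

definition cl_map where
  "cl_map V W g' h C = (\<Union>t\<in>C. cl_eqv W g' `` {talg_map V W h t})"


subsection \<open>Exterior algebras\<close>

definition alt :: "nat \<Rightarrow> ('v list \<Rightarrow>\<^sub>0 real) \<Rightarrow> ('v list \<Rightarrow>\<^sub>0 real)" where
  "alt n a = (1 / fact n) *\<^sub>R (\<Sum>\<sigma> | \<sigma> permutes {..<n}. of_int (sign \<sigma>) *\<^sub>R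
     (\<Sum>k\<in>Poly_Mapping.keys a. Poly_Mapping.single (permute_list \<sigma> k) (Poly_Mapping.lookup a k)))"

definition Alt :: "('v, 'x) pbundle \<Rightarrow> nat \<Rightarrow>
    'x \<times> ('v list \<Rightarrow>\<^sub>0 real) set \<Rightarrow> 'x \<times> ('v list \<Rightarrow>\<^sub>0 real) set" where
  "Alt V n = (\<lambda>(x, A). (x, \<Union>a\<in>A. tcoset V x n (alt n a)))"

definition ext_pow :: "('v, 'x) pbundle \<Rightarrow> nat \<Rightarrow> ('x \<times> ('v list \<Rightarrow>\<^sub>0 real) set, 'x) pbundle" where
  "ext_pow V n = (tpow V n)\<lparr>tot :=
     sub_dsp (tot (tpow V n)) (Alt V n ` points (tot (tpow V n)))\<rparr>"

text \<open>The exterior powers beyond the fibre dimension vanish, so no upper bound on the degree is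
  needed.\<close>

definition ext :: "('v, 'x) pbundle \<Rightarrow> ('x \<times> (nat \<Rightarrow> 'x \<times> ('v list \<Rightarrow>\<^sub>0 real) set), 'x) pbundle" where
  "ext V = dsum (ext_pow V)"

definition wedge :: "('v, 'x) pbundle \<Rightarrow> 'x \<Rightarrow> 'v list \<Rightarrow>
    'x \<times> (nat \<Rightarrow> 'x \<times> ('v list \<Rightarrow>\<^sub>0 real) set)" where
  "wedge V x vs = dsum_in (ext_pow V) (length vs) (Alt V (length vs) (tens V x vs))"


subsection \<open>The standard Clifford action\<close>

text \<open>In the sum, \<open>j\<close> counts from \<open>0\<close>, whence the sign \<open>(-1)\<^sup>j\<close>.\<close>

definition is_standard_clifford_action where
  "is_standard_clifford_action V g c \<longleftrightarrow> (\<forall>x\<in>points (base V).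
     (\<forall>C\<in>fibre (cl V g) x. linear_fibre (ext V) x (ext V) x (c C)) \<and>
     (\<forall>e\<in>fibre (ext V) x.
        (\<forall>C\<in>fibre (cl V g) x. \<forall>D\<in>fibre (cl V g) x.
           c (vadd (cl V g) C D) e = vadd (ext V) (c C e) (c D e) \<and>
           c (cl_mul V g C D) e = c C (c D e)) \<and>
        (\<forall>a. \<forall>C\<in>fibre (cl V g) x. c (vscale (cl V g) a C) e = vscale (ext V) a (c C e)) \<and>
        c (cl_one V g x) e = e) \<and>
     (\<forall>v\<in>fibre V x. \<forall>vs. set vs \<subseteq> fibre V x \<longrightarrow>
        c (cl_vec V g v) (wedge V x vs) =
          vadd (ext V) (wedge V x (v # vs))
            (vscale (ext V) (- 1)
              (vsum (ext V) x
                (map (\<lambda>j. vscale (ext V) ((- 1) ^ j * g x v (vs ! j))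
                             (wedge V x (take j vs @ drop (Suc j) vs))) [0..<length vs])))))"

text \<open>The defining conditions determine the values of the action on each pair consisting of
  a Clifford element and an exterior element over the same point.\<close>

definition clifford_action where
  "clifford_action V g = (SOME c. is_standard_clifford_action V g c)"


section \<open>Gluing\<close>

definition glue_rel :: "'a set \<Rightarrow> ('a \<Rightarrow> 'b) \<Rightarrow> (('a + 'b) \<times> ('a + 'b)) set" where
  "glue_rel D h = (let r = {(Inl a, Inr (h a)) |a. a \<in> D} in (r \<union> r\<inverse>)\<^sup>*)"

definition glue_dsp :: "'a dspace \<Rightarrow> 'b dspace \<Rightarrow> 'a set \<Rightarrow> ('a \<Rightarrow> 'b) \<Rightarrow> ('a + 'b) set dspace" where
  "glue_dsp X Y D h = quot_dsp (sum_dsp X Y) (glue_rel D h)"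

text \<open>The natural inclusions \<open>in1\<close> (used on \<open>Z\<^sub>1 - D\<close>) and \<open>in2\<close> (used on \<open>Z\<^sub>2\<close>) and their
  inverses \<open>out1\<close> and \<open>out2\<close>. The arguments \<open>S\<close> are the underlying sets of \<open>Z\<^sub>1\<close> or \<open>Z\<^sub>2\<close>.\<close>

definition in1 :: "'a set \<Rightarrow> ('a \<Rightarrow> 'b) \<Rightarrow> 'a \<Rightarrow> ('a + 'b) set" where
  "in1 D h a = glue_rel D h `` {Inl a}"

definition in2 :: "'a set \<Rightarrow> ('a \<Rightarrow> 'b) \<Rightarrow> 'b \<Rightarrow> ('a + 'b) set" where
  "in2 D h b = glue_rel D h `` {Inr b}"

definition out1 :: "'a set \<Rightarrow> 'a set \<Rightarrow> ('a \<Rightarrow> 'b) \<Rightarrow> ('a + 'b) set \<Rightarrow> 'a" where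
  "out1 S D h = the_inv_into (S - D) (in1 D h)"

definition out2 :: "'b set \<Rightarrow> 'a set \<Rightarrow> ('a \<Rightarrow> 'b) \<Rightarrow> ('a + 'b) set \<Rightarrow> 'b" where
  "out2 S D h = the_inv_into S (in2 D h)"

definition pb_glue :: "('v, 'x) pbundle \<Rightarrow> ('w, 'y) pbundle \<Rightarrow> 'x set \<Rightarrow> ('x \<Rightarrow> 'y) \<Rightarrow> ('v \<Rightarrow> 'w) \<Rightarrow>
    (('v + 'w) set, ('x + 'y) set) pbundle" where
  "pb_glue V W D f F =
     (let SV = points (tot V); SW = points (tot W); DV = over V D;
          j1 = in1 DV F; j2 = in2 DV F; k1 = out1 SV DV F; k2 = out2 SW DV F
      in \<lparr>tot = glue_dsp (tot V) (tot W) DV F,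
          base = glue_dsp (base V) (base W) D f,
          proj = (\<lambda>c. the_elem ((\<lambda>z. glue_rel D f `` {map_sum (proj V) (proj W) z}) ` c)),
          vadd = (\<lambda>c d. if c \<in> j1 ` (SV - DV) then j1 (vadd V (k1 c) (k1 d))
                        else j2 (vadd W (k2 c) (k2 d))),
          vscale = (\<lambda>a c. if c \<in> j1 ` (SV - DV) then j1 (vscale V a (k1 c))
                          else j2 (vscale W a (k2 c))),
          vzero = (\<lambda>b. if b \<in> in1 D f ` (points (base V) - D)
                       then j1 (vzero V (out1 (points (base V)) D f b))
                       else j2 (vzero W (out2 (points (base W)) D f b)))\<rparr>)"

abbreviation pb_in1 :: "('v, 'x) pbundle \<Rightarrow> 'x set \<Rightarrow> ('v \<Rightarrow> 'w) \<Rightarrow> 'v \<Rightarrow> ('v + 'w) set" where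
  "pb_in1 V D F \<equiv> in1 (over V D) F"

abbreviation pb_in2 :: "('v, 'x) pbundle \<Rightarrow> 'x set \<Rightarrow> ('v \<Rightarrow> 'w) \<Rightarrow> 'w \<Rightarrow> ('v + 'w) set" where
  "pb_in2 V D F \<equiv> in2 (over V D) F"

abbreviation pb_out1 :: "('v, 'x) pbundle \<Rightarrow> 'x set \<Rightarrow> ('v \<Rightarrow> 'w) \<Rightarrow> ('v + 'w) set \<Rightarrow> 'v" where
  "pb_out1 V D F \<equiv> out1 (points (tot V)) (over V D) F"

abbreviation pb_out2 ::
    "('v, 'x) pbundle \<Rightarrow> ('w, 'y) pbundle \<Rightarrow> 'x set \<Rightarrow> ('v \<Rightarrow> 'w) \<Rightarrow> ('v + 'w) set \<Rightarrow> 'w" where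
  "pb_out2 V W D F \<equiv> out2 (points (tot W)) (over V D) F"

definition is_gluing :: "('v, 'x) pbundle \<Rightarrow> ('w, 'y) pbundle \<Rightarrow> 'x set \<Rightarrow> ('x \<Rightarrow> 'y) \<Rightarrow> ('v \<Rightarrow> 'w) \<Rightarrow> bool" where
  "is_gluing V1 V2 Y f F \<longleftrightarrow>
     Y \<subseteq> points (base V1) \<and> smooth_map (sub_dsp (base V1) Y) (base V2) f \<and>
     smooth_map (sub_dsp (tot V1) (over V1 Y)) (tot V2) F \<and>
     (\<forall>y\<in>Y. linear_fibre V1 y V2 (f y) F)"

definition compatible :: "('v, 'x) pbundle \<Rightarrow> 'x set \<Rightarrow> ('x \<Rightarrow> 'y) \<Rightarrow> ('v \<Rightarrow> 'w) \<Rightarrow>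
    ('x \<Rightarrow> 'v \<Rightarrow> 'v \<Rightarrow> real) \<Rightarrow> ('y \<Rightarrow> 'w \<Rightarrow> 'w \<Rightarrow> real) \<Rightarrow> bool" where
  "compatible V1 Y f F g1 g2 \<longleftrightarrow>
     (\<forall>y\<in>Y. \<forall>v\<in>fibre V1 y. \<forall>w\<in>fibre V1 y. g1 y v w = g2 (f y) (F v) (F w))"

text \<open>The map \<open>F\<^sup>*\<close> of duals, covering the inverse of \<open>f\<close> on its image.\<close>

definition Fstar :: "('v, 'x) pbundle \<Rightarrow> 'x set \<Rightarrow> ('x \<Rightarrow> 'y) \<Rightarrow> ('v \<Rightarrow> 'w) \<Rightarrow>
    'y \<times> ('w \<Rightarrow> real) \<Rightarrow> 'x \<times> ('v \<Rightarrow> real)" where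
  "Fstar V1 Y f F \<xi> = precomp V1 (the_inv_into Y f (fst \<xi>)) F \<xi>"

context
  fixes V1 :: "('v1, 'x1) pbundle" and V2 :: "('v2, 'x2) pbundle"
    and Y :: "'x1 set" and f :: "'x1 \<Rightarrow> 'x2" and F :: "'v1 \<Rightarrow> 'v2"
begin

text \<open>\<open>V\<^sub>1 \<union> V\<^sub>2\<close> and \<open>V\<^sub>2\<^sup>* \<union> V\<^sub>1\<^sup>*\<close>.\<close>

definition glued :: "(('v1 + 'v2) set, ('x1 + 'x2) set) pbundle" where
  "glued = pb_glue V1 V2 Y f F"

definition glued_duals where
  "glued_duals = pb_glue (dual V2) (dual V1) (f ` Y) (the_inv_into Y f) (Fstar V1 Y f F)"

text \<open>Whether a point of \<open>X\<^sub>2 \<union> X\<^sub>1\<close>, glued along the inverse of \<open>f\<close>, comes from \<open>X\<^sub>2 - f(Y)\<close>.\<close>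

definition on_left :: "('x2 + 'x1) set \<Rightarrow> bool" where
  "on_left b \<longleftrightarrow> b \<in> in1 (f ` Y) (the_inv_into Y f) ` (points (base V2) - f ` Y)"

definition Phi_dual ::
    "('x1 + 'x2) set \<times> (('v1 + 'v2) set \<Rightarrow> real) \<Rightarrow>
     (('x2 \<times> ('v2 \<Rightarrow> real)) + ('x1 \<times> ('v1 \<Rightarrow> real))) set" where
  "Phi_dual \<xi> =
     (let b = fst \<xi>;
          j1 = pb_in1 (dual V2) (f ` Y) (Fstar V1 Y f F);
          j2 = pb_in2 (dual V2) (f ` Y) (Fstar V1 Y f F)
      in if b \<in> in1 Y f ` (points (base V1) - Y)
         then j2 (precomp V1 (out1 (points (base V1)) Y f b) (pb_in1 V1 Y F) \<xi>)
         else let z = out2 (points (base V2)) Y f b;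
                  \<eta> = precomp V2 z (pb_in2 V1 Y F) \<xi>
              in if z \<in> f ` Y then j2 (Fstar V1 Y f F \<eta>) else j1 \<eta>)"

text \<open>\<open>\<And>(V\<^sub>1 \<union> V\<^sub>2)\<close>, and the gluing of \<open>\<And>(V\<^sub>2)\<close> to \<open>\<And>(V\<^sub>1)\<close>.\<close>

definition ext_glued where
  "ext_glued = ext (dual glued)"

definition F_ext where
  "F_ext = talg_map (dual V2) (dual V1) (Fstar V1 Y f F)"

definition glued_exts where
  "glued_exts = pb_glue (ext (dual V2)) (ext (dual V1)) (f ` Y) (the_inv_into Y f) F_ext"

definition Phi_dual_ext where
  "Phi_dual_ext = restrict (talg_map (dual glued) glued_duals Phi_dual) (points (tot ext_glued))"

definition F_tpow where
  "F_tpow n = tpow_map (dual V2) (dual V1) n (Fstar V1 Y f F)"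

definition glued_tpows where
  "glued_tpows n =
     pb_glue (tpow (dual V2) n) (tpow (dual V1) n) (f ` Y) (the_inv_into Y f) (F_tpow n)"

definition Phi_tens where
  "Phi_tens n t =
     (if on_left (proj (tpow glued_duals n) t)
      then pb_in1 (tpow (dual V2) n) (f ` Y) (F_tpow n)
             (the_inv_into (over (tpow (dual V2) n) (points (base V2) - f ` Y))
                (tpow_map (dual V2) glued_duals n
                   (pb_in1 (dual V2) (f ` Y) (Fstar V1 Y f F))) t)
      else pb_in2 (tpow (dual V2) n) (f ` Y) (F_tpow n)
             (the_inv_into (points (tot (tpow (dual V1) n)))
                (tpow_map (dual V1) glued_duals n
                   (pb_in2 (dual V2) (f ` Y) (Fstar V1 Y f F))) t))"

text \<open>\<open>F_ext\<close>, being the direct sum of the \<open>F_tpow n\<close>, is here the gluing map of tensor algebras.\<close>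

definition Phi_sum where
  "Phi_sum = (\<lambda>(b, s).
     if on_left b
     then pb_in1 (talg (dual V2)) (f ` Y) F_ext
            (out1 (points (base V2)) (f ` Y) (the_inv_into Y f) b,
             \<lambda>n. pb_out1 (tpow (dual V2) n) (f ` Y) (F_tpow n) (s n))
     else pb_in2 (talg (dual V2)) (f ` Y) F_ext
            (out2 (points (base V1)) (f ` Y) (the_inv_into Y f) b,
             \<lambda>n. pb_out2 (tpow (dual V2) n) (tpow (dual V1) n) (f ` Y) (F_tpow n) (s n)))"

definition Phi_ext where
  "Phi_ext = restrict
     (Phi_sum \<circ>
      dsum_map glued_tpows (\<lambda>n. Phi_tens n \<circ> tpow_map (dual glued) glued_duals n Phi_dual))
     (points (tot ext_glued))"

context
  fixes g1 :: "'x1 \<Rightarrow> 'v1 \<Rightarrow> 'v1 \<Rightarrow> real" and g2 :: "'x2 \<Rightarrow> 'v2 \<Rightarrow> 'v2 \<Rightarrow> real"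
begin

definition glued_dual_metric where
  "glued_dual_metric b \<xi> \<eta> =
     (if on_left b
      then let k1 = pb_out1 (dual V2) (f ` Y) (Fstar V1 Y f F)
           in dual_metric V2 g2 (out1 (points (base V2)) (f ` Y) (the_inv_into Y f) b) (k1 \<xi>) (k1 \<eta>)
      else let k2 = pb_out2 (dual V2) (dual V1) (f ` Y) (Fstar V1 Y f F)
           in dual_metric V1 g1 (out2 (points (base V1)) (f ` Y) (the_inv_into Y f) b) (k2 \<xi>) (k2 \<eta>))"

abbreviation "cl1 \<equiv> cl (dual V1) (dual_metric V1 g1)"
abbreviation "cl2 \<equiv> cl (dual V2) (dual_metric V2 g2)"

definition F_cl where
  "F_cl = cl_map (dual V2) (dual V1) (dual_metric V1 g1) (Fstar V1 Y f F)"

definition glued_cls where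
  "glued_cls = pb_glue cl2 cl1 (f ` Y) (the_inv_into Y f) F_cl"

definition Phi_cl where
  "Phi_cl C =
     (if on_left (proj glued_cls C)
      then cl_map (dual V2) glued_duals glued_dual_metric
             (pb_in1 (dual V2) (f ` Y) (Fstar V1 Y f F)) (pb_out1 cl2 (f ` Y) F_cl C)
      else cl_map (dual V1) glued_duals glued_dual_metric
             (pb_in2 (dual V2) (f ` Y) (Fstar V1 Y f F)) (pb_out2 cl2 cl1 (f ` Y) F_cl C))"

text \<open>The action on the glued exterior algebras that is obtained by gluing the standard ones.\<close>

definition glued_action where
  "glued_action C e =
     (if on_left (proj glued_cls C)
      then pb_in1 (ext (dual V2)) (f ` Y) F_ext
             (clifford_action (dual V2) (dual_metric V2 g2)
                (pb_out1 cl2 (f ` Y) F_cl C)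
                (pb_out1 (ext (dual V2)) (f ` Y) F_ext e))
      else pb_in2 (ext (dual V2)) (f ` Y) F_ext
             (clifford_action (dual V1) (dual_metric V1 g1)
                (pb_out2 cl2 cl1 (f ` Y) F_cl C)
                (pb_out2 (ext (dual V2)) (ext (dual V1)) (f ` Y) F_ext e)))"

end

end

end

theory Submission
  imports Defs
begin

text \<open>The standard Clifford action is natural under form-preserving linear maps of fibres, and all
  maps in the statement are fibrewise induced by such maps. To see this, all algebras of a fibre
  \<open>E\<close> are written as quotients of the free algebra on the elements of \<open>E\<close>. There the action is an
  explicit operator, composed of concatenation and contraction, which respects the relations
  defining the tensor, exterior and Clifford algebras. This proves that a standard action exists;
  it is unique because vectors generate the Clifford algebra and decomposable elements span the
  exterior algebra, and the explicit formula is visibly natural.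

  It remains to see that the map of duals is a fibrewise isomorphism. Over the domain of gluing this
  needs the pull-back \<open>F\<^sup>*\<close> of forms to be onto; it is, because by compatibility every form
  \<open>g\<^sub>1(v, \<cdot>)\<close> is the pull-back of \<open>g\<^sub>2(F v, \<cdot>)\<close>, and by the rank condition these exhaust the dual.\<close>

section \<open>Smooth functions on open subsets of Euclidean spaces\<close>

text \<open>Products, induced maps and projections are defined as unions over all representatives;
  inverses, dimensions and the action itself by choice operators. None of them can be computed
  before independence of representatives or uniqueness is known. On the free algebra this becomes
  manageable, since operators there are linear extensions of their values on words. All signs and
  permutations stay at that level.

  Smoothness matters through the duals, whose elements are smooth forms. A form on a fibre of a
  gluing has to be recognised as smooth from one piece, and plots of a gluing lift to the pieces
  only locally; hence the local nature of smoothness comes into play.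

  Two mismatches shape the rest. The rank condition compares dimensions obtained by counting bases
  inside a carrier set, so fibres are transferred to a real vector space. And \<open>Phi_ext\<close>
  yields classes of the gluing of tensor algebras, which must be recognised as classes of the gluing
  of exterior algebras.\<close>

lemma has_real_derivative_transform_line:
  assumes "openin (Euclidean_space n) U" "u \<in> U" "i < n" "\<And>w. w \<in> U \<Longrightarrow> f w = g w"
    and "((\<lambda>t. f (u(i := t))) has_real_derivative d) (at (u i))"
  shows "((\<lambda>t. g (u(i := t))) has_real_derivative d) (at (u i))"
proof -
  have top: "u(i := t) \<in> topspace (Euclidean_space n)" for t
    using openin_subset[OF assms(1)] assms(2,3) by (auto simp: topspace_Euclidean_space)
  \<comment> \<open>Changing a coordinate \<open>i < n\<close> stays in the space of sequences that
    vanish from \<open>n\<close> on, so the line through \<open>u\<close> is a continuous map into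
    it. The parameters landing in \<open>U\<close> form an open set, on which \<open>f\<close> and
    \<open>g\<close> agree.\<close>
  have "continuous_map euclideanreal (Euclidean_space n) (\<lambda>t. u(i := t))"
    using top unfolding Euclidean_space_def
    by (subst continuous_map_in_subtopology)
      (auto simp: continuous_map_componentwise_UNIV Euclidean_space_def intro!: continuous_intros)
  from openin_continuous_map_preimage[OF this assms(1)]
  have "open {t. u(i := t) \<in> U}" by simp
  then show ?thesis
    by (rule has_field_derivative_transform_within_open[OF assms(5)]) (use assms in auto)
qed

text \<open>\<open>C_diff\<close> differentiates total functions, and openness of \<open>U\<close>
  makes these derivatives depend on the values in \<open>U\<close> only. The witnesses
  \<open>f'\<close> carry over unchanged, hence cases on \<open>k\<close> instead of an
  induction.\<close>

lemma C_diff_cong: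
  assumes "C_diff k n U f" "openin (Euclidean_space n) U" "\<And>w. w \<in> U \<Longrightarrow> f w = g w"
  shows "C_diff k n U g"
proof -
  have cont: "continuous_map (subtopology (Euclidean_space n) U) euclideanreal f \<Longrightarrow>
        continuous_map (subtopology (Euclidean_space n) U) euclideanreal g"
    by (erule continuous_map_eq) (use assms(3) in auto)
  show ?thesis
  proof (cases k)
    case 0
    then show ?thesis using assms cont by simp
  next
    case (Suc k')
    show ?thesis
      unfolding Suc C_diff.simps
    proof (intro conjI allI impI)
      show "continuous_map (subtopology (Euclidean_space n) U) euclideanreal g"
        using assms Suc cont by simp
      fix i assume i: "i < n"
      then obtain f' where "\<forall>u\<in>U. ((\<lambda>t. f (u(i := t))) has_real_derivative f' u) (at (u i))"
        "C_diff k' n U f'" using assms(1) Suc by auto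
      then show "\<exists>f'. (\<forall>u\<in>U. ((\<lambda>t. g (u(i := t))) has_real_derivative f' u) (at (u i))) \<and>
                 C_diff k' n U f'"
        using has_real_derivative_transform_line[OF assms(2) _ i, where f = f and g = g] assms(3)
        by blast
    qed
  qed
qed

lemma C_diff_local:
  assumes "openin (Euclidean_space n) U"
    and "\<And>u. u \<in> U \<Longrightarrow> \<exists>W\<subseteq>U. openin (Euclidean_space n) W \<and> u \<in> W \<and> C_diff k n W f"
  shows "C_diff k n U f"
  using assms(2)
proof (induction k arbitrary: f)
  have pasting: "continuous_map (subtopology (Euclidean_space n) U) euclideanreal f"
    if loc: "\<And>u. u \<in> U \<Longrightarrow> \<exists>W\<subseteq>U. openin (Euclidean_space n) W \<and> u \<in> W \<and>
      continuous_map (subtopology (Euclidean_space n) W) euclideanreal f" for f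
  proof -
    let ?I = "{W. W \<subseteq> U \<and> openin (Euclidean_space n) W \<and>
      continuous_map (subtopology (Euclidean_space n) W) euclideanreal f}"
    show ?thesis
    proof (rule pasting_lemma[where I = ?I and T = "\<lambda>W. W" and f = "\<lambda>_. f"])
      show "openin (subtopology (Euclidean_space n) U) W" if "W \<in> ?I" for W
        using that by (auto simp: openin_subset_topspace_eq openin_subtopology)
      show "continuous_map (subtopology (subtopology (Euclidean_space n) U) W) euclideanreal f"
        if "W \<in> ?I" for W
        using that by (simp add: subtopology_subtopology Int_absorb1)
      show "\<exists>j. j \<in> ?I \<and> x \<in> j \<and> f x = f x"
        if "x \<in> topspace (subtopology (Euclidean_space n) U)" for x
        using that loc[of x] by auto
    qed auto
  qed
  {
    case 0
    then show ?case using pasting by simp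
  next
    case (Suc k)
    show ?case
      unfolding C_diff.simps
    proof (intro conjI allI impI)
      show "continuous_map (subtopology (Euclidean_space n) U) euclideanreal f"
        using Suc.prems by (intro pasting) (meson C_diff.simps(2))
      fix i assume i: "i < n"
      \<comment> \<open>The local witnesses for the partial derivative depend on the neighbourhood;
        \<open>deriv\<close> gives one global candidate that agrees with each of them.\<close>
      define f' where "f' u = deriv (\<lambda>t. f (u(i := t))) (u i)" for u
      have loc: "\<exists>W\<subseteq>U. openin (Euclidean_space n) W \<and> u \<in> W \<and> C_diff k n W f' \<and>
          ((\<lambda>t. f (u(i := t))) has_real_derivative f' u) (at (u i))" if u: "u \<in> U" for u
      proof -
        obtain W where W: "W \<subseteq> U" "openin (Euclidean_space n) W" "u \<in> W" "C_diff (Suc k) n W f"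
          using Suc.prems[OF u] by blast
        then obtain d where d: "\<forall>u\<in>W. ((\<lambda>t. f (u(i := t))) has_real_derivative d u) (at (u i))"
          "C_diff k n W d" using i by auto
        have "d w = f' w" if "w \<in> W" for w
          using DERIV_imp_deriv[OF d(1)[rule_format, OF that]] by (simp add: f'_def)
        then show ?thesis using W d C_diff_cong[OF d(2) W(2)] by metis
      qed
      then show "\<exists>f'. (\<forall>u\<in>U. ((\<lambda>t. f (u(i := t))) has_real_derivative f' u) (at (u i))) \<and>
          C_diff k n U f'"
        using Suc.IH[of f'] by (intro exI[of _ f']) blast
    qed
  }
qed

lemma C_diff_add:
  assumes "C_diff k n U f" "C_diff k n U g"
  shows "C_diff k n U (\<lambda>u. f u + g u)"
  using assms
proof (induction k arbitrary: f g)
  case 0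
  then show ?case by (auto intro!: continuous_map_add)
next
  case (Suc k)
  show ?case
    unfolding C_diff.simps
  proof (intro conjI allI impI)
    show "continuous_map (subtopology (Euclidean_space n) U) euclideanreal (\<lambda>u. f u + g u)"
      using Suc.prems by (auto intro!: continuous_map_add)
    fix i assume i: "i < n"
    obtain f' where f': "\<forall>u\<in>U. ((\<lambda>t. f (u(i := t))) has_real_derivative f' u) (at (u i))" "C_diff k n U f'"
      using Suc.prems(1) i by auto
    obtain g' where "\<forall>u\<in>U. ((\<lambda>t. g (u(i := t))) has_real_derivative g' u) (at (u i))" "C_diff k n U g'"
      using Suc.prems(2) i by auto
    with f' show "\<exists>h'. (\<forall>u\<in>U. ((\<lambda>t. f (u(i := t)) + g (u(i := t))) has_real_derivative h' u) (at (u i))) \<and>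
        C_diff k n U h'"
      using Suc.IH by (intro exI[of _ "\<lambda>u. f' u + g' u"]) (auto intro!: DERIV_add)
  qed
qed

lemma C_diff_cmult:
  assumes "C_diff k n U f"
  shows "C_diff k n U (\<lambda>u. c * f u)"
  using assms
proof (induction k arbitrary: f)
  case 0
  then show ?case by (auto intro!: continuous_map_real_mult)
next
  case (Suc k)
  show ?case
    unfolding C_diff.simps
  proof (intro conjI allI impI)
    show "continuous_map (subtopology (Euclidean_space n) U) euclideanreal (\<lambda>u. c * f u)"
      using Suc.prems by (auto intro!: continuous_map_real_mult)
    fix i assume i: "i < n"
    obtain f' where "\<forall>u\<in>U. ((\<lambda>t. f (u(i := t))) has_real_derivative f' u) (at (u i))" "C_diff k n U f'"
      using Suc.prems i by auto
    then show "\<exists>h'. (\<forall>u\<in>U. ((\<lambda>t. c * f (u(i := t))) has_real_derivative h' u) (at (u i))) \<and>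
        C_diff k n U h'"
      using Suc.IH by (intro exI[of _ "\<lambda>u. c * f' u"]) (auto intro!: DERIV_cmult)
  qed
qed

lemma C_diff_zero: "C_diff k n U (\<lambda>_. 0)"
  by (induction k) (auto intro!: exI[of _ "\<lambda>_. 0"])

section \<open>Smooth real-valued maps on diffeological spaces\<close>

lemma smooth_map_realI:
  assumes "\<And>n U p. plot X n U p \<Longrightarrow> openin (Euclidean_space n) U \<and> smooth_fun n U (\<phi> \<circ> p)"
  shows "smooth_map X real_dsp \<phi>"
  using assms by (auto simp: smooth_map_def real_dsp_def)

lemma smooth_map_realD:
  assumes "smooth_map X real_dsp \<phi>" "plot X n U p"
  shows "openin (Euclidean_space n) U" "smooth_fun n U (\<phi> \<circ> p)"
  using assms by (auto simp: smooth_map_def real_dsp_def)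

lemma smooth_map_real_add:
  assumes "smooth_map X real_dsp \<phi>" "smooth_map X real_dsp \<psi>"
  shows "smooth_map X real_dsp (\<lambda>v. \<phi> v + \<psi> v)"
  using smooth_map_realD[OF assms(1)] smooth_map_realD[OF assms(2)]
  by (intro smooth_map_realI) (auto simp: smooth_fun_def comp_def intro!: C_diff_add)

lemma smooth_map_real_cmult:
  assumes "smooth_map X real_dsp \<phi>"
  shows "smooth_map X real_dsp (\<lambda>v. c * \<phi> v)"
  using smooth_map_realD[OF assms(1)]
  by (intro smooth_map_realI) (auto simp: smooth_fun_def comp_def intro!: C_diff_cmult)

text \<open>The form in which smoothness is tested on a gluing: the local expression
  \<open>q\<close> may come from a different lift of the plot at each point
  \<open>u\<close>.\<close>

lemma smooth_map_real_local:
  assumes "\<And>n U p. plot X n U p \<Longrightarrow> openin (Euclidean_space n) U"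
    and "\<And>n U p u. plot X n U p \<Longrightarrow> u \<in> U \<Longrightarrow>
      \<exists>W\<subseteq>U. \<exists>q. openin (Euclidean_space n) W \<and> u \<in> W \<and> smooth_fun n W q \<and> (\<forall>w\<in>W. \<phi> (p w) = q w)"
  shows "smooth_map X real_dsp \<phi>"
proof (rule smooth_map_realI, rule conjI)
  fix n U p assume p: "plot X n U p"
  show U: "openin (Euclidean_space n) U" by (rule assms(1)[OF p])
  show "smooth_fun n U (\<phi> \<circ> p)"
    unfolding smooth_fun_def
  proof (intro allI C_diff_local[OF U])
    fix k u assume u: "u \<in> U"
    obtain W q where W: "W \<subseteq> U" "openin (Euclidean_space n) W" "u \<in> W" "smooth_fun n W q"
      "\<forall>w\<in>W. \<phi> (p w) = q w"
      using assms(2)[OF p u] by (elim exE conjE) (rule that)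
    have "C_diff k n W (\<phi> \<circ> p)"
    proof (rule C_diff_cong)
      show "C_diff k n W q" using W(4) by (simp add: smooth_fun_def)
      show "q w = (\<phi> \<circ> p) w" if "w \<in> W" for w using W(5) that by simp
    qed (rule W(2))
    then show "\<exists>W\<subseteq>U. openin (Euclidean_space n) W \<and> u \<in> W \<and> C_diff k n W (\<phi> \<circ> p)"
      using W by blast
  qed
qed

text \<open>Lets a form be replaced by its extensional restriction, which agrees with it on the
  fibre \<open>S\<close> in which the plots take their values.\<close>

lemma smooth_map_real_cong:
  assumes "smooth_map X real_dsp \<phi>" "\<And>n U p. plot X n U p \<Longrightarrow> p ` U \<subseteq> S" "\<And>v. v \<in> S \<Longrightarrow> \<phi> v = \<psi> v"
  shows "smooth_map X real_dsp \<psi>"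
proof (rule smooth_map_realI)
  fix n U p assume p: "plot X n U p"
  have "C_diff k n U (\<psi> \<circ> p)" for k
  proof (rule C_diff_cong)
    show "C_diff k n U (\<phi> \<circ> p)"
      using smooth_map_realD(2)[OF assms(1) p] by (simp add: smooth_fun_def)
    show "(\<phi> \<circ> p) w = (\<psi> \<circ> p) w" if "w \<in> U" for w
      using assms(2)[OF p] assms(3) that by auto
  qed (rule smooth_map_realD(1)[OF assms(1) p])
  then show "openin (Euclidean_space n) U \<and> smooth_fun n U (\<psi> \<circ> p)"
    using smooth_map_realD(1)[OF assms(1) p] by (simp add: smooth_fun_def)
qed

lemma smooth_map_real_zero:
  assumes "\<And>n U p. plot X n U p \<Longrightarrow> openin (Euclidean_space n) U"
  shows "smooth_map X real_dsp (\<lambda>_. 0)"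
  using assms by (intro smooth_map_realI) (auto simp: smooth_fun_def comp_def C_diff_zero)

section \<open>The free algebra on a set of generators\<close>

abbreviation bas :: "'k \<Rightarrow> ('k \<Rightarrow>\<^sub>0 real)" where
  "bas k \<equiv> Poly_Mapping.single k 1"

lemma lookup_scaleR: "Poly_Mapping.lookup (c *\<^sub>R a) k = c *\<^sub>R Poly_Mapping.lookup a k"
proof -
  have "finite {k. c *\<^sub>R Poly_Mapping.lookup a k \<noteq> 0}"
    by (rule finite_subset[OF _ finite_keys[of a]]) (auto simp: in_keys_iff)
  then show ?thesis by (simp add: scaleR_poly_mapping_def)
qed

lemma keys_scaleR: "Poly_Mapping.keys (c *\<^sub>R a) \<subseteq> Poly_Mapping.keys a"
  by (auto simp: in_keys_iff lookup_scaleR)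

lemma single_eq_scaleR: "Poly_Mapping.single k c = c *\<^sub>R bas k" for c :: real
  by (rule poly_mapping_eqI) (simp add: lookup_scaleR lookup_single when_def)

text \<open>Linear extension from the basis, the universal property of the free vector space. All
  operators on words are brought into this form, so that identities between them reduce to single
  words by \<open>linear_eq_on_free\<close>.\<close>

definition lext :: "('k \<Rightarrow> 'b::real_vector) \<Rightarrow> ('k \<Rightarrow>\<^sub>0 real) \<Rightarrow> 'b" where
  "lext \<phi> a = (\<Sum>k\<in>Poly_Mapping.keys a. Poly_Mapping.lookup a k *\<^sub>R \<phi> k)"

lemma lext_superset:
  assumes "finite K" "Poly_Mapping.keys a \<subseteq> K"
  shows "lext \<phi> a = (\<Sum>k\<in>K. Poly_Mapping.lookup a k *\<^sub>R \<phi> k)"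
  unfolding lext_def by (rule sum.mono_neutral_left) (use assms in \<open>auto simp: in_keys_iff\<close>)

lemma linear_lext: "linear (lext \<phi>)"
proof (rule linearI)
  fix a b :: "'a \<Rightarrow>\<^sub>0 real" and r :: real
  let ?K = "Poly_Mapping.keys a \<union> Poly_Mapping.keys b"
  have "lext \<phi> (a + b) = (\<Sum>k\<in>?K. Poly_Mapping.lookup (a + b) k *\<^sub>R \<phi> k)"
    by (rule lext_superset) (use Poly_Mapping.keys_add[of a b] in auto)
  also have "\<dots> = lext \<phi> a + lext \<phi> b"
    using lext_superset[of ?K a \<phi>] lext_superset[of ?K b \<phi>]
    by (simp add: lookup_add scaleR_add_left sum.distrib)
  finally show "lext \<phi> (a + b) = lext \<phi> a + lext \<phi> b" .
  have "lext \<phi> (r *\<^sub>R a) = (\<Sum>k\<in>Poly_Mapping.keys a. Poly_Mapping.lookup (r *\<^sub>R a) k *\<^sub>R \<phi> k)"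
    by (rule lext_superset) (use keys_scaleR[of r a] in auto)
  then show "lext \<phi> (r *\<^sub>R a) = r *\<^sub>R lext \<phi> a"
    by (simp add: lext_def lookup_scaleR scaleR_sum_right)
qed

lemmas linear_o = linear_compose[unfolded comp_def]

lemma lext_bas [simp]: "lext \<phi> (bas k) = \<phi> k"
  by (simp add: lext_def)

lemma lext_bas_id: "lext bas a = a"
proof (rule poly_mapping_eqI)
  fix i
  have "Poly_Mapping.lookup (lext bas a) i =
      (\<Sum>k\<in>Poly_Mapping.keys a. if k = i then Poly_Mapping.lookup a k else 0)"
    unfolding lext_def lookup_sum
    by (rule sum.cong) (simp_all add: lookup_scaleR lookup_single when_def)
  then show "Poly_Mapping.lookup (lext bas a) i = Poly_Mapping.lookup a i"
    by (simp add: sum.delta) (metis in_keys_iff)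
qed

text \<open>The type contains combinations of words with arbitrary letters, whereas a fibre is only
  a subset of a type; \<open>free_on (lists (fibre V x))\<close> is the free algebra on that
  fibre.\<close>

definition free_on :: "'k set \<Rightarrow> ('k \<Rightarrow>\<^sub>0 real) set" where
  "free_on X = {a. Poly_Mapping.keys a \<subseteq> X}"

lemma subspace_free_on: "subspace (free_on X)"
  unfolding free_on_def
  by (rule subspaceI) (auto dest: subsetD[OF Poly_Mapping.keys_add] subsetD[OF keys_scaleR])

lemmas free_on_add = subspace_add[OF subspace_free_on]
  and free_on_diff = subspace_diff[OF subspace_free_on]
  and free_on_scale = subspace_scale[OF subspace_free_on]
  and free_on_zero [simp] = subspace_0[OF subspace_free_on]

lemma bas_in_free_on [simp]: "bas k \<in> free_on X \<longleftrightarrow> k \<in> X"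
  by (auto simp: free_on_def)

lemma in_free_on_UNIV [simp]: "a \<in> free_on UNIV"
  by (simp add: free_on_def)

lemma lext_in_subspace:
  assumes "subspace S" "a \<in> free_on X" "\<And>k. k \<in> X \<Longrightarrow> \<phi> k \<in> S"
  shows "lext \<phi> a \<in> S"
  unfolding lext_def using assms
  by (intro subspace_sum subspace_scale) (auto simp: free_on_def)

lemma free_on_induct [consumes 1, case_names zero add]:
  assumes "a \<in> free_on X" "P 0"
    and "\<And>k c a. \<lbrakk>k \<in> X; a \<in> free_on X; P a\<rbrakk> \<Longrightarrow> P (c *\<^sub>R bas k + a)"
  shows "P a"
proof -
  have "P (\<Sum>k\<in>K. Poly_Mapping.lookup a k *\<^sub>R bas k) \<and>
      (\<Sum>k\<in>K. Poly_Mapping.lookup a k *\<^sub>R bas k) \<in> free_on X"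
    if "finite K" "K \<subseteq> X" for K
    using that
    by (induction K rule: finite_induct)
      (auto simp: assms(2) intro!: assms(3) free_on_add free_on_scale)
  from this[of "Poly_Mapping.keys a"] show ?thesis
    using assms(1) lext_bas_id[of a] by (simp add: free_on_def lext_def)
qed

lemma linear_eq_on_free:
  assumes "linear f" "linear g" "\<And>k. k \<in> X \<Longrightarrow> f (bas k) = g (bas k)" "a \<in> free_on X"
  shows "f a = g a"
  using assms(4)
  by (induction rule: free_on_induct)
    (simp_all add: linear_add[OF assms(1)] linear_add[OF assms(2)] linear_scale[OF assms(1)]
      linear_scale[OF assms(2)] linear_0[OF assms(1)] linear_0[OF assms(2)] assms(3))

lemma linear_eq_bas:
  assumes "linear f" "linear g" "\<And>k. f (bas k) = g (bas k)"
  shows "f a = g a"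
  using linear_eq_on_free[OF assms(1,2), of UNIV a] assms(3) by simp

lemma bilinear_eq_bas:
  assumes "\<And>b. linear (\<lambda>a. f a b)" "\<And>a. linear (f a)" "\<And>b. linear (\<lambda>a. g a b)" "\<And>a. linear (g a)"
    and "\<And>k l. f (bas k) (bas l) = g (bas k) (bas l)"
  shows "f a b = g a b"
proof (rule linear_eq_bas[OF assms(1,3)])
  show "f (bas k) b = g (bas k) b" for k by (rule linear_eq_bas[OF assms(2,4,5)])
qed

lemma linear_lext_param:
  assumes "\<And>k. linear (\<phi> k)"
  shows "linear (\<lambda>e. lext (\<lambda>k. \<phi> k e) a)"
  unfolding lext_def by (intro linear_compose_sum ballI linear_compose_scale_right assms)

section \<open>Push-forward, concatenation, alternation and degree components\<close>

lemma push_eq: "push h = lext (\<lambda>k. bas (map h k))"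
  by (auto simp: push_def lext_def fun_eq_iff single_eq_scaleR[of _ "Poly_Mapping.lookup _ _"])

lemma fmul_eq: "fmul a b = lext (\<lambda>k. lext (\<lambda>l. bas (k @ l)) b) a"
  by (auto simp: fmul_def lext_def fun_eq_iff single_eq_scaleR[of _ "_ * _"] scaleR_sum_right)

text \<open>The degree is read off the word, so that \<open>altT\<close> alternates in all degrees
  at once; \<open>alt n\<close> agrees with it on combinations of words of length
  \<open>n\<close>.\<close>

definition altb :: "'v list \<Rightarrow> ('v list \<Rightarrow>\<^sub>0 real)" where
  "altb k = (1 / fact (length k)) *\<^sub>R
     (\<Sum>\<sigma> | \<sigma> permutes {..<length k}. of_int (sign \<sigma>) *\<^sub>R bas (permute_list \<sigma> k))"

definition altT :: "('v list \<Rightarrow>\<^sub>0 real) \<Rightarrow> ('v list \<Rightarrow>\<^sub>0 real)" where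
  "altT = lext altb"

text \<open>Projection to the homogeneous component of degree \<open>n\<close>. It mediates between
  one element of the free algebra and the sequence of its components in the direct sum of tensor
  powers.\<close>

definition hcomp :: "nat \<Rightarrow> ('v list \<Rightarrow>\<^sub>0 real) \<Rightarrow> ('v list \<Rightarrow>\<^sub>0 real)" where
  "hcomp n = lext (\<lambda>k. if length k = n then bas k else 0)"

lemma linear_push: "linear (push h)" by (simp add: push_eq linear_lext)
lemma linear_altT: "linear altT" by (simp add: altT_def linear_lext)
lemma linear_hcomp: "linear (hcomp n)" by (simp add: hcomp_def linear_lext)

lemma linear_fmul_left: "linear (\<lambda>a. fmul a b)" by (simp add: fmul_eq linear_lext)
lemma linear_fmul_right: "linear (fmul a)"
  unfolding fmul_eq by (rule linear_lext_param[OF linear_lext])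

lemma push_bas [simp]: "push h (bas k) = bas (map h k)" by (simp add: push_eq)
lemma altT_bas: "altT (bas k) = altb k" by (simp add: altT_def)
lemma hcomp_bas: "hcomp n (bas k) = (if length k = n then bas k else 0)" by (simp add: hcomp_def)
lemma fmul_bas [simp]: "fmul (bas k) (bas l) = bas (k @ l)" by (simp add: fmul_eq)

lemma alt_eq_altT:
  assumes "a \<in> free_on {k. length k = n}"
  shows "alt n a = altT a"
proof -
  have "alt n a = (1 / fact n) *\<^sub>R (\<Sum>\<sigma> | \<sigma> permutes {..<n}. of_int (sign \<sigma>) *\<^sub>R
      lext (\<lambda>k. bas (permute_list \<sigma> k)) a)"
    by (simp add: alt_def lext_def single_eq_scaleR[of _ "Poly_Mapping.lookup _ _"])
  moreover have "linear (\<lambda>a. (1 / fact n) *\<^sub>R (\<Sum>\<sigma> | \<sigma> permutes {..<n}. of_int (sign \<sigma>) *\<^sub>R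
      lext (\<lambda>k. bas (permute_list \<sigma> k)) a :: 'a list \<Rightarrow>\<^sub>0 real))"
    by (intro linear_compose_scale_right linear_compose_sum ballI linear_lext)
  from linear_eq_on_free[OF this linear_altT _ assms]
  have "(1 / fact n) *\<^sub>R (\<Sum>\<sigma> | \<sigma> permutes {..<n}. of_int (sign \<sigma>) *\<^sub>R
      lext (\<lambda>k. bas (permute_list \<sigma> k)) a) = altT a"
    by (simp add: altT_bas altb_def)
  ultimately show ?thesis by simp
qed

lemma fmul_assoc: "fmul (fmul a b) c = fmul a (fmul b c)"
proof -
  have "fmul (fmul a b) (bas m) = fmul a (fmul b (bas m))" for m
    by (rule bilinear_eq_bas[OF linear_o[OF linear_fmul_left linear_fmul_left]
          linear_o[OF linear_fmul_right linear_fmul_left] linear_fmul_left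
          linear_o[OF linear_fmul_left linear_fmul_right]]) simp
  then show ?thesis
    by (rule linear_eq_bas[OF linear_fmul_right linear_o[OF linear_fmul_right linear_fmul_right]])
qed

lemma fmul_Nil [simp]: "fmul (bas []) a = a" "fmul a (bas []) = a"
proof -
  show "fmul (bas []) a = a" by (rule linear_eq_bas[OF linear_fmul_right linear_id[unfolded id_def]]) simp
  show "fmul a (bas []) = a" by (rule linear_eq_bas[OF linear_fmul_left linear_id[unfolded id_def]]) simp
qed

lemma fmul_free_on:
  assumes "a \<in> free_on (lists S)" "b \<in> free_on (lists S)"
  shows "fmul a b \<in> free_on (lists S)"
  unfolding fmul_eq
  by (rule lext_in_subspace[OF subspace_free_on assms(1)], rule lext_in_subspace[OF subspace_free_on assms(2)]) simp

lemma push_free_on: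
  assumes "a \<in> free_on (lists S)" "\<And>v. v \<in> S \<Longrightarrow> h v \<in> S'"
  shows "push h a \<in> free_on (lists S')"
  unfolding push_eq
  by (rule lext_in_subspace[OF subspace_free_on assms(1)]) (use assms(2) in auto)

lemma push_fmul: "push h (fmul a b) = fmul (push h a) (push h b)"
  by (rule bilinear_eq_bas[OF linear_o[OF linear_fmul_left linear_push] linear_o[OF linear_fmul_right linear_push]
        linear_o[OF linear_push linear_fmul_left] linear_o[OF linear_push linear_fmul_right]]) simp

lemma push_push: "push k (push h a) = push (k \<circ> h) a"
  by (rule linear_eq_bas[OF linear_o[OF linear_push linear_push] linear_push]) simp

lemma push_cong:
  assumes "a \<in> free_on (lists S)" "\<And>v. v \<in> S \<Longrightarrow> h v = k v"
  shows "push h a = push k a"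
proof (rule linear_eq_on_free[OF linear_push linear_push _ assms(1)])
  fix l assume "l \<in> lists S"
  then have "map h l = map k l" using assms(2) by auto
  then show "push h (bas l) = push k (bas l)" by (simp only: push_bas)
qed

lemma push_ident [simp]: "push (\<lambda>v. v) a = a"
  by (rule linear_eq_bas[OF linear_push linear_id[unfolded id_def]]) simp

lemma hcomp_push: "hcomp n (push h a) = push h (hcomp n a)"
  by (rule linear_eq_bas[OF linear_o[OF linear_push linear_hcomp]
        linear_o[OF linear_hcomp linear_push]])
    (simp add: hcomp_bas linear_0[OF linear_push])

lemma hcomp_eq_self: "a \<in> free_on {k. length k = n} \<Longrightarrow> hcomp n a = a"
  by (rule linear_eq_on_free[OF linear_hcomp linear_id[unfolded id_def]]) (auto simp: hcomp_bas)

lemma hcomp_eq_0: "a \<in> free_on {k. length k \<noteq> n} \<Longrightarrow> hcomp n a = 0"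
  by (rule linear_eq_on_free[OF linear_hcomp linear_zero]) (auto simp: hcomp_bas)

lemma hcomp_free_on: "a \<in> free_on X \<Longrightarrow> hcomp n a \<in> free_on {k \<in> X. length k = n}"
  unfolding hcomp_def by (rule lext_in_subspace[OF subspace_free_on]) auto

lemma sum_hcomp:
  assumes "finite N" "length ` Poly_Mapping.keys a \<subseteq> N"
  shows "(\<Sum>n\<in>N. hcomp n a) = a"
proof -
  have "(\<Sum>n\<in>N. hcomp n a) = id a"
    by (rule linear_eq_on_free[where X = "{k. length k \<in> N}" and f = "\<lambda>a. \<Sum>n\<in>N. hcomp n a" and g = id])
      (use assms in \<open>auto simp: hcomp_bas free_on_def intro!: linear_compose_sum linear_hcomp linear_id\<close>)
  then show ?thesis by simp
qed

text \<open>The Cauchy product: on words \<open>k\<close> and \<open>l\<close> only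
  \<open>i = length k\<close> can contribute, and then \<open>l\<close> must have length
  \<open>n - i\<close>.\<close>

lemma hcomp_fmul: "hcomp n (fmul a b) = (\<Sum>i\<le>n. fmul (hcomp i a) (hcomp (n - i) b))"
proof (rule bilinear_eq_bas[OF linear_o[OF linear_fmul_left linear_hcomp] linear_o[OF linear_fmul_right linear_hcomp]
      linear_compose_sum[OF ballI[OF linear_o[OF linear_hcomp linear_fmul_left]]]
      linear_compose_sum[OF ballI[OF linear_o[OF linear_hcomp linear_fmul_right]]]])
  fix k l :: "'a list"
  have "(\<Sum>i\<le>n. fmul (hcomp i (bas k)) (hcomp (n - i) (bas l)))
      = (\<Sum>i\<le>n. if i = length k then (if length l = n - i then bas (k @ l) else 0) else 0)"
    by (rule sum.cong) (auto simp: hcomp_bas linear_0[OF linear_fmul_left] linear_0[OF linear_fmul_right])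
  then show "hcomp n (fmul (bas k) (bas l)) = (\<Sum>i\<le>n. fmul (hcomp i (bas k)) (hcomp (n - i) (bas l)))"
    by (auto simp: hcomp_bas sum.delta)
qed

subsection \<open>Alternation\<close>

text \<open>Only exchanges of neighbours are required, which is easy to check for recursively
  defined operators. Arbitrary transpositions, and then all permutations, follow.\<close>

definition alternating :: "('v list \<Rightarrow> 'b::real_vector) \<Rightarrow> bool" where
  "alternating T \<longleftrightarrow> (\<forall>us v w ws. T (us @ v # w # ws) = - T (us @ w # v # ws))"

lemma alternatingD: "alternating T \<Longrightarrow> T (us @ v # w # ws) = - T (us @ w # v # ws)"
  unfolding alternating_def by blast

lemma alternating_move:
  assumes "alternating T"
  shows "T (us @ ms @ v # ws) = (-1) ^ length ms *\<^sub>R T (us @ v # ms @ ws)"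
proof (induction ms arbitrary: us)
  case (Cons m ms)
  have "T (us @ (m # ms) @ v # ws) = (-1) ^ length ms *\<^sub>R T (us @ m # v # ms @ ws)"
    using Cons[of "us @ [m]"] by simp
  also have "T (us @ m # v # ms @ ws) = - T (us @ v # m # ms @ ws)"
    by (rule alternatingD[OF assms])
  finally show ?case by simp
qed simp

lemma permute_list_transpose:
  "permute_list (Transposition.transpose (length us) (length us + Suc (length ms))) (us @ v # ms @ w # ws) =
     us @ w # ms @ v # ws"
proof (rule nth_equalityI)
  fix i assume "i < length (permute_list (Transposition.transpose (length us) (length us + Suc (length ms))) (us @ v # ms @ w # ws))"
  then have "permute_list (Transposition.transpose (length us) (length us + Suc (length ms))) (us @ v # ms @ w # ws) ! i =
     (us @ v # ms @ w # ws) ! Transposition.transpose (length us) (length us + Suc (length ms)) i"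
    by (simp add: permute_list_def del: upt_Suc)
  also consider "i = length us" | "i = length us + Suc (length ms)"
    | "i \<noteq> length us" "i \<noteq> length us + Suc (length ms)" by blast
  then have "(us @ v # ms @ w # ws) ! Transposition.transpose (length us) (length us + Suc (length ms)) i
      = (us @ w # ms @ v # ws) ! i"
  proof cases
    case 3
    then show ?thesis
      by (auto simp: transpose_apply_other nth_append nth_Cons' less_Suc_eq)
  qed (simp_all add: nth_append)
  finally show "permute_list (Transposition.transpose (length us) (length us + Suc (length ms))) (us @ v # ms @ w # ws) ! i
      = (us @ w # ms @ v # ws) ! i" .
qed simp

text \<open>Both letters travel past the block \<open>ms\<close> between them, which contributes the
  sign \<open>(-1) ^ length ms\<close> twice; the one remaining exchange of neighbours gives the
  minus sign.\<close>

lemma alternating_transpose: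
  assumes "alternating T" "i < j" "j < length k"
  shows "T (permute_list (Transposition.transpose i j) k) = - T k"
proof -
  define us ms ws where "us = take i k" "ms = take (j - Suc i) (drop (Suc i) k)" "ws = drop (Suc j) k"
  have "drop (Suc i) k = ms @ drop (j - Suc i) (drop (Suc i) k)"
    by (simp add: us_ms_ws_def del: drop_drop)
  also have "drop (j - Suc i) (drop (Suc i) k) = k ! j # ws"
    using assms by (simp add: us_ms_ws_def Cons_nth_drop_Suc)
  finally have k: "k = us @ k ! i # ms @ k ! j # ws"
    using assms id_take_nth_drop[of i k] by (simp add: us_ms_ws_def)
  have len: "i = length us" "j = length us + Suc (length ms)" using assms by (auto simp: us_ms_ws_def)
  have swap: "T (us @ w # ms @ v # ws) = - T (us @ v # ms @ w # ws)" for v w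
  proof -
    have "T (us @ w # ms @ v # ws) = (-1) ^ length ms *\<^sub>R T (us @ w # v # ms @ ws)"
      using alternating_move[OF assms(1), of "us @ [w]" ms v ws] by simp
    also have "T (us @ w # v # ms @ ws) = - T (us @ v # w # ms @ ws)"
      by (rule alternatingD[OF assms(1)])
    also have "T (us @ v # ms @ w # ws) = (-1) ^ length ms *\<^sub>R T (us @ v # w # ms @ ws)"
      using alternating_move[OF assms(1), of "us @ [v]" ms w ws] by simp
    then have "T (us @ v # w # ms @ ws) = (-1) ^ length ms *\<^sub>R T (us @ v # ms @ w # ws)"
      by (simp add: power_add[symmetric] flip: mult_2)
    finally show ?thesis by (simp add: power_add[symmetric] flip: mult_2)
  qed
  show ?thesis
    using swap[of "k ! j" "k ! i"] permute_list_transpose[of us ms "k ! i" "k ! j" ws] k len by metis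
qed

lemma alternating_permute:
  assumes "alternating T" "\<sigma> permutes {..<length k}"
  shows "T (permute_list \<sigma> k) = of_int (sign \<sigma>) *\<^sub>R T k"
  using finite_lessThan assms(2)
proof (induction rule: permutes_rev_induct)
  case (swap i j p)
  have "permutation p" using swap(4) by (auto simp: permutation_permutes)
  then have sign: "sign (p \<circ> Transposition.transpose i j) = - sign p"
    using swap(3) by (simp add: sign_compose sign_swap_id permutation_swap_id)
  have per: "Transposition.transpose i j permutes {..<length k}" using swap by (intro permutes_swap_id) auto
  have "T (permute_list (Transposition.transpose i j) (permute_list p k)) = - T (permute_list p k)"
  proof (cases "i < j")
    case True
    then show ?thesis using swap assms(1) by (intro alternating_transpose) auto
  next
    case False
    then show ?thesis using swap alternating_transpose[OF assms(1), of j i "permute_list p k"]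
      by (simp add: transpose_commute)
  qed
  then show ?case
    unfolding permute_list_compose[OF per] sign swap.IH by simp
qed simp

text \<open>Composition with \<open>\<sigma>\<close> on the left only reindexes the sum over the
  symmetric group, and turns each summand into one for the permuted word, up to the sign of
  \<open>\<sigma>\<close>. That sign is its own inverse.\<close>

lemma altT_permute:
  assumes "\<sigma> permutes {..<length k}"
  shows "altT (bas (permute_list \<sigma> k)) = of_int (sign \<sigma>) *\<^sub>R altT (bas k)"
proof -
  let ?P = "{p. p permutes {..<length k}}"
  let ?f = "\<lambda>p. of_int (sign p) *\<^sub>R bas (permute_list p k) :: 'a list \<Rightarrow>\<^sub>0 real"
  have "sum ?f ?P = (\<Sum>p\<in>?P. ?f (\<sigma> \<circ> p))" by (rule setum_permutations_compose_left[OF assms])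
  also have "\<dots> = (\<Sum>p\<in>?P. of_int (sign \<sigma>) *\<^sub>R of_int (sign p) *\<^sub>R bas (permute_list p (permute_list \<sigma> k)))"
  proof (rule sum.cong[OF refl])
    fix p assume p: "p \<in> ?P"
    have "permutation p" "permutation \<sigma>" using p assms by (auto simp: permutation_permutes)
    then show "?f (\<sigma> \<circ> p) = of_int (sign \<sigma>) *\<^sub>R of_int (sign p) *\<^sub>R bas (permute_list p (permute_list \<sigma> k))"
      using p permute_list_compose[of p k \<sigma>] by (simp add: sign_compose)
  qed
  finally have "sum ?f ?P = of_int (sign \<sigma>) *\<^sub>R
      (\<Sum>p\<in>?P. of_int (sign p) *\<^sub>R bas (permute_list p (permute_list \<sigma> k)))"
    by (simp add: scaleR_sum_right)
  then have "altT (bas k) = of_int (sign \<sigma>) *\<^sub>R altT (bas (permute_list \<sigma> k))"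
    by (simp add: altT_bas altb_def mult.commute)
  then have "of_int (sign \<sigma>) *\<^sub>R altT (bas k) = of_int (sign \<sigma>) *\<^sub>R of_int (sign \<sigma>) *\<^sub>R altT (bas (permute_list \<sigma> k))"
    by simp
  then show ?thesis by (simp only: scaleR_scaleR sign_idempotent of_int_1 scaleR_one flip: of_int_mult)
qed

lemma alternating_altT: "alternating (\<lambda>k. altT (bas k))"
  unfolding alternating_def
proof (intro allI)
  fix us ws :: "'a list" and v w
  let ?k = "us @ v # w # ws" and ?t = "Transposition.transpose (length us) (Suc (length us))"
  have k: "permute_list ?t ?k = us @ w # v # ws"
    using permute_list_transpose[of us "[]" v w ws] by simp
  have "?t permutes {..<length ?k}" by (rule permutes_swap_id) auto
  from altT_permute[OF this]
  show "altT (bas (us @ v # w # ws)) = - altT (bas (us @ w # v # ws))"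
    by (simp only: k sign_swap_id) simp
qed

text \<open>An alternating \<open>L\<close> takes the same value on all signed permutations of a
  word, so averaging over them changes nothing. Used whenever an operator has to be shown to descend
  to the exterior algebra.\<close>

lemma alternating_linear_altT:
  assumes "linear L" "alternating (\<lambda>k. L (bas k))"
  shows "L (altT a) = L a"
proof (rule linear_eq_bas[where f = "\<lambda>a. L (altT a)" and g = L])
  fix k :: "'a list"
  have "L (altT (bas k)) = (1 / fact (length k)) *\<^sub>R
      (\<Sum>\<sigma> | \<sigma> permutes {..<length k}. of_int (sign \<sigma>) *\<^sub>R L (bas (permute_list \<sigma> k)))"
    by (simp add: altT_bas altb_def linear_scale[OF assms(1)] linear_sum[OF assms(1)])
  also have "(\<Sum>\<sigma> | \<sigma> permutes {..<length k}. of_int (sign \<sigma>) *\<^sub>R L (bas (permute_list \<sigma> k)))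
      = (\<Sum>\<sigma> | \<sigma> permutes {..<length k}. L (bas k))"
  proof (rule sum.cong[OF refl])
    fix \<sigma> assume "\<sigma> \<in> {\<sigma>. \<sigma> permutes {..<length k}}"
    with alternating_permute[OF assms(2), of \<sigma> k]
    have "of_int (sign \<sigma>) *\<^sub>R L (bas (permute_list \<sigma> k)) = of_int (sign \<sigma>) *\<^sub>R of_int (sign \<sigma>) *\<^sub>R L (bas k)"
      by simp
    then show "of_int (sign \<sigma>) *\<^sub>R L (bas (permute_list \<sigma> k)) = L (bas k)"
      by (simp only: scaleR_scaleR sign_idempotent of_int_1 scaleR_one flip: of_int_mult)
  qed
  also have "\<dots> = fact (length k) *\<^sub>R L (bas k)"
    using card_permutations[of "{..<length k}" "length k"] by (simp add: scaleR_conv_of_real sum_constant_scaleR)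
  finally show "L (altT (bas k)) = L (bas k)" by simp
qed (use assms(1) linear_o[OF linear_altT assms(1)] in \<open>simp_all add: comp_def\<close>)

lemma hcomp_altT: "hcomp n (altT a) = altT (hcomp n a)"
proof (rule linear_eq_bas[where f = "\<lambda>a. hcomp n (altT a)" and g = "\<lambda>a. altT (hcomp n a)"])
  fix k :: "'a list"
  show "hcomp n (altT (bas k)) = altT (hcomp n (bas k))"
    by (simp add: altT_bas altb_def hcomp_bas linear_scale[OF linear_hcomp] linear_sum[OF linear_hcomp]
        linear_0[OF linear_altT])
qed (auto intro: linear_o[OF linear_altT linear_hcomp]
    linear_o[OF linear_hcomp linear_altT])

lemma push_altT: "push h (altT a) = altT (push h a)"
proof (rule linear_eq_bas[where f = "\<lambda>a. push h (altT a)" and g = "\<lambda>a. altT (push h a)"])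
  fix k
  show "push h (altT (bas k)) = altT (push h (bas k))"
    by (simp add: altT_bas altb_def linear_scale[OF linear_push] linear_sum[OF linear_push] permute_list_map)
qed (auto intro: linear_o[OF linear_altT linear_push]
    linear_o[OF linear_push linear_altT])

lemma altT_free_on: "a \<in> free_on (lists S) \<Longrightarrow> altT a \<in> free_on (lists S)"
  unfolding altT_def altb_def
  by (rule lext_in_subspace[OF subspace_free_on])
    (auto intro!: free_on_scale subspace_sum[OF subspace_free_on] simp: in_lists_conv_set)

subsection \<open>Clifford multiplication on the free algebra\<close>

text \<open>Exterior multiplication by \<open>v\<close>, before alternation.\<close>

definition lcons :: "'v \<Rightarrow> ('v list \<Rightarrow>\<^sub>0 real) \<Rightarrow> ('v list \<Rightarrow>\<^sub>0 real)" where
  "lcons v = lext (\<lambda>k. bas (v # k))"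

text \<open>Interior multiplication by \<open>\<phi>\<close>, before alternation: the recursion is
  the rule for an antiderivation, and each letter passed contributes a sign.\<close>

primrec ctrb :: "('v \<Rightarrow> real) \<Rightarrow> 'v list \<Rightarrow> ('v list \<Rightarrow>\<^sub>0 real)" where
  "ctrb \<phi> [] = 0"
| "ctrb \<phi> (w # k) = \<phi> w *\<^sub>R bas k - lcons w (ctrb \<phi> k)"

definition ctr :: "('v \<Rightarrow> real) \<Rightarrow> ('v list \<Rightarrow>\<^sub>0 real) \<Rightarrow> ('v list \<Rightarrow>\<^sub>0 real)" where
  "ctr \<phi> = lext (ctrb \<phi>)"

definition cliff :: "('v \<Rightarrow> 'v \<Rightarrow> real) \<Rightarrow> 'v \<Rightarrow> ('v list \<Rightarrow>\<^sub>0 real) \<Rightarrow> ('v list \<Rightarrow>\<^sub>0 real)" where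
  "cliff g v a = lcons v a - ctr (g v) a"

text \<open>The free algebra acting on itself: a word acts as the composition of the operators of
  its letters, the last letter first.\<close>

definition act :: "('v \<Rightarrow> 'v \<Rightarrow> real) \<Rightarrow> ('v list \<Rightarrow>\<^sub>0 real) \<Rightarrow> ('v list \<Rightarrow>\<^sub>0 real) \<Rightarrow> ('v list \<Rightarrow>\<^sub>0 real)" where
  "act g a e = lext (\<lambda>k. foldr (cliff g) k e) a"

lemma linear_lcons: "linear (lcons v)" by (simp add: lcons_def linear_lext)
lemma linear_ctr: "linear (ctr \<phi>)" by (simp add: ctr_def linear_lext)
lemma linear_cliff: "linear (cliff g v)"
  unfolding cliff_def[abs_def] by (intro linear_compose_sub linear_lcons linear_ctr)
lemma linear_foldr_cliff: "linear (foldr (cliff g) k)"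
  by (induction k) (simp_all add: linear_id[unfolded id_def] id_def
      linear_o[OF _ linear_cliff] comp_def)
lemma linear_act_left: "linear (\<lambda>a. act g a e)" by (simp add: act_def linear_lext)
lemma linear_act_right: "linear (act g a)"
  unfolding act_def[abs_def] by (rule linear_lext_param[OF linear_foldr_cliff])

lemma lcons_bas [simp]: "lcons v (bas k) = bas (v # k)" by (simp add: lcons_def)
lemma ctr_bas [simp]: "ctr \<phi> (bas k) = ctrb \<phi> k" by (simp add: ctr_def)
lemma act_bas [simp]: "act g (bas k) e = foldr (cliff g) k e" by (simp add: act_def)

lemma lcons_free_on: "v \<in> S \<Longrightarrow> a \<in> free_on (lists S) \<Longrightarrow> lcons v a \<in> free_on (lists S)"
  unfolding lcons_def by (rule lext_in_subspace[OF subspace_free_on]) auto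

lemma ctrb_free_on: "k \<in> lists S \<Longrightarrow> ctrb \<phi> k \<in> free_on (lists S)"
  by (induction k) (auto intro!: free_on_diff free_on_scale lcons_free_on)

lemma ctr_free_on: "a \<in> free_on (lists S) \<Longrightarrow> ctr \<phi> a \<in> free_on (lists S)"
  unfolding ctr_def by (rule lext_in_subspace[OF subspace_free_on _ ctrb_free_on])

lemma cliff_free_on: "v \<in> S \<Longrightarrow> a \<in> free_on (lists S) \<Longrightarrow> cliff g v a \<in> free_on (lists S)"
  unfolding cliff_def by (intro free_on_diff lcons_free_on ctr_free_on)

lemma foldr_cliff_free_on:
  "k \<in> lists S \<Longrightarrow> e \<in> free_on (lists S) \<Longrightarrow> foldr (cliff g) k e \<in> free_on (lists S)"
  by (induction k) (auto intro: cliff_free_on)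

lemma act_free_on:
  "a \<in> free_on (lists S) \<Longrightarrow> e \<in> free_on (lists S) \<Longrightarrow> act g a e \<in> free_on (lists S)"
  unfolding act_def by (rule lext_in_subspace[OF subspace_free_on _ foldr_cliff_free_on])

lemma act_fmul: "act g (fmul a b) e = act g a (act g b e)"
  by (rule bilinear_eq_bas[where f = "\<lambda>a b. act g (fmul a b) e" and g = "\<lambda>a b. act g a (act g b e)",
        OF linear_o[OF linear_fmul_left linear_act_left] linear_o[OF linear_fmul_right linear_act_left]
        linear_act_left linear_o[OF linear_act_left linear_act_right]]) simp

text \<open>The recursion unrolled. This is the alternating sum in the definition of a standard
  action, with positions counted from \<open>0\<close>.\<close>

lemma ctrb_formula:
  "ctrb \<phi> vs = (\<Sum>j<length vs. ((-1) ^ j * \<phi> (vs ! j)) *\<^sub>R bas (take j vs @ drop (Suc j) vs))"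
  by (induction vs)
    (simp_all add: sum.lessThan_Suc_shift linear_sum[OF linear_lcons] linear_scale[OF linear_lcons] flip: sum_negf
      del: sum.lessThan_Suc)

lemma ctr_lcons: "ctr \<phi> (lcons v a) = \<phi> v *\<^sub>R a - lcons v (ctr \<phi> a)"
  by (rule linear_eq_bas[OF linear_o[OF linear_lcons linear_ctr]
      linear_compose_sub[OF linear_compose_scale_right[OF linear_id[unfolded id_def]]
         linear_o[OF linear_ctr linear_lcons]]]) simp

text \<open>Contractions anticommute exactly, without alternation: splitting off the first letter
  leaves two scalar terms that are exchanged with opposite signs, and the rest is the induction
  hypothesis under \<open>lcons\<close>.\<close>

lemma ctr_ctr: "ctr \<phi> (ctr \<psi> a) = - ctr \<psi> (ctr \<phi> a)"
proof (rule linear_eq_bas[OF linear_o[OF linear_ctr linear_ctr]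
      linear_compose_neg[OF linear_o[OF linear_ctr linear_ctr]]])
  fix k :: "'a list"
  show "ctr \<phi> (ctr \<psi> (bas k)) = - ctr \<psi> (ctr \<phi> (bas k))"
    by (induction k) (simp_all add: linear_0[OF linear_ctr] linear_diff[OF linear_ctr] linear_scale[OF linear_ctr]
      ctr_lcons linear_neg[OF linear_lcons])
qed

text \<open>Prefixing a letter shifts an exchange of neighbours by one place, so the alternated word
  with \<open>v\<close> in front still alternates in the letters behind \<open>v\<close>.\<close>

lemma altT_lcons_altT: "altT (lcons v (altT a)) = altT (lcons v a)"
proof (rule alternating_linear_altT[OF linear_o[OF linear_lcons linear_altT]])
  show "alternating (\<lambda>k. altT (lcons v (bas k)))"
    unfolding alternating_def lcons_bas
  proof (intro allI)
    fix us ws :: "'a list" and a b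
    show "altT (bas (v # us @ a # b # ws)) = - altT (bas (v # us @ b # a # ws))"
      using alternatingD[OF alternating_altT, of "v # us" a b ws] by simp
  qed
qed

lemma altT_lcons_lcons: "altT (lcons v (lcons w a)) = - altT (lcons w (lcons v a))"
proof (rule linear_eq_bas[where a = a, OF linear_o[OF linear_o[OF linear_lcons linear_lcons] linear_altT]
      linear_compose_neg[OF linear_o[OF linear_o[OF linear_lcons linear_lcons] linear_altT]]])
  fix k
  show "altT (lcons v (lcons w (bas k))) = - altT (lcons w (lcons v (bas k)))"
    using alternatingD[OF alternating_altT, of "[]" v w k] by simp
qed

text \<open>It suffices that exchanging neighbours in a word changes the sign of its alternated
  contraction. If the pair is in front, the scalar terms cancel and two prefixed letters remain in
  both orders, which alternation kills. Otherwise the first letter is split off.\<close>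

lemma altT_ctr_altT: "altT (ctr \<phi> (altT a)) = altT (ctr \<phi> a)"
proof (rule alternating_linear_altT[OF linear_o[OF linear_ctr linear_altT]])
  have "altT (ctrb \<phi> (us @ v # w # ws) + ctrb \<phi> (us @ w # v # ws)) = 0" for us ws v w
  proof (induction us)
    case Nil
    have "ctrb \<phi> (v # w # ws) + ctrb \<phi> (w # v # ws) =
        lcons v (lcons w (ctrb \<phi> ws)) + lcons w (lcons v (ctrb \<phi> ws))"
      by (simp add: linear_diff[OF linear_lcons] linear_scale[OF linear_lcons])
    then show ?case
      using altT_lcons_lcons[of v w "ctrb \<phi> ws"] by (simp add: linear_add[OF linear_altT])
  next
    case (Cons u us)
    let ?c = "ctrb \<phi> (us @ v # w # ws) + ctrb \<phi> (us @ w # v # ws)"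
    have eq: "ctrb \<phi> ((u # us) @ v # w # ws) + ctrb \<phi> ((u # us) @ w # v # ws) =
        \<phi> u *\<^sub>R (bas (us @ v # w # ws) + bas (us @ w # v # ws)) - lcons u ?c"
      by (simp add: linear_add[OF linear_lcons] algebra_simps)
    have "altT (bas (us @ v # w # ws) + bas (us @ w # v # ws)) = 0"
      using alternatingD[OF alternating_altT, of us v w ws] by (simp add: linear_add[OF linear_altT])
    \<comment> \<open>The induction hypothesis is about \<open>altT ?c\<close>;
      \<open>altT_lcons_altT\<close> brings it under the letter \<open>u\<close>.\<close>
    moreover have "altT (lcons u ?c) = 0"
      using Cons altT_lcons_altT[of u ?c] by (simp add: linear_0[OF linear_lcons] linear_0[OF linear_altT])
    ultimately show ?case
      unfolding eq by (simp only: linear_diff[OF linear_altT] linear_scale[OF linear_altT])  simp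
  qed
  then show "alternating (\<lambda>k. altT (ctr \<phi> (bas k)))"
    unfolding alternating_def ctr_bas linear_add[OF linear_altT] eq_neg_iff_add_eq_0 by blast
qed

lemma altT_cliff_altT: "altT (cliff g v (altT a)) = altT (cliff g v a)"
  by (simp add: cliff_def linear_diff[OF linear_altT] altT_lcons_altT altT_ctr_altT)

text \<open>The Clifford relation up to alternation. The two contractions cancel by
  \<open>ctr_ctr\<close>, the mixed terms by the antiderivation rule except for
  \<open>- (2 * g v w)\<close> times \<open>a\<close>; what remains is \<open>v\<close> and
  \<open>w\<close> prefixed in both orders.\<close>

lemma altT_cliff_cliff:
  assumes "g v w = g w v"
  shows "altT (cliff g v (cliff g w a) + cliff g w (cliff g v a) + (2 * g v w) *\<^sub>R a) = 0"
proof -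
  have "cliff g v (cliff g w a) + cliff g w (cliff g v a) + (2 * g v w) *\<^sub>R a
      = lcons v (lcons w a) + lcons w (lcons v a)"
    using ctr_ctr[of "g v" "g w" a] assms
    by (simp add: cliff_def linear_diff[OF linear_ctr] linear_diff[OF linear_lcons] ctr_lcons scaleR_2
        flip: scaleR_scaleR)
  then show ?thesis
    using altT_lcons_lcons[of v w a] by (simp add: linear_add[OF linear_altT])
qed

lemma push_lcons: "push h (lcons v a) = lcons (h v) (push h a)"
  by (rule linear_eq_bas[OF linear_o[OF linear_lcons linear_push]
      linear_o[OF linear_push linear_lcons]]) simp

lemma push_ctr:
  assumes "a \<in> free_on (lists S)" "\<And>w. w \<in> S \<Longrightarrow> \<psi> (h w) = \<phi> w"
  shows "push h (ctr \<phi> a) = ctr \<psi> (push h a)"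
proof (rule linear_eq_on_free[OF linear_o[OF linear_ctr linear_push]
      linear_o[OF linear_push linear_ctr] _ assms(1)])
  fix k assume "k \<in> lists S"
  then show "push h (ctr \<phi> (bas k)) = ctr \<psi> (push h (bas k))"
    by (induction k) (simp_all add: assms(2) linear_0[OF linear_push] linear_diff[OF linear_push]
      linear_scale[OF linear_push] push_lcons)
qed

text \<open>Naturality holds already in the free algebra, before any relation is imposed. Only
  values of the forms on letters from \<open>S\<close> occur.\<close>

lemma push_act:
  assumes "a \<in> free_on (lists S)" "e \<in> free_on (lists S)"
    and "\<And>v w. v \<in> S \<Longrightarrow> w \<in> S \<Longrightarrow> g' (h v) (h w) = g v w"
  shows "push h (act g a e) = act g' (push h a) (push h e)"
proof (rule linear_eq_on_free[OF linear_o[OF linear_act_left linear_push]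
      linear_o[OF linear_push linear_act_left] _ assms(1)])
  fix k assume "k \<in> lists S"
  then show "push h (act g (bas k) e) = act g' (push h (bas k)) (push h e)"
  proof (induction k)
    case (Cons v k)
    then have v: "v \<in> S" and k: "k \<in> lists S" by auto
    show ?case
      using Cons.IH push_ctr[OF foldr_cliff_free_on[OF k assms(2)], of "g' (h v)" h "g v" g]
        assms(3)[OF v]
      by (simp add: cliff_def[of _ v] cliff_def[of _ "h v"] linear_diff[OF linear_push] push_lcons)
  qed simp
qed

section \<open>Tensor and exterior algebras of a fibre\<close>

lemma linear_span_into:
  assumes "linear f" "subspace T" "\<And>b. b \<in> B \<Longrightarrow> f b \<in> T" "a \<in> span B"
  shows "f a \<in> T"
proof -
  have "span B \<subseteq> f -` T"
    by (rule span_minimal) (use assms in \<open>auto intro: linear_subspace_vimage\<close>)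
  then show ?thesis using assms(4) by auto
qed

lemma linear_free_into:
  assumes "linear f" "subspace T" "a \<in> free_on X" "\<And>k. k \<in> X \<Longrightarrow> f (bas k) \<in> T"
  shows "f a \<in> T"
  using assms(3)
  by (induction rule: free_on_induct)
    (auto simp: linear_add[OF assms(1)] linear_scale[OF assms(1)] linear_0[OF assms(1)]
      intro!: assms(4) subspace_add[OF assms(2)] subspace_scale[OF assms(2)] subspace_0[OF assms(2)])

text \<open>The multilinearity relations for words of all lengths at once, while
  \<open>multilin_rels\<close> fixes the length. They generate the kernel of the passage from the
  free algebra to the tensor algebra.\<close>

definition rel_gens :: "('v, 'x) pbundle \<Rightarrow> 'x \<Rightarrow> ('v list \<Rightarrow>\<^sub>0 real) set" where
  "rel_gens V x =
     {bas (us @ [vadd V v w] @ ws) - bas (us @ [v] @ ws) - bas (us @ [w] @ ws) |us v w ws.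
        us @ [v] @ ws \<in> lists (fibre V x) \<and> us @ [w] @ ws \<in> lists (fibre V x)} \<union>
     {bas (us @ [vscale V c v] @ ws) - c *\<^sub>R bas (us @ [v] @ ws) |us c v ws.
        us @ [v] @ ws \<in> lists (fibre V x)}"

definition rels :: "('v, 'x) pbundle \<Rightarrow> 'x \<Rightarrow> ('v list \<Rightarrow>\<^sub>0 real) set" where
  "rels V x = span (rel_gens V x)"

text \<open>Linearity up to elements of \<open>T\<close>. An operator on words respects the
  multilinearity relations if it is linear in this sense in every slot.\<close>

definition linear_mod :: "('v, 'x) pbundle \<Rightarrow> 'x \<Rightarrow> 'b::real_vector set \<Rightarrow> ('v \<Rightarrow> 'b) \<Rightarrow> bool" where
  "linear_mod V x T \<phi> \<longleftrightarrow>
     (\<forall>v\<in>fibre V x. \<forall>w\<in>fibre V x. \<phi> (vadd V v w) - \<phi> v - \<phi> w \<in> T) \<and>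
     (\<forall>c. \<forall>v\<in>fibre V x. \<phi> (vscale V c v) - c *\<^sub>R \<phi> v \<in> T)"

lemma linear_mod_compose:
  assumes "linear L" "linear_mod V x T \<phi>" "\<And>t. t \<in> T \<Longrightarrow> L t \<in> T'"
  shows "linear_mod V x T' (\<lambda>u. L (\<phi> u))"
  using assms(2,3) unfolding linear_mod_def
  by (simp flip: linear_diff[OF assms(1)] linear_scale[OF assms(1)])

lemma linear_mod_diff:
  assumes "subspace T" "linear_mod V x T \<phi>" "linear_mod V x T \<psi>"
  shows "linear_mod V x T (\<lambda>u. \<phi> u - \<psi> u)"
proof -
  have "a - a' - (b - b') - (c - c') \<in> T" if "a - b - c \<in> T" "a' - b' - c' \<in> T" for a a' b b' c c'
    using subspace_diff[OF assms(1) that] by (simp add: algebra_simps)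
  moreover have "a - a' - r *\<^sub>R (b - b') \<in> T" if "a - r *\<^sub>R b \<in> T" "a' - r *\<^sub>R b' \<in> T" for a a' b b' r
    using subspace_diff[OF assms(1) that] by (simp add: algebra_simps)
  ultimately show ?thesis using assms(2,3) unfolding linear_mod_def by blast
qed

lemma linear_mod_sum:
  assumes "subspace T" "\<And>i. i \<in> I \<Longrightarrow> linear_mod V x T (\<phi> i)"
  shows "linear_mod V x T (\<lambda>u. \<Sum>i\<in>I. \<phi> i u)"
  unfolding linear_mod_def scaleR_sum_right sum_subtractf[symmetric]
  by (intro conjI ballI allI subspace_sum[OF assms(1)]) (use assms(2) in \<open>simp_all add: linear_mod_def\<close>)

lemma linear_mod_scale:
  "subspace T \<Longrightarrow> linear_mod V x T \<phi> \<Longrightarrow> linear_mod V x T (\<lambda>u. c *\<^sub>R \<phi> u)"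
  by (rule linear_mod_compose[OF linear_scale_self]) (auto intro: subspace_scale)

text \<open>All algebras of a fibre are presented by the free algebra on its elements: \<open>tau\<close> sends an
  element of the free algebra to its class in the tensor algebra. The exterior algebra, being the
  image of \<open>Alt\<close>, is covered by \<open>tau \<circ> altT\<close>.\<close>

definition tau :: "('v, 'x) pbundle \<Rightarrow> 'x \<Rightarrow> ('v list \<Rightarrow>\<^sub>0 real) \<Rightarrow>
    'x \<times> (nat \<Rightarrow> 'x \<times> ('v list \<Rightarrow>\<^sub>0 real) set)" where
  "tau V x a = (x, \<lambda>n. (x, tcoset V x n (hcomp n a)))"

lemma tpow_simps [simp]:
  "points (tot (tpow V n)) = {(x, tcoset V x n a) |x a.
     x \<in> points (base V) \<and> Poly_Mapping.keys a \<subseteq> tuples V x n}"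
  "base (tpow V n) = base V"
  "proj (tpow V n) = fst"
  "vadd (tpow V n) = (\<lambda>(x, A) (_, B). (x, {a + b |a b. a \<in> A \<and> b \<in> B}))"
  "vscale (tpow V n) = (\<lambda>c (x, A). (x, \<Union>a\<in>A. tcoset V x n (c *\<^sub>R a)))"
  "vzero (tpow V n) = (\<lambda>x. (x, tcoset V x n 0))"
  by (simp_all add: tpow_def Let_def)

lemma dsum_simps [simp]:
  "points (tot (dsum W)) = {(x, s). x \<in> points (base (W 0)) \<and> (\<forall>n. s n \<in> fibre (W n) x) \<and>
                       finite {n. s n \<noteq> vzero (W n) x}}"
  "base (dsum W) = base (W 0)"
  "proj (dsum W) = fst"
  "vadd (dsum W) = (\<lambda>(x, s) (_, t). (x, \<lambda>n. vadd (W n) (s n) (t n)))"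
  "vscale (dsum W) = (\<lambda>a (x, s). (x, \<lambda>n. vscale (W n) a (s n)))"
  "vzero (dsum W) = (\<lambda>x. (x, \<lambda>n. vzero (W n) x))"
  by (simp_all add: dsum_def Let_def)

lemma ext_pow_simps [simp]:
  "points (tot (ext_pow V n)) = points (tot (tpow V n)) \<inter> Alt V n ` points (tot (tpow V n))"
  "base (ext_pow V n) = base V"
  "proj (ext_pow V n) = fst"
  "vadd (ext_pow V n) = vadd (tpow V n)"
  "vscale (ext_pow V n) = vscale (tpow V n)"
  "vzero (ext_pow V n) = vzero (tpow V n)"
  unfolding ext_pow_def by (simp_all add: sub_dsp_def)

lemma ext_simps:
  "vadd (ext V) = vadd (talg V)"
  "vscale (ext V) = vscale (talg V)"
  "vzero (ext V) = vzero (talg V)"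
  "base (ext V) = base V"
  "proj (ext V) = fst"
  by (simp_all add: ext_def)

section \<open>Cosets of the multilinearity relations\<close>

lemma subspace_multilin_rels: "subspace (multilin_rels V x n)"
  by (simp add: multilin_rels_def)

lemma subspace_rels: "subspace (rels V x)"
  by (simp add: rels_def)

lemma tuples_eq: "tuples V x n = {k \<in> lists (fibre V x). length k = n}"
  by (auto simp: tuples_def)

lemma mem_tcoset: "c \<in> tcoset V x n a \<longleftrightarrow> c - a \<in> multilin_rels V x n"
  by (auto simp: tcoset_def image_iff intro!: bexI[of _ "c - a"])

lemma tcoset_eq_iff: "tcoset V x n a = tcoset V x n b \<longleftrightarrow> a - b \<in> multilin_rels V x n"
proof
  assume "tcoset V x n a = tcoset V x n b"
  moreover have "a \<in> tcoset V x n a" by (simp add: mem_tcoset subspace_0[OF subspace_multilin_rels])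
  ultimately show "a - b \<in> multilin_rels V x n" by (simp add: mem_tcoset)
next
  assume ab: "a - b \<in> multilin_rels V x n"
  have "c - a \<in> multilin_rels V x n \<longleftrightarrow> c - b \<in> multilin_rels V x n" for c
    using subspace_add[OF subspace_multilin_rels _ ab, of "c - a"]
      subspace_diff[OF subspace_multilin_rels _ ab, of "c - b"] by auto
  then show "tcoset V x n a = tcoset V x n b" by (auto simp: mem_tcoset)
qed

text \<open>Operations on cosets are defined as unions over all representatives; once the sets
  \<open>T b\<close> are known to coincide, the union collapses to one of them.\<close>

lemma UN_tcoset:
  assumes "\<And>b. b - a \<in> multilin_rels V x n \<Longrightarrow> T b = T a"
  shows "(\<Union>b\<in>tcoset V x n a. T b) = T a"
proof -
  have "a \<in> tcoset V x n a" by (simp add: mem_tcoset subspace_0[OF subspace_multilin_rels])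
  moreover have "T b = T a" if "b \<in> tcoset V x n a" for b
    by (rule assms) (use that in \<open>simp add: mem_tcoset\<close>)
  ultimately show ?thesis by blast
qed

lemma tcoset_add:
  "{c + d |c d. c \<in> tcoset V x n a \<and> d \<in> tcoset V x n b} = tcoset V x n (a + b)"
proof (intro subset_antisym subsetI)
  fix e assume "e \<in> {c + d |c d. c \<in> tcoset V x n a \<and> d \<in> tcoset V x n b}"
  then show "e \<in> tcoset V x n (a + b)"
    using subspace_add[OF subspace_multilin_rels[of V x n]] by (auto simp: mem_tcoset add_diff_add)
next
  fix e assume "e \<in> tcoset V x n (a + b)"
  then have "e = a + (e - a) \<and> a \<in> tcoset V x n a \<and> e - a \<in> tcoset V x n b"
    by (simp add: mem_tcoset subspace_0[OF subspace_multilin_rels] diff_diff_eq)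
  then show "e \<in> {c + d |c d. c \<in> tcoset V x n a \<and> d \<in> tcoset V x n b}" by blast
qed

lemma vadd_tpow: "vadd (tpow V n) (x, tcoset V x n a) (x, tcoset V x n b) = (x, tcoset V x n (a + b))"
  by (simp add: tcoset_add)

lemma vscale_tpow: "vscale (tpow V n) c (x, tcoset V x n a) = (x, tcoset V x n (c *\<^sub>R a))"
proof -
  have "tcoset V x n (c *\<^sub>R b) = tcoset V x n (c *\<^sub>R a)" if "b - a \<in> multilin_rels V x n" for b
    using subspace_scale[OF subspace_multilin_rels that, of c] by (simp add: tcoset_eq_iff scaleR_diff_right)
  then have "(\<Union>b\<in>tcoset V x n a. tcoset V x n (c *\<^sub>R b)) = tcoset V x n (c *\<^sub>R a)" by (rule UN_tcoset)
  then show ?thesis by simp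
qed

lemma vsum_tpow:
  "vsum (tpow V n) x (map (\<lambda>i. (x, tcoset V x n (c i))) is) = (x, tcoset V x n (sum_list (map c is)))"
  unfolding vsum_def by (induction "is") (simp_all del: tpow_simps(4) add: vadd_tpow)

lemma vadd_tau: "vadd (talg V) (tau V x a) (tau V x b) = tau V x (a + b)"
  by (simp add: tau_def vadd_tpow linear_add[OF linear_hcomp] del: tpow_simps)

lemma vscale_tau: "vscale (talg V) c (tau V x a) = tau V x (c *\<^sub>R a)"
  by (simp add: tau_def vscale_tpow linear_scale[OF linear_hcomp] del: tpow_simps)

lemma vzero_tau: "vzero (talg V) x = tau V x 0"
  by (simp add: tau_def linear_0[OF linear_hcomp])

lemma vsum_ext: "vsum (ext V) x (map (\<lambda>i. tau V x (c i)) is) = tau V x (sum_list (map c is))"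
  unfolding vsum_def by (induction "is") (simp_all only: list.map foldr.simps comp_apply id_apply sum_list.Nil sum_list.Cons
     ext_simps vadd_tau vzero_tau)

lemma talg_tens_tau: "talg_tens V x vs = tau V x (bas vs)"
  by (auto simp: talg_tens_def tens_def dsum_in_def tau_def hcomp_bas Let_def)

text \<open>Closure properties of a single fibre, which can be verified fibre by fibre for duals and
  gluings.\<close>

locale vfibre =
  fixes V :: "('v, 'x) pbundle" and x :: 'x
  assumes base_pt: "x \<in> points (base V)"
    and vadd_closed: "v \<in> fibre V x \<Longrightarrow> w \<in> fibre V x \<Longrightarrow> vadd V v w \<in> fibre V x"
    and vscale_closed: "v \<in> fibre V x \<Longrightarrow> vscale V c v \<in> fibre V x"
    and vzero_closed: "vzero V x \<in> fibre V x"
begin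

abbreviation "F \<equiv> free_on (lists (fibre V x))"

lemma linear_mod_bas:
  assumes "us \<in> lists (fibre V x)" "ws \<in> lists (fibre V x)"
  shows "linear_mod V x (rels V x) (\<lambda>u. bas (us @ u # ws))"
  unfolding linear_mod_def
proof (intro conjI ballI allI)
  fix v w c assume v: "v \<in> fibre V x"
  have "bas (us @ [vscale V c v] @ ws) - c *\<^sub>R bas (us @ [v] @ ws) \<in> rel_gens V x"
    unfolding rel_gens_def
    by (intro UnI2 CollectI exI[of _ us] exI[of _ v] exI[of _ c] exI[of _ ws]) (use assms v in simp)
  then show "bas (us @ vscale V c v # ws) - c *\<^sub>R bas (us @ v # ws) \<in> rels V x"
    by (simp add: rels_def span_base)
  assume "w \<in> fibre V x"
  then have "bas (us @ [vadd V v w] @ ws) - bas (us @ [v] @ ws) - bas (us @ [w] @ ws) \<in> rel_gens V x"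
    unfolding rel_gens_def
    by (intro UnI1 CollectI exI[of _ us] exI[of _ v] exI[of _ w] exI[of _ ws]) (use assms v in simp)
  then show "bas (us @ vadd V v w # ws) - bas (us @ v # ws) - bas (us @ w # ws) \<in> rels V x"
    by (simp add: rels_def span_base)
qed

lemma rels_into:
  assumes "linear f" "subspace T" "r \<in> rels V x"
    and "\<And>us ws. us \<in> lists (fibre V x) \<Longrightarrow> ws \<in> lists (fibre V x) \<Longrightarrow> linear_mod V x T (\<lambda>u. f (bas (us @ u # ws)))"
  shows "f r \<in> T"
  using assms(3) unfolding rels_def
proof (rule linear_span_into[OF assms(1,2), rotated])
  fix b assume "b \<in> rel_gens V x"
  then consider us v w ws where "b = bas (us @ vadd V v w # ws) - bas (us @ v # ws) - bas (us @ w # ws)"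
      "us @ [v] @ ws \<in> lists (fibre V x)" "us @ [w] @ ws \<in> lists (fibre V x)"
    | us v c ws where "b = bas (us @ vscale V c v # ws) - c *\<^sub>R bas (us @ v # ws)"
      "us @ [v] @ ws \<in> lists (fibre V x)"
    unfolding rel_gens_def by fastforce
  then show "f b \<in> T"
  proof cases
    case 1
    then show ?thesis using assms(4)[of us ws] by (simp add: linear_diff[OF assms(1)] linear_mod_def)
  next
    case 2
    then show ?thesis using assms(4)[of us ws]
      by (simp add: linear_diff[OF assms(1)] linear_scale[OF assms(1)] linear_mod_def)
  qed
qed

lemma rels_subset_free: "rels V x \<subseteq> F"
proof
  fix r assume "r \<in> rels V x"
  then show "r \<in> F"
    by (rule rels_into[OF linear_id[unfolded id_def] subspace_free_on])
      (auto simp: linear_mod_def intro!: free_on_diff free_on_scale vadd_closed vscale_closed)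
qed

lemma multilin_rels_subset:
  assumes "a \<in> multilin_rels V x n"
  shows "a \<in> rels V x" "a \<in> free_on {k. length k = n}"
proof -
  have "multilin_rels V x n \<subseteq> rels V x"
    unfolding multilin_rels_def rels_def
    by (rule span_mono) (unfold rel_gens_def tuples_eq, blast)
  then show "a \<in> rels V x" using assms by auto
  have "multilin_rels V x n \<subseteq> free_on {k. length k = n}"
    unfolding multilin_rels_def
    by (rule span_minimal[OF _ subspace_free_on])
      (auto simp: tuples_eq intro!: free_on_diff free_on_scale)
  then show "a \<in> free_on {k. length k = n}" using assms by auto
qed

text \<open>The relations are homogeneous: all words of a generator have the same length, so a
  component of it is either the generator itself or zero.\<close>

lemma hcomp_rels:
  assumes "a \<in> rels V x"
  shows "hcomp n a \<in> multilin_rels V x n"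
proof (rule rels_into[OF linear_hcomp subspace_multilin_rels assms])
  fix us ws assume *: "us \<in> lists (fibre V x)" "ws \<in> lists (fibre V x)"
  show "linear_mod V x (multilin_rels V x n) (\<lambda>u. hcomp n (bas (us @ u # ws)))"
  proof (cases "Suc (length us + length ws) = n")
    case True
    have "bas (us @ [vadd V v w] @ ws) - bas (us @ [v] @ ws) - bas (us @ [w] @ ws) \<in> multilin_rels V x n"
      if "v \<in> fibre V x" "w \<in> fibre V x" for v w
      unfolding multilin_rels_def
      by (intro span_base UnI1 CollectI exI[of _ us] exI[of _ v] exI[of _ w] exI[of _ ws])
        (use * True that in \<open>auto simp: tuples_eq\<close>)
    moreover have "bas (us @ [vscale V c v] @ ws) - c *\<^sub>R bas (us @ [v] @ ws) \<in> multilin_rels V x n"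
      if "v \<in> fibre V x" for v c
      unfolding multilin_rels_def
      by (intro span_base UnI2 CollectI exI[of _ us] exI[of _ v] exI[of _ c] exI[of _ ws])
        (use * True that in \<open>auto simp: tuples_eq\<close>)
    ultimately show ?thesis using True by (simp add: hcomp_bas linear_mod_def)
  qed (simp add: hcomp_bas linear_mod_def subspace_0[OF subspace_multilin_rels])
qed

lemma multilin_rels_iff:
  "a \<in> multilin_rels V x n \<longleftrightarrow> a \<in> rels V x \<and> a \<in> free_on {k. length k = n}"
  using multilin_rels_subset[of a n] hcomp_rels[of a n] hcomp_eq_self[of a n] by auto

text \<open>Equality in the tensor algebra is equality modulo relations in every degree. Since an
  element of the free algebra is the finite sum of its components, the degrees can be put together
  again.\<close>

lemma tau_eq_iff: "tau V x a = tau V x b \<longleftrightarrow> a - b \<in> rels V x"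
proof
  assume "tau V x a = tau V x b"
  then have hc: "hcomp n (a - b) \<in> multilin_rels V x n" for n
    by (simp add: tau_def fun_eq_iff tcoset_eq_iff linear_diff[OF linear_hcomp])
  have "(\<Sum>n\<in>length ` Poly_Mapping.keys (a - b). hcomp n (a - b)) \<in> rels V x"
    by (rule subspace_sum[OF subspace_rels]) (rule multilin_rels_subset(1)[OF hc])
  then show "a - b \<in> rels V x" by (simp add: sum_hcomp)
next
  assume "a - b \<in> rels V x"
  then show "tau V x a = tau V x b"
    using hcomp_rels[of "a - b"] by (simp add: tau_def fun_eq_iff tcoset_eq_iff linear_diff[OF linear_hcomp])
qed

lemma rels_fmul_right:
  assumes "r \<in> rels V x" "b \<in> F"
  shows "fmul r b \<in> rels V x"
  by (rule linear_free_into[OF linear_fmul_right subspace_rels assms(2)],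
      rule rels_into[OF linear_fmul_left subspace_rels assms(1)]) (simp add: linear_mod_bas)

lemma rels_fmul_left:
  assumes "r \<in> rels V x" "b \<in> F"
  shows "fmul b r \<in> rels V x"
proof (rule linear_free_into[OF linear_fmul_left subspace_rels assms(2)],
    rule rels_into[OF linear_fmul_right subspace_rels assms(1)])
  show "linear_mod V x (rels V x) (\<lambda>u. fmul (bas k) (bas (us @ u # ws)))"
    if "k \<in> lists (fibre V x)" "us \<in> lists (fibre V x)" "ws \<in> lists (fibre V x)" for k us ws
    using linear_mod_bas[of "k @ us" ws] that by simp
qed

text \<open>The unions in the definitions range over the whole coset; this guarantees that every
  representative is still built from tuples in the fibre.\<close>

lemma tcoset_subset_free:
  assumes "a \<in> free_on (tuples V x n)" "b \<in> tcoset V x n a"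
  shows "b \<in> free_on (tuples V x n)"
proof -
  have "b - a \<in> free_on (tuples V x n)"
    using multilin_rels_subset[of "b - a" n] rels_subset_free assms(2)
    by (auto simp: mem_tcoset free_on_def tuples_eq)
  from free_on_add[OF this assms(1)] show ?thesis by simp
qed

lemma free_tuples: "a \<in> free_on (tuples V x n) \<Longrightarrow> a \<in> F"
  by (auto simp: free_on_def tuples_eq)

lemma tpow_mul_tcoset:
  assumes "a \<in> free_on (tuples V x m)" "b \<in> free_on (tuples V x n)"
  shows "tpow_mul V m n (x, tcoset V x m a) (x, tcoset V x n b) = (x, tcoset V x (m + n) (fmul a b))"
proof -
  have len: "fmul c d \<in> free_on {k. length k = m + n}"
    if "c \<in> free_on {k. length k = m}" "d \<in> free_on {k. length k = n}" for c d :: "'v list \<Rightarrow>\<^sub>0 real"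
    unfolding fmul_eq
    by (rule lext_in_subspace[OF subspace_free_on that(1)], rule lext_in_subspace[OF subspace_free_on that(2)]) simp
  have lena: "c \<in> free_on {k. length k = p}" if "c \<in> free_on (tuples V x p)" for c p
    using that by (auto simp: free_on_def tuples_eq)
  have eq: "tcoset V x (m + n) (fmul a' b') = tcoset V x (m + n) (fmul a b)"
    if a': "a' - a \<in> multilin_rels V x m" and b': "b' - b \<in> multilin_rels V x n" for a' b'
  proof -
    have b'F: "b' \<in> free_on (tuples V x n)"
      using tcoset_subset_free[OF assms(2)] b' by (simp add: mem_tcoset)
    \<comment> \<open>One factor is exchanged at a time, so that the relations form one factor of
      each summand.\<close>
    have "fmul a' b' - fmul a b = fmul (a' - a) b' + fmul a (b' - b)"
      by (simp add: linear_diff[OF linear_fmul_left] linear_diff[OF linear_fmul_right])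
    also have "\<dots> \<in> multilin_rels V x (m + n)"
    proof (rule subspace_add[OF subspace_multilin_rels])
      show "fmul (a' - a) b' \<in> multilin_rels V x (m + n)"
        unfolding multilin_rels_iff using multilin_rels_subset[OF a'] b'F
        by (intro conjI rels_fmul_right len) (auto intro: free_tuples lena)
      show "fmul a (b' - b) \<in> multilin_rels V x (m + n)"
        unfolding multilin_rels_iff using multilin_rels_subset[OF b'] assms(1)
        by (intro conjI rels_fmul_left len) (auto intro: free_tuples lena)
    qed
    finally show ?thesis by (simp add: tcoset_eq_iff)
  qed
  have "(\<Union>b'\<in>tcoset V x n b. tcoset V x (m + n) (fmul a' b')) = tcoset V x (m + n) (fmul a b)"
    if "a' - a \<in> multilin_rels V x m" for a'
    using UN_tcoset[of b V x n "\<lambda>b'. tcoset V x (m + n) (fmul a' b')"] eq[OF that]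
      subspace_0[OF subspace_multilin_rels[of V x n]] by simp
  then have "(\<Union>a'\<in>tcoset V x m a. \<Union>b'\<in>tcoset V x n b. tcoset V x (m + n) (fmul a' b'))
      = tcoset V x (m + n) (fmul a b)"
    using UN_tcoset[of a V x m "\<lambda>a'. \<Union>b'\<in>tcoset V x n b. tcoset V x (m + n) (fmul a' b')"]
      subspace_0[OF subspace_multilin_rels[of V x m]] by simp
  then show ?thesis by (simp add: tpow_mul_def)
qed

lemma hcomp_free: "a \<in> F \<Longrightarrow> hcomp n a \<in> free_on (tuples V x n)"
  unfolding tuples_eq by (rule hcomp_free_on)

lemma talg_mul_tau:
  assumes "a \<in> F" "b \<in> F"
  shows "talg_mul V (tau V x a) (tau V x b) = tau V x (fmul a b)"
proof -
  have "vsum (tpow V n) x (map (\<lambda>i. tpow_mul V i (n - i) (x, tcoset V x i (hcomp i a))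
      (x, tcoset V x (n - i) (hcomp (n - i) b))) [0..<Suc n]) = (x, tcoset V x n (hcomp n (fmul a b)))" for n
  proof -
    have "map (\<lambda>i. tpow_mul V i (n - i) (x, tcoset V x i (hcomp i a))
        (x, tcoset V x (n - i) (hcomp (n - i) b))) [0..<Suc n]
      = map (\<lambda>i. (x, tcoset V x n (fmul (hcomp i a) (hcomp (n - i) b)))) [0..<Suc n]"
      using tpow_mul_tcoset[OF hcomp_free[OF assms(1)] hcomp_free[OF assms(2)]]
      by (auto simp del: upt_Suc)
    moreover have "sum_list (map (\<lambda>i. fmul (hcomp i a) (hcomp (n - i) b)) [0..<Suc n]) = hcomp n (fmul a b)"
      unfolding interv_sum_list_conv_sum_set_nat hcomp_fmul
      by (rule sum.cong) auto
    ultimately show ?thesis by (simp only: vsum_tpow)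
  qed
  then show ?thesis by (simp add: talg_mul_def tau_def del: upt_Suc)
qed

lemma fibre_tpow: "fibre (tpow V n) x = {(x, tcoset V x n a) |a. a \<in> free_on (tuples V x n)}"
  using base_pt by (auto simp: over_def free_on_def)

text \<open>A sequence with finite support is represented by one element, the sum of representatives
  over the support. \<open>L\<close> is the identity for the tensor algebra and \<open>altT\<close>
  for the exterior algebra.\<close>

lemma tau_surj_aux:
  assumes "\<And>n. s n = (x, tcoset V x n (L (a n)))" "\<And>n. a n \<in> free_on (tuples V x n)" "linear L"
    "\<And>n c. hcomp n (L c) = L (hcomp n c)"
    "finite {n. s n \<noteq> (x, tcoset V x n 0)}"
  shows "\<exists>c\<in>F. (x, s) = tau V x (L c)"
proof -
  let ?N = "{n. s n \<noteq> (x, tcoset V x n 0)}"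
  let ?c = "\<Sum>n\<in>?N. a n"
  have "s n = (x, tcoset V x n (hcomp n (L ?c)))" for n
  proof -
    have hc: "hcomp n (a m) = (if m = n then a n else 0)" for m
    proof (cases "m = n")
      case True
      then show ?thesis using assms(2)[of n] hcomp_eq_self[of "a n" n] by (auto simp: free_on_def tuples_eq)
    next
      case False
      then show ?thesis using assms(2)[of m] hcomp_eq_0[of "a m" n] by (auto simp: free_on_def tuples_eq)
    qed
    have hcn: "hcomp n ?c = (if n \<in> ?N then a n else 0)"
      unfolding linear_sum[OF linear_hcomp] hc using assms(5) by (simp add: sum.delta)
    show ?thesis
    proof (cases "n \<in> ?N")
      case True
      then show ?thesis unfolding assms(4) hcn using assms(1)[of n] by (simp only: if_True)
    next
      case False
      then have "s n = (x, tcoset V x n 0)" by blast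
      moreover have "hcomp n (L ?c) = 0" unfolding assms(4) hcn using False linear_0[OF assms(3)] by (simp only: if_False)
      ultimately show ?thesis by (simp only:)
    qed
  qed
  then have "s = (\<lambda>n. (x, tcoset V x n (hcomp n (L ?c))))" by (rule HOL.ext)
  then have "(x, s) = tau V x (L ?c)" unfolding tau_def by (rule arg_cong)
  moreover have "?c \<in> F" using assms(2) by (intro subspace_sum[OF subspace_free_on]) (auto intro: free_tuples)
  ultimately show ?thesis by blast
qed

lemma finite_support_tau: "finite {n. (x, tcoset V x n (hcomp n a)) \<noteq> (x, tcoset V x n 0)}"
proof (rule finite_subset)
  show "{n. (x, tcoset V x n (hcomp n a)) \<noteq> (x, tcoset V x n 0)} \<subseteq> length ` Poly_Mapping.keys a"
  proof
    fix n assume "n \<in> {n. (x, tcoset V x n (hcomp n a)) \<noteq> (x, tcoset V x n 0)}"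
    then have "hcomp n a \<noteq> 0" by auto
    then show "n \<in> length ` Poly_Mapping.keys a"
      using hcomp_eq_0[of a n] by (auto simp: free_on_def)
  qed
qed simp

lemma tau_in_fibre: "a \<in> F \<Longrightarrow> tau V x a \<in> fibre (talg V) x"
proof -
  assume "a \<in> F"
  then have "(x, tcoset V x n (hcomp n a)) \<in> fibre (tpow V n) x" for n
    using hcomp_free[of a n] unfolding fibre_tpow by blast
  then show ?thesis
    using base_pt finite_support_tau[of a] by (simp add: over_def tau_def)
qed

lemma fibre_talg: "fibre (talg V) x = tau V x ` F"
proof
  show "tau V x ` F \<subseteq> fibre (talg V) x" using tau_in_fibre by auto
  show "fibre (talg V) x \<subseteq> tau V x ` F"
  proof
    fix t assume t: "t \<in> fibre (talg V) x"
    then obtain s where ts: "t = (x, s)" and s: "\<And>n. s n \<in> fibre (tpow V n) x"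
      and fin: "finite {n. s n \<noteq> (x, tcoset V x n 0)}"
      by (auto simp: over_def)
    from s have "\<exists>a. s n = (x, tcoset V x n a) \<and> a \<in> free_on (tuples V x n)" for n
      unfolding fibre_tpow by auto
    then obtain a where "\<And>n. s n = (x, tcoset V x n (a n))" "\<And>n. a n \<in> free_on (tuples V x n)" by metis
    from tau_surj_aux[of s "\<lambda>a. a", OF this linear_id[unfolded id_def] refl fin] ts
    show "t \<in> tau V x ` F" by auto
  qed
qed

subsection \<open>Alternation respects the multilinearity relations\<close>

text \<open>A permutation moves the slot of \<open>u\<close> to a place that does not depend on
  \<open>u\<close>. To see this, the slot is marked by \<open>None\<close> and all other letters by
  \<open>Some\<close>; the mark occurs exactly once in the permuted list.\<close>

lemma permute_list_split:
  assumes "\<sigma> permutes {..<Suc (length us + length ws)}"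
  obtains us' ws' where "set us' \<subseteq> set us \<union> set ws" "set ws' \<subseteq> set us \<union> set ws"
    "\<And>u :: 'v. permute_list \<sigma> (us @ u # ws) = us' @ u # ws'"
proof -
  let ?K = "map Some us @ None # map Some ws"
  have \<sigma>: "\<sigma> permutes {..<length ?K}" using assms by simp
  have ms: "mset (permute_list \<sigma> ?K) = mset ?K" by (rule mset_permute_list[OF \<sigma>])
  have "None \<in> set (permute_list \<sigma> ?K)" using \<sigma> by simp
  then obtain A B where AB: "permute_list \<sigma> ?K = A @ None # B" by (meson split_list)
  have "count (mset A) None + count (mset B) None = 0"
    using arg_cong[OF ms, of "\<lambda>M. count M None"] unfolding AB
    by (simp add: count_mset_0_iff[THEN iffD2] image_iff flip: mset_map)
  then have none: "None \<notin> set A" "None \<notin> set B" by (simp_all add: count_eq_zero_iff)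
  have sets: "set A \<union> set B \<subseteq> Some ` (set us \<union> set ws)"
    using none arg_cong[OF ms, of set_mset] unfolding AB by (simp add: image_Un insert_ident)
  have "permute_list \<sigma> (us @ u # ws) = map the A @ u # map the B" for u
  proof -
    have "us @ u # ws = map (case_option u id) ?K" by (simp add: comp_def)
    then have "permute_list \<sigma> (us @ u # ws) = map (case_option u id) (A @ None # B)"
      using permute_list_map[OF \<sigma>] AB by metis
    also have "\<dots> = map the A @ u # map the B"
      using none by (auto split: option.split simp: map_eq_conv[of _ A] map_eq_conv[of _ B])
    finally show ?thesis .
  qed
  moreover have "set (map the A) \<subseteq> set us \<union> set ws" "set (map the B) \<subseteq> set us \<union> set ws"
    using sets by auto
  ultimately show ?thesis using that by blast
qed

text \<open>Every summand of the alternation is a permuted word with \<open>u\<close> in a single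
  slot, hence linear in \<open>u\<close> modulo relations.\<close>

lemma altT_rels:
  assumes "r \<in> rels V x"
  shows "altT r \<in> rels V x"
proof (rule rels_into[OF linear_altT subspace_rels assms])
  fix us ws assume *: "us \<in> lists (fibre V x)" "ws \<in> lists (fibre V x)"
  have "linear_mod V x (rels V x) (\<lambda>u. bas (permute_list \<sigma> (us @ u # ws)))"
    if \<sigma>: "\<sigma> permutes {..<Suc (length us + length ws)}" for \<sigma>
    using * by (rule_tac permute_list_split[OF \<sigma>]) (auto intro!: linear_mod_bas)
  then show "linear_mod V x (rels V x) (\<lambda>u. altT (bas (us @ u # ws)))"
    unfolding altT_bas altb_def length_append list.size add_0_right add_Suc_right
    by (intro linear_mod_scale linear_mod_sum subspace_rels) simp
qed

lemma altT_in_multilin_rels: "r \<in> multilin_rels V x n \<Longrightarrow> altT r \<in> multilin_rels V x n"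
  using altT_rels[of r] hcomp_rels[of "altT r" n] by (auto simp: multilin_rels_iff hcomp_altT hcomp_eq_self)

lemma Alt_tcoset:
  assumes "a \<in> free_on (tuples V x n)"
  shows "Alt V n (x, tcoset V x n a) = (x, tcoset V x n (altT a))"
proof -
  have len: "alt n b = altT b" if "b - a \<in> multilin_rels V x n" for b
    using tcoset_subset_free[OF assms] that
    by (intro alt_eq_altT) (auto simp: mem_tcoset free_on_def tuples_eq)
  have "tcoset V x n (alt n b) = tcoset V x n (alt n a)" if "b - a \<in> multilin_rels V x n" for b
    using altT_in_multilin_rels[OF that] len[OF that] len[of a] subspace_0[OF subspace_multilin_rels[of V x n]]
    by (simp add: tcoset_eq_iff linear_diff[OF linear_altT])
  then have "(\<Union>b\<in>tcoset V x n a. tcoset V x n (alt n b)) = tcoset V x n (alt n a)"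
    by (rule UN_tcoset)
  then show ?thesis
    using len[of a] subspace_0[OF subspace_multilin_rels[of V x n]] by (simp add: Alt_def)
qed

lemma wedge_tau:
  assumes "vs \<in> lists (fibre V x)"
  shows "wedge V x vs = tau V x (altT (bas vs))"
proof -
  have "Alt V (length vs) (tens V x vs) = (x, tcoset V x (length vs) (altT (bas vs)))"
    unfolding tens_def by (rule Alt_tcoset) (use assms in \<open>simp add: tuples_eq\<close>)
  moreover have "hcomp n (altT (bas vs)) = (if n = length vs then altT (bas vs) else 0)" for n
    by (simp add: hcomp_altT hcomp_bas linear_0[OF linear_altT])
  ultimately show ?thesis by (auto simp: wedge_def dsum_in_def Let_def tau_def)
qed

lemma fibre_ext: "fibre (ext V) x = (\<lambda>a. tau V x (altT a)) ` F"
proof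
  show "(\<lambda>a. tau V x (altT a)) ` F \<subseteq> fibre (ext V) x"
  proof
    fix t assume "t \<in> (\<lambda>a. tau V x (altT a)) ` F"
    then obtain a where a: "a \<in> F" "t = tau V x (altT a)" by auto
    have "(x, tcoset V x n (hcomp n (altT a))) \<in> fibre (ext_pow V n) x" for n
    proof -
      have mem: "(x, tcoset V x n (hcomp n c)) \<in> fibre (tpow V n) x" if "c \<in> F" for c
        using hcomp_free[OF that, of n] unfolding fibre_tpow by blast
      have "(x, tcoset V x n (hcomp n (altT a))) = Alt V n (x, tcoset V x n (hcomp n a))"
        using Alt_tcoset[OF hcomp_free[OF a(1)]] by (simp add: hcomp_altT)
      then show ?thesis
        using mem[OF a(1)] mem[OF altT_free_on[OF a(1)]] by (auto simp: over_def simp del: tpow_simps(1))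
    qed
    then show "t \<in> fibre (ext V) x"
      using base_pt finite_support_tau[of "altT a"] unfolding a(2) ext_def
      by (simp add: over_def tau_def)
  qed
  show "fibre (ext V) x \<subseteq> (\<lambda>a. tau V x (altT a)) ` F"
  proof
    fix t assume t: "t \<in> fibre (ext V) x"
    then obtain s where ts: "t = (x, s)" and s: "\<And>n. s n \<in> fibre (ext_pow V n) x"
      and fin: "finite {n. s n \<noteq> (x, tcoset V x n 0)}"
      by (auto simp: over_def ext_def)
    have "\<exists>a. s n = (x, tcoset V x n (altT a)) \<and> a \<in> free_on (tuples V x n)" for n
    proof -
      obtain p where p: "p \<in> points (tot (tpow V n))" "s n = Alt V n p" "fst (s n) = x"
        using s[of n] by (auto simp: over_def simp del: tpow_simps)
      then have "p \<in> fibre (tpow V n) x" by (auto simp: over_def Alt_def split: prod.splits)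
      then obtain a where "p = (x, tcoset V x n a)" "a \<in> free_on (tuples V x n)" unfolding fibre_tpow by auto
      then show ?thesis using p Alt_tcoset by auto
    qed
    then obtain a where "\<And>n. s n = (x, tcoset V x n (altT (a n)))" "\<And>n. a n \<in> free_on (tuples V x n)" by metis
    from tau_surj_aux[of s altT, OF this linear_altT hcomp_altT fin] ts
    show "t \<in> (\<lambda>a. tau V x (altT a)) ` F" by auto
  qed
qed

end

subsection \<open>Induced maps\<close>

locale vfibre_map = A: vfibre V x + B: vfibre W y
  for V :: "('v, 'x) pbundle" and x and W :: "('w, 'y) pbundle" and y +
  fixes h :: "'v \<Rightarrow> 'w"
  assumes lin: "linear_fibre V x W y h"
begin

lemma map_closed: "v \<in> fibre V x \<Longrightarrow> h v \<in> fibre W y"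
  using lin by (auto simp: linear_fibre_def)

lemma map_vadd: "v \<in> fibre V x \<Longrightarrow> w \<in> fibre V x \<Longrightarrow> h (vadd V v w) = vadd W (h v) (h w)"
  using lin by (auto simp: linear_fibre_def)

lemma map_vscale: "v \<in> fibre V x \<Longrightarrow> h (vscale V c v) = vscale W c (h v)"
  using lin by (auto simp: linear_fibre_def)

lemma base_map: "base_map V W h x = y"
  using map_closed[OF A.vzero_closed] by (simp add: base_map_def over_def)

lemma push_F: "a \<in> A.F \<Longrightarrow> push h a \<in> B.F"
  by (rule push_free_on) (use map_closed in auto)

lemma push_rels: "r \<in> rels V x \<Longrightarrow> push h r \<in> rels W y"
proof (rule A.rels_into[OF linear_push subspace_rels])
  fix us ws assume *: "us \<in> lists (fibre V x)" "ws \<in> lists (fibre V x)"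
  then have "linear_mod W y (rels W y) (\<lambda>u. bas (map h us @ u # map h ws))"
    by (intro B.linear_mod_bas) (simp_all add: in_lists_conv_set map_closed image_subset_iff)
  then show "linear_mod V x (rels W y) (\<lambda>u. push h (bas (us @ u # ws)))"
    unfolding linear_mod_def by (simp add: map_closed map_vadd map_vscale)
qed

lemma push_multilin_rels: "r \<in> multilin_rels V x n \<Longrightarrow> push h r \<in> multilin_rels W y n"
  using push_rels[of r] B.hcomp_rels[of "push h r" n]
  by (auto simp: A.multilin_rels_iff hcomp_push hcomp_eq_self)

lemma tpow_map_tcoset: "tpow_map V W n h (x, tcoset V x n a) = (y, tcoset W y n (push h a))"
proof -
  have "tcoset W y n (push h b) = tcoset W y n (push h a)" if "b - a \<in> multilin_rels V x n" for b
    using push_multilin_rels[OF that] by (simp add: tcoset_eq_iff linear_diff[OF linear_push])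
  then have "(\<Union>b\<in>tcoset V x n a. tcoset W y n (push h b)) = tcoset W y n (push h a)" by (rule UN_tcoset)
  then show ?thesis by (simp add: tpow_map_def base_map Let_def)
qed

lemma tpow_map_fibre:
  assumes "t \<in> fibre (tpow V n) x"
  shows "tpow_map V W n h t \<in> fibre (tpow W n) y"
proof -
  obtain a where a: "t = (x, tcoset V x n a)" "a \<in> free_on (tuples V x n)"
    using assms unfolding A.fibre_tpow by blast
  have "push h a \<in> free_on (tuples W y n)"
    unfolding push_eq by (rule lext_in_subspace[OF subspace_free_on a(2)])
      (auto simp: tuples_def intro: map_closed)
  then show ?thesis unfolding a(1) tpow_map_tcoset B.fibre_tpow by blast
qed

lemma talg_map_tau: "talg_map V W h (tau V x a) = tau W y (push h a)"
  by (simp add: talg_map_def dsum_map_def tau_def tpow_map_tcoset hcomp_push)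

lemma talg_map_snd: "tpow_map V W n h (snd t n) = snd (talg_map V W h t) n"
  by (simp add: talg_map_def dsum_map_def split_beta)

lemma talg_map_ext: "t \<in> fibre (ext V) x \<Longrightarrow> talg_map V W h t \<in> fibre (ext W) y"
  by (auto simp: A.fibre_ext B.fibre_ext talg_map_tau push_altT intro: push_F)

lemma talg_map_talg: "t \<in> fibre (talg V) x \<Longrightarrow> talg_map V W h t \<in> fibre (talg W) y"
  by (auto simp: A.fibre_talg B.fibre_talg talg_map_tau intro: push_F)

end

lemma (in vfibre) fibre_ext_subset: "fibre (ext V) x \<subseteq> fibre (talg V) x"
  by (auto simp: fibre_ext fibre_talg intro: altT_free_on)

locale vfibre_iso = vfibre_map +
  assumes bij: "bij_betw h (fibre V x) (fibre W y)"
begin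

definition "inverse_map = the_inv_into (fibre V x) h"

lemma inverse_left: "v \<in> fibre V x \<Longrightarrow> inverse_map (h v) = v"
  using bij by (auto simp: inverse_map_def bij_betw_def the_inv_into_f_f)

lemma inverse_right: "w \<in> fibre W y \<Longrightarrow> h (inverse_map w) = w"
  unfolding inverse_map_def by (rule f_the_inv_into_f_bij_betw[OF bij])

lemma inverse_closed: "w \<in> fibre W y \<Longrightarrow> inverse_map w \<in> fibre V x"
  using bij by (auto simp: inverse_map_def bij_betw_def the_inv_into_into)

lemma inverse_vfibre_map: "vfibre_map W y V x inverse_map"
proof
  have eq: "inverse_map w = v" if "v \<in> fibre V x" "w = h v" for v w using inverse_left that by simp
  show "linear_fibre W y V x inverse_map"
    unfolding linear_fibre_def
  proof (intro conjI ballI allI)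
    show "inverse_map (vadd W v w) = vadd V (inverse_map v) (inverse_map w)"
      if "v \<in> fibre W y" "w \<in> fibre W y" for v w
      using that by (intro eq A.vadd_closed inverse_closed) (simp_all add: map_vadd inverse_closed inverse_right)
    show "inverse_map (vscale W c v) = vscale V c (inverse_map v)" if "v \<in> fibre W y" for c v
      using that by (intro eq A.vscale_closed inverse_closed) (simp_all add: map_vscale inverse_closed inverse_right)
  qed (use inverse_closed in auto)
qed

lemma push_inverse: "a \<in> A.F \<Longrightarrow> push inverse_map (push h a) = a"
  using push_cong[of a "fibre V x" "inverse_map \<circ> h" "\<lambda>v. v"] inverse_left by (simp add: push_push)

lemma push_inverse': "b \<in> B.F \<Longrightarrow> push h (push inverse_map b) = b"
  using push_cong[of b "fibre W y" "h \<circ> inverse_map" "\<lambda>v. v"] inverse_right by (simp add: push_push)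

interpretation I: vfibre_map W y V x inverse_map by (rule inverse_vfibre_map)

lemma talg_map_bij: "bij_betw (talg_map V W h) (fibre (talg V) x) (fibre (talg W) y)"
  by (rule bij_betw_byWitness[where f' = "talg_map W V inverse_map"])
    (auto simp: A.fibre_talg B.fibre_talg talg_map_tau I.talg_map_tau push_inverse push_inverse' push_F I.push_F)

lemma talg_map_ext_surj: "talg_map V W h ` fibre (ext V) x = fibre (ext W) y"
proof
  show "talg_map V W h ` fibre (ext V) x \<subseteq> fibre (ext W) y" using talg_map_ext by auto
  show "fibre (ext W) y \<subseteq> talg_map V W h ` fibre (ext V) x"
  proof
    fix t assume "t \<in> fibre (ext W) y"
    then obtain b where "b \<in> B.F" "t = tau W y (altT b)" by (auto simp: B.fibre_ext)
    then show "t \<in> talg_map V W h ` fibre (ext V) x"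
      by (auto simp: A.fibre_ext image_image talg_map_tau push_altT push_inverse'
          intro!: image_eqI[of _ _ "push inverse_map b"] I.push_F)
  qed
qed

lemma tpow_map_inj: "inj_on (tpow_map V W n h) (fibre (tpow V n) x)"
proof (rule inj_on_inverseI)
  fix t assume "t \<in> fibre (tpow V n) x"
  then show "tpow_map W V n inverse_map (tpow_map V W n h t) = t"
    by (auto simp: A.fibre_tpow tpow_map_tcoset I.tpow_map_tcoset push_inverse A.free_tuples)
qed

end

text \<open>Fibrewise injectivity becomes global because \<open>\<beta>\<close> recovers the base
  point of an element from that of its image. \<open>Phi_tens\<close> inverts such maps over a whole
  part of the base.\<close>

lemma tpow_map_inj_on:
  assumes iso: "\<And>x. x \<in> C \<Longrightarrow> vfibre_iso V x W (\<beta> x) h" and "inj_on \<beta> C"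
  shows "inj_on (tpow_map V W n h) (over (tpow V n) C)"
proof (rule inj_onI)
  fix s t assume st: "s \<in> over (tpow V n) C" "t \<in> over (tpow V n) C"
    and eq: "tpow_map V W n h s = tpow_map V W n h t"
  have C: "fst s \<in> C" "fst t \<in> C" and mem: "s \<in> fibre (tpow V n) (fst s)" "t \<in> fibre (tpow V n) (fst t)"
    using st by (auto simp: over_def)
  interpret K: vfibre_iso V "fst s" W "\<beta> (fst s)" h by (rule iso[OF C(1)])
  interpret K': vfibre_iso V "fst t" W "\<beta> (fst t)" h by (rule iso[OF C(2)])
  have "\<beta> (fst s) = \<beta> (fst t)"
    using K.tpow_map_fibre[OF mem(1)] K'.tpow_map_fibre[OF mem(2)] eq by (simp add: over_def)
  then have "fst s = fst t" using inj_onD[OF assms(2)] C by blast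
  then show "s = t" using inj_onD[OF K.tpow_map_inj eq] mem by simp
qed

section \<open>Clifford algebras and the standard action\<close>

abbreviation eps :: "('v, 'x) pbundle \<Rightarrow> 'x \<Rightarrow> ('v list \<Rightarrow>\<^sub>0 real) \<Rightarrow>
    'x \<times> (nat \<Rightarrow> 'x \<times> ('v list \<Rightarrow>\<^sub>0 real) set)" where
  "eps V x a \<equiv> tau V x (altT a)"

definition kap where
  "kap V g x a = cl_eqv V g `` {tau V x a}"

definition crel :: "('v \<Rightarrow> 'v \<Rightarrow> real) \<Rightarrow> 'v \<Rightarrow> 'v \<Rightarrow> ('v list \<Rightarrow>\<^sub>0 real)" where
  "crel G v w = bas [v, w] + (bas [w, v] + (2 * G v w) *\<^sub>R bas [])"

text \<open>The kernel of the passage from the free algebra to the Clifford algebra: the two-sided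
  ideal of the Clifford relations together with the multilinearity relations.\<close>

definition crels :: "('v, 'x) pbundle \<Rightarrow> ('x \<Rightarrow> 'v \<Rightarrow> 'v \<Rightarrow> real) \<Rightarrow> 'x \<Rightarrow> ('v list \<Rightarrow>\<^sub>0 real) set" where
  "crels V g x = span ({fmul (fmul p (crel (g x) v w)) q |p v w q.
     p \<in> free_on (lists (fibre V x)) \<and> q \<in> free_on (lists (fibre V x)) \<and>
     v \<in> fibre V x \<and> w \<in> fibre V x} \<union> rels V x)"

text \<open>The candidate for the standard action: \<open>act\<close> on arbitrarily chosen
  representatives. That the choice does not matter is \<open>std_act_kap_eps\<close>.\<close>

definition std_act where
  "std_act V g C e =
     (let x = fst e; F = free_on (lists (fibre V x));
          a = SOME a. a \<in> F \<and> kap V g x a = C;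
          b = SOME b. b \<in> F \<and> eps V x b = e
      in eps V x (act (g x) a b))"

lemma lcons_eq_fmul: "lcons v a = fmul (bas [v]) a"
  by (rule linear_eq_bas[OF linear_lcons linear_fmul_right]) simp

lemma proj_talg: "proj (talg V) = fst" by simp

lemma fst_vadd_talg: "fst (vadd (talg V) t u) = fst t"
  by (simp add: split_beta)

lemma fst_tau [simp]: "fst (tau V x a) = x"
  by (simp add: tau_def)

lemma cl_eqv_class:
  assumes "t \<in> points (tot (talg V))"
  shows "cl_eqv V g `` {t} = vadd (talg V) t ` cl_ideal V g (fst t)"
  using assms unfolding cl_eqv_def proj_talg by blast

lemma fst_cl_eqv_class:
  assumes "t \<in> points (tot (talg V))"
  shows "fst ` (cl_eqv V g `` {t}) = {fst t}"
  using cl_ideal.zero[of V "fst t" g]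
  unfolding cl_eqv_class[OF assms] image_image fst_vadd_talg image_constant_conv by auto

lemma cl_simps:
  "points (tot (cl V g)) = points (tot (talg V)) // cl_eqv V g"
  "base (cl V g) = base V"
  "proj (cl V g) C = the_elem (fst ` C)"
  by (simp_all add: cl_def quot_dsp_def)

locale cfibre = vfibre V x for V :: "('v, 'x) pbundle" and x +
  fixes g :: "'x \<Rightarrow> 'v \<Rightarrow> 'v \<Rightarrow> real"
  assumes form_sym: "v \<in> fibre V x \<Longrightarrow> w \<in> fibre V x \<Longrightarrow> g x v w = g x w v"
    and form_vadd: "u \<in> fibre V x \<Longrightarrow> v \<in> fibre V x \<Longrightarrow> w \<in> fibre V x \<Longrightarrow>
      g x u (vadd V v w) = g x u v + g x u w"
    and form_vscale: "u \<in> fibre V x \<Longrightarrow> v \<in> fibre V x \<Longrightarrow> g x u (vscale V c v) = c * g x u v"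
begin

section \<open>The Clifford ideal and its quotient in terms of the free algebra\<close>

lemma crel_free: "v \<in> fibre V x \<Longrightarrow> w \<in> fibre V x \<Longrightarrow> crel G v w \<in> F"
  unfolding crel_def by (intro free_on_add free_on_scale) auto

lemma subspace_crels: "subspace (crels V g x)"
  by (simp add: crels_def)

lemma crels_subset_free: "crels V g x \<subseteq> F"
  unfolding crels_def
  by (rule span_minimal[OF _ subspace_free_on])
    (use rels_subset_free in \<open>auto intro!: fmul_free_on crel_free\<close>)

lemma rels_subset_crels: "rels V x \<subseteq> crels V g x"
  unfolding crels_def by (auto intro: span_base)

lemma crelsI:
  assumes "p \<in> F" "q \<in> F" "v \<in> fibre V x" "w \<in> fibre V x"
  shows "fmul (fmul p (crel (g x) v w)) q \<in> crels V g x"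
  unfolding crels_def by (rule span_base) (use assms in blast)

lemma crels_into:
  assumes "linear f" "subspace T" "a \<in> crels V g x"
    and "\<And>r. r \<in> rels V x \<Longrightarrow> f r \<in> T"
    and "\<And>p q v w. \<lbrakk>p \<in> F; q \<in> F; v \<in> fibre V x; w \<in> fibre V x\<rbrakk> \<Longrightarrow> f (fmul (fmul p (crel (g x) v w)) q) \<in> T"
  shows "f a \<in> T"
  using assms(3) unfolding crels_def
  by (rule linear_span_into[OF assms(1,2), rotated]) (use assms(4,5) in auto)

lemma crels_fmul_right: "a \<in> crels V g x \<Longrightarrow> b \<in> F \<Longrightarrow> fmul a b \<in> crels V g x"
  by (rule crels_into[OF linear_fmul_left subspace_crels])
    (use rels_subset_crels rels_fmul_right in \<open>auto simp: fmul_assoc[of _ _ b] intro!: crelsI fmul_free_on\<close>)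

lemma crels_fmul_left:
  assumes "a \<in> crels V g x" "b \<in> F"
  shows "fmul b a \<in> crels V g x"
proof (rule crels_into[OF linear_fmul_right subspace_crels assms(1)])
  show "fmul b (fmul (fmul p (crel (g x) v w)) q) \<in> crels V g x"
    if "p \<in> F" "q \<in> F" "v \<in> fibre V x" "w \<in> fibre V x" for p q v w
    using crelsI[OF fmul_free_on[OF assms(2) that(1)] that(2-)] by (simp add: fmul_assoc)
qed (use rels_subset_crels rels_fmul_left assms(2) in auto)

lemma cl_relator_tau:
  assumes "v \<in> fibre V x" "w \<in> fibre V x"
  shows "cl_relator V g x v w = tau V x (crel (g x) v w)"
  unfolding cl_relator_def talg_tens_tau crel_def
  using assms by (simp add: talg_mul_tau vadd_tau vscale_tau del: dsum_simps)

text \<open>Each generator of the ideal has arbitrary factors on both sides, which is matched by the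
  products with \<open>p\<close> and \<open>q\<close> in \<open>crels\<close>; the multilinearity
  relations become zero under \<open>tau\<close>.\<close>

lemma cl_ideal_eq: "cl_ideal V g x = tau V x ` crels V g x"
proof (intro subset_antisym subsetI)
  fix t assume "t \<in> cl_ideal V g x"
  then show "t \<in> tau V x ` crels V g x"
  proof induction
    case zero
    show ?case using subspace_0[OF subspace_crels] by (auto simp only: vzero_tau)
  next
    case (gen a b v w)
    then obtain p q where "a = tau V x p" "p \<in> F" "b = tau V x q" "q \<in> F" by (auto simp: fibre_talg)
    then show ?case
      using gen(3,4)
      by (auto simp: cl_relator_tau talg_mul_tau crel_free fmul_free_on intro!: imageI crelsI)
  next
    case (add s t)
    then show ?case
      using subspace_add[OF subspace_crels] by (auto simp: vadd_tau simp del: dsum_simps)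
  qed
next
  fix t assume "t \<in> tau V x ` crels V g x"
  then obtain n where n: "n \<in> crels V g x" "t = tau V x n" by auto
  have "tau V x n \<in> cl_ideal V g x \<and> n \<in> F"
    using n(1) unfolding crels_def
  proof (induction rule: span_induct_alt)
    case base
    then show ?case using cl_ideal.zero[of V x g] by (simp only: vzero_tau free_on_zero)
  next
    case (step c r y)
    from step(1) show ?case
    proof (elim UnE CollectE exE conjE)
      fix p v w q assume r: "r = fmul (fmul p (crel (g x) v w)) q"
        and m: "p \<in> F" "q \<in> F" "v \<in> fibre V x" "w \<in> fibre V x"
      \<comment> \<open>\<open>cl_ideal\<close> has no rule for scalar multiples, so the scalar
        \<open>c\<close> is absorbed into the left factor.\<close>
      have "talg_mul V (talg_mul V (tau V x (c *\<^sub>R p)) (cl_relator V g x v w)) (tau V x q) \<in> cl_ideal V g x"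
        using m by (intro cl_ideal.gen tau_in_fibre free_on_scale)
      then have "tau V x (c *\<^sub>R r) \<in> cl_ideal V g x"
        using m by (simp add: r cl_relator_tau talg_mul_tau free_on_scale fmul_free_on crel_free
            linear_scale[OF linear_fmul_left])
      then have "tau V x (c *\<^sub>R r + y) \<in> cl_ideal V g x"
        using cl_ideal.add[of "tau V x (c *\<^sub>R r)" V g x "tau V x y"] step(2) by (simp only: vadd_tau)
      then show ?thesis
        using step(2) m by (auto simp: r intro!: free_on_add free_on_scale fmul_free_on crel_free)
    next
      assume r: "r \<in> rels V x"
      then have "tau V x (c *\<^sub>R r + y) = tau V x y"
        by (simp add: tau_eq_iff subspace_scale[OF subspace_rels])
      then show ?thesis using step(2) r rels_subset_free by (auto intro!: free_on_add free_on_scale)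
    qed
  qed
  then show "t \<in> cl_ideal V g x" using n by simp
qed

lemma tau_in_points: "a \<in> F \<Longrightarrow> tau V x a \<in> points (tot (talg V))"
  using tau_in_fibre by (auto simp: over_def)

lemma kap_eq: "a \<in> F \<Longrightarrow> kap V g x a = (\<lambda>n. tau V x (a + n)) ` crels V g x"
proof -
  assume a: "a \<in> F"
  have "kap V g x a = vadd (talg V) (tau V x a) ` tau V x ` crels V g x"
    unfolding kap_def cl_eqv_class[OF tau_in_points[OF a]] fst_tau cl_ideal_eq ..
  also have "\<dots> = (\<lambda>n. tau V x (a + n)) ` crels V g x"
    unfolding image_image by (simp only: vadd_tau)
  finally show ?thesis .
qed

lemma kap_eq_iff:
  assumes "a \<in> F" "b \<in> F"
  shows "kap V g x a = kap V g x b \<longleftrightarrow> a - b \<in> crels V g x"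
proof
  assume eq: "kap V g x a = kap V g x b"
  have "tau V x (a + 0) \<in> kap V g x a"
    unfolding kap_eq[OF assms(1)] by (rule imageI) (rule subspace_0[OF subspace_crels])
  then obtain n where n: "n \<in> crels V g x" "tau V x (a + 0) = tau V x (b + n)"
    unfolding eq kap_eq[OF assms(2)] by blast
  then have "a - (b + n) \<in> crels V g x" using rels_subset_crels by (auto simp: tau_eq_iff)
  from subspace_add[OF subspace_crels this n(1)] show "a - b \<in> crels V g x" by simp
next
  assume ab: "a - b \<in> crels V g x"
  have sub: "kap V g x a \<subseteq> kap V g x b" if A: "a \<in> F" "b \<in> F" "a - b \<in> crels V g x" for a b
  proof
    fix t assume "t \<in> kap V g x a"
    then obtain n where n: "n \<in> crels V g x" "t = tau V x (a + n)" unfolding kap_eq[OF A(1)] by blast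
    have "t = tau V x (b + (a - b + n))" using n by simp
    moreover have "a - b + n \<in> crels V g x" using subspace_add[OF subspace_crels A(3) n(1)] .
    ultimately show "t \<in> kap V g x b" unfolding kap_eq[OF A(2)] by blast
  qed
  have "b - a \<in> crels V g x" using subspace_neg[OF subspace_crels ab] by simp
  then show "kap V g x a = kap V g x b" using sub assms ab by blast
qed

lemma kap_eqI: "a \<in> F \<Longrightarrow> b \<in> F \<Longrightarrow> a - b \<in> crels V g x \<Longrightarrow> kap V g x a = kap V g x b"
  by (simp add: kap_eq_iff)

lemma fibre_cl: "fibre (cl V g) x = kap V g x ` F"
proof
  show "fibre (cl V g) x \<subseteq> kap V g x ` F"
  proof
    fix C assume C: "C \<in> fibre (cl V g) x"
    then obtain t where t: "t \<in> points (tot (talg V))" "C = cl_eqv V g `` {t}"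
      by (auto simp: over_def cl_simps quotient_def simp del: dsum_simps)
    then have "fst t = x" using C fst_cl_eqv_class[OF t(1), of g] by (simp add: over_def cl_simps del: dsum_simps)
    then have "t \<in> fibre (talg V) x" using t by (simp add: over_def del: dsum_simps(1))
    then show "C \<in> kap V g x ` F" using t by (auto simp: fibre_talg kap_def)
  qed
  show "kap V g x ` F \<subseteq> fibre (cl V g) x"
  proof
    fix C assume "C \<in> kap V g x ` F"
    then obtain a where a: "a \<in> F" "C = cl_eqv V g `` {tau V x a}" by (auto simp: kap_def)
    then show "C \<in> fibre (cl V g) x"
      using tau_in_points[OF a(1)] fst_cl_eqv_class[OF tau_in_points[OF a(1)], of g]
      by (simp add: over_def cl_simps quotientI del: dsum_simps)
  qed
qed

lemma UN_kap:
  assumes "a \<in> F" "\<And>n. n \<in> crels V g x \<Longrightarrow> T (tau V x (a + n)) = R"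
  shows "(\<Union>s\<in>kap V g x a. T s) = R"
  unfolding kap_eq[OF assms(1)] using assms(2) subspace_0[OF subspace_crels] by auto

lemma UN_kap2:
  assumes "a \<in> F" "b \<in> F" "\<And>n m. n \<in> crels V g x \<Longrightarrow> m \<in> crels V g x \<Longrightarrow> T (tau V x (a + n)) (tau V x (b + m)) = R"
  shows "(\<Union>s\<in>kap V g x a. \<Union>t\<in>kap V g x b. T s t) = R"
  by (intro UN_kap assms)

lemma crels_free: "n \<in> crels V g x \<Longrightarrow> n \<in> F"
  using crels_subset_free by blast

lemma vadd_kap:
  assumes "a \<in> F" "b \<in> F"
  shows "vadd (cl V g) (kap V g x a) (kap V g x b) = kap V g x (a + b)"
proof -
  have "cl_eqv V g `` {vadd (talg V) (tau V x (a + n)) (tau V x (b + m))} = kap V g x (a + b)"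
    if "n \<in> crels V g x" "m \<in> crels V g x" for n m
  proof -
    have "kap V g x (a + n + (b + m)) = kap V g x (a + b)"
      using that assms subspace_add[OF subspace_crels that]
      by (intro kap_eqI) (simp_all add: free_on_add crels_free algebra_simps)
    then show ?thesis unfolding vadd_tau kap_def .
  qed
  then show ?thesis unfolding cl_def by (simp del: dsum_simps add: UN_kap2[OF assms])
qed

lemma vscale_kap:
  assumes "a \<in> F"
  shows "vscale (cl V g) c (kap V g x a) = kap V g x (c *\<^sub>R a)"
proof -
  have "cl_eqv V g `` {vscale (talg V) c (tau V x (a + n))} = kap V g x (c *\<^sub>R a)"
    if "n \<in> crels V g x" for n
  proof -
    have "kap V g x (c *\<^sub>R (a + n)) = kap V g x (c *\<^sub>R a)"
      using that assms subspace_scale[OF subspace_crels that]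
      by (intro kap_eqI) (simp_all add: free_on_add free_on_scale crels_free flip: scaleR_diff_right)
    then show ?thesis unfolding vscale_tau kap_def .
  qed
  then show ?thesis unfolding cl_def by (simp del: dsum_simps add: UN_kap[OF assms])
qed

lemma cl_mul_kap:
  assumes "a \<in> F" "b \<in> F"
  shows "cl_mul V g (kap V g x a) (kap V g x b) = kap V g x (fmul a b)"
proof -
  have "cl_eqv V g `` {talg_mul V (tau V x (a + n)) (tau V x (b + m))} = kap V g x (fmul a b)"
    if nm: "n \<in> crels V g x" "m \<in> crels V g x" for n m
  proof -
    have "fmul (a + n) (b + m) - fmul a b = fmul n (b + m) + fmul a m"
      by (simp add: linear_add[OF linear_fmul_left] linear_add[OF linear_fmul_right])
    also have "\<dots> \<in> crels V g x"
    proof (rule subspace_add[OF subspace_crels])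
      show "fmul n (b + m) \<in> crels V g x"
        by (rule crels_fmul_right[OF nm(1)]) (use assms nm in \<open>simp add: free_on_add crels_free\<close>)
      show "fmul a m \<in> crels V g x" by (rule crels_fmul_left[OF nm(2) assms(1)])
    qed
    finally have "kap V g x (fmul (a + n) (b + m)) = kap V g x (fmul a b)"
      using assms nm by (intro kap_eqI) (simp_all add: fmul_free_on free_on_add crels_free)
    then show ?thesis
      using assms nm by (simp add: talg_mul_tau free_on_add crels_free kap_def)
  qed
  then show ?thesis unfolding cl_mul_def by (intro UN_kap2 assms)
qed

lemma cl_one_kap: "cl_one V g x = kap V g x (bas [])"
  by (simp add: cl_one_def kap_def talg_tens_tau)

lemma cl_vec_kap: "v \<in> fibre V x \<Longrightarrow> cl_vec V g v = kap V g x (bas [v])"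
  by (simp add: cl_vec_def kap_def talg_tens_tau over_def)

subsection \<open>The action on representatives\<close>

text \<open>The kernel of \<open>eps V x\<close>: elements whose class in the exterior algebra is
  zero.\<close>

abbreviation "K \<equiv> {e. altT e \<in> rels V x}"

lemma subspace_K: "subspace K"
  using linear_subspace_vimage[OF linear_altT subspace_rels] by (simp add: vimage_def)

lemma rels_in_K: "r \<in> rels V x \<Longrightarrow> r \<in> K"
  using altT_rels by simp

lemma linear_mod_lcons:
  assumes "e \<in> F"
  shows "linear_mod V x (rels V x) (\<lambda>u. lcons u e)"
  unfolding lcons_eq_fmul
  using linear_mod_compose[OF linear_fmul_left linear_mod_bas[of "[]" "[]"] rels_fmul_right[OF _ assms]] by simp

text \<open>Induction on the letters before the slot. A contraction that meets the slot first gives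
  \<open>g x v u\<close>, linear in \<open>u\<close>, and a product with \<open>u\<close> in front;
  any other first letter leaves the slot inside the rest of the word.\<close>

lemma ctr_rels:
  assumes "v \<in> fibre V x" "r \<in> rels V x"
  shows "ctr (g x v) r \<in> rels V x"
proof (rule rels_into[OF linear_ctr subspace_rels assms(2)])
  fix us ws assume *: "us \<in> lists (fibre V x)" "ws \<in> lists (fibre V x)"
  show "linear_mod V x (rels V x) (\<lambda>u. ctr (g x v) (bas (us @ u # ws)))"
    using *(1)
  proof (induction us)
    case Nil
    have "linear_mod V x (rels V x) (\<lambda>u. g x v u *\<^sub>R bas ws)"
      using assms(1) subspace_0[OF subspace_rels[of V x]]
      by (simp add: linear_mod_def form_vadd form_vscale scaleR_add_left)
    then show ?case
      using linear_mod_diff[OF subspace_rels _ linear_mod_lcons[OF ctrb_free_on[OF *(2)]]] by simp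
  next
    case (Cons a us)
    then have "linear_mod V x (rels V x) (\<lambda>u. lcons a (ctrb (g x v) (us @ u # ws)))"
      by (intro linear_mod_compose[OF linear_lcons])
        (auto simp: lcons_eq_fmul intro!: rels_fmul_left)
    then show ?case
      using linear_mod_diff[OF subspace_rels linear_mod_scale[OF subspace_rels linear_mod_bas]] Cons(2) *(2) by simp
  qed
qed

text \<open>\<open>e \<in> K\<close> says that \<open>altT e\<close> is a relation, and
  \<open>cliff\<close> preserves relations. Replacing \<open>e\<close> by \<open>altT e\<close>
  under \<open>cliff\<close> does not change the alternated result.\<close>

lemma cliff_K:
  assumes "v \<in> fibre V x" "e \<in> K"
  shows "cliff (g x) v e \<in> K"
proof -
  have "cliff (g x) v (altT e) \<in> rels V x"
    unfolding cliff_def lcons_eq_fmul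
    using assms by (intro subspace_diff[OF subspace_rels] rels_fmul_left ctr_rels) auto
  then show ?thesis using altT_rels altT_cliff_altT[of "g x" v e] by fastforce
qed

lemma foldr_cliff_K: "k \<in> lists (fibre V x) \<Longrightarrow> e \<in> K \<Longrightarrow> foldr (cliff (g x)) k e \<in> K"
proof (induction k)
  case (Cons v k)
  then show ?case using cliff_K[of v "foldr (cliff (g x)) k e"] by simp
qed simp

lemma act_K: "a \<in> F \<Longrightarrow> e \<in> K \<Longrightarrow> act (g x) a e \<in> K"
  unfolding act_def by (rule lext_in_subspace[OF subspace_K _ foldr_cliff_K])

text \<open>As functions of \<open>v\<close>, contraction is linear exactly and left multiplication
  linear modulo relations.\<close>

lemma linear_mod_cliff:
  assumes "e \<in> F"
  shows "linear_mod V x K (\<lambda>v. cliff (g x) v e)"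
proof -
  have add: "ctr (g x (vadd V v w)) e = ctr (g x v) e + ctr (g x w) e"
    if vw: "v \<in> fibre V x" "w \<in> fibre V x" for v w
  proof (rule linear_eq_on_free[OF linear_ctr linear_compose_add[OF linear_ctr linear_ctr] _ assms])
    fix k assume "k \<in> lists (fibre V x)"
    then show "ctr (g x (vadd V v w)) (bas k) = ctr (g x v) (bas k) + ctr (g x w) (bas k)"
    proof (induction k)
      case (Cons u k)
      \<comment> \<open>The locale provides linearity in the second argument; symmetry carries it
        over to the first.\<close>
      have "g x (vadd V v w) u = g x v u + g x w u"
        using Cons vw form_vadd[of u v w] form_sym[of u] vadd_closed by auto
      then show ?case using Cons by (simp add: scaleR_add_left linear_add[OF linear_lcons])
    qed simp
  qed
  have scale: "ctr (g x (vscale V c v)) e = c *\<^sub>R ctr (g x v) e" if v: "v \<in> fibre V x" for v c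
  proof (rule linear_eq_on_free[OF linear_ctr linear_compose_scale_right[OF linear_ctr] _ assms])
    fix k assume "k \<in> lists (fibre V x)"
    then show "ctr (g x (vscale V c v)) (bas k) = c *\<^sub>R ctr (g x v) (bas k)"
    proof (induction k)
      case (Cons u k)
      have "g x (vscale V c v) u = c * g x v u"
        using Cons v form_vscale[of u v c] form_sym[of u] vscale_closed by auto
      then show ?case using Cons by (simp add: scaleR_diff_right linear_scale[OF linear_lcons])
    qed simp
  qed
  have "linear_mod V x (rels V x) (\<lambda>v. ctr (g x v) e)"
    using subspace_0[OF subspace_rels[of V x]] by (simp add: linear_mod_def add scale)
  from linear_mod_diff[OF subspace_rels linear_mod_lcons[OF assms] this]
  have "linear_mod V x (rels V x) (\<lambda>v. cliff (g x) v e)" unfolding cliff_def .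
  then show ?thesis using rels_in_K unfolding linear_mod_def by blast
qed

lemma act_rels:
  assumes "e \<in> F" "r \<in> rels V x"
  shows "act (g x) r e \<in> K"
proof (rule rels_into[OF linear_act_left subspace_K assms(2)])
  let ?f = "foldr (cliff (g x))"
  fix us ws assume *: "us \<in> lists (fibre V x)" "ws \<in> lists (fibre V x)"
  have "linear_mod V x K (\<lambda>v. ?f us (cliff (g x) v (?f ws e)))"
    by (rule linear_mod_compose[OF linear_foldr_cliff linear_mod_cliff[OF foldr_cliff_free_on[OF *(2) assms(1)]]
          foldr_cliff_K[OF *(1)]])
  then show "linear_mod V x K (\<lambda>v. act (g x) (bas (us @ v # ws)) e)" by simp
qed

text \<open>The Clifford relator acts as zero on the exterior algebra by
  \<open>altT_cliff_cliff\<close>; the factor on its right only changes the argument, and the one on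
  its left preserves \<open>K\<close>.\<close>

lemma act_crels:
  assumes "e \<in> F" "n \<in> crels V g x"
  shows "act (g x) n e \<in> K"
proof (rule crels_into[OF linear_act_left subspace_K assms(2) act_rels[OF assms(1)]])
  fix p q v w assume *: "p \<in> F" "q \<in> F" "v \<in> fibre V x" "w \<in> fibre V x"
  have "act (g x) (crel (g x) v w) d \<in> K" for d
    using altT_cliff_cliff[of "g x" v w d] form_sym[OF *(3,4)] subspace_0[OF subspace_rels]
    by (simp add: crel_def linear_add[OF linear_act_left] linear_scale[OF linear_act_left] add.assoc)
  then show "act (g x) (fmul (fmul p (crel (g x) v w)) q) e \<in> K"
    unfolding act_fmul by (rule act_K[OF *(1)])
qed assumption

lemma eps_eq_iff: "eps V x a = eps V x b \<longleftrightarrow> a - b \<in> K"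
  by (simp add: tau_eq_iff linear_diff[OF linear_altT])

lemma std_act_kap_eps:
  assumes "a \<in> F" "b \<in> F"
  shows "std_act V g (kap V g x a) (eps V x b) = eps V x (act (g x) a b)"
proof -
  define a' where "a' = (SOME a'. a' \<in> F \<and> kap V g x a' = kap V g x a)"
  define b' where "b' = (SOME b'. b' \<in> F \<and> eps V x b' = eps V x b)"
  have a': "a' \<in> F \<and> kap V g x a' = kap V g x a" unfolding a'_def by (rule someI[of _ a]) (simp add: assms)
  have b': "b' \<in> F \<and> eps V x b' = eps V x b" unfolding b'_def by (rule someI[of _ b]) (simp add: assms)
  \<comment> \<open>The exterior representative is exchanged first, which uses that
    \<open>act\<close> preserves \<open>K\<close>, then the Clifford representative, whose change
    \<open>a' - a\<close> acts into \<open>K\<close>.\<close>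
  have "act (g x) a' b' - act (g x) a b = act (g x) a' (b' - b) + act (g x) (a' - a) b"
    by (simp add: linear_diff[OF linear_act_right] linear_diff[OF linear_act_left])
  also have "\<dots> \<in> K"
  proof (rule subspace_add[OF subspace_K])
    show "act (g x) a' (b' - b) \<in> K"
      by (rule act_K) (use a' b' in \<open>simp_all only: eps_eq_iff\<close>)
    show "act (g x) (a' - a) b \<in> K"
      by (rule act_crels[OF assms(2)]) (use a' assms(1) kap_eq_iff in blast)
  qed
  finally have "eps V x (act (g x) a' b') = eps V x (act (g x) a b)" unfolding eps_eq_iff .
  then show ?thesis
    by (simp add: std_act_def tau_def Let_def flip: a'_def b'_def)
      (simp add: a'_def b'_def tau_def)
qed

lemma clifford_vector_formula:
  assumes "v \<in> fibre V x" "set vs \<subseteq> fibre V x"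
  shows "eps V x (act (g x) (bas [v]) (bas vs)) =
    vadd (ext V) (wedge V x (v # vs))
      (vscale (ext V) (- 1)
        (vsum (ext V) x
          (map (\<lambda>j. vscale (ext V) ((- 1) ^ j * g x v (vs ! j))
                       (wedge V x (take j vs @ drop (Suc j) vs))) [0..<length vs])))"
proof -
  let ?d = "\<lambda>j. take j vs @ drop (Suc j) vs"
  have w: "wedge V x (?d j) = eps V x (bas (?d j))" for j
    by (rule wedge_tau) (use assms set_take_subset[of j vs] set_drop_subset[of "Suc j" vs] in auto)
  have w': "wedge V x (v # vs) = eps V x (bas (v # vs))"
    by (rule wedge_tau) (use assms in auto)
  show ?thesis
    unfolding w w' ext_simps(1,2) vscale_tau vsum_ext vadd_tau
    by (simp add: cliff_def linear_diff[OF linear_altT] ctrb_formula linear_sum[OF linear_altT]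
        linear_scale[OF linear_altT] interv_sum_list_conv_sum_set_nat atLeast0LessThan)
qed

text \<open>The prescribed formula gives the action of one vector on wedge products, linearity that
  on all exterior elements, multiplicativity that of words, and linearity in the Clifford argument
  the rest.\<close>

lemma standard_action_unique:
  assumes std: "is_standard_clifford_action V g c" and "a \<in> F" "b \<in> F"
  shows "c (kap V g x a) (eps V x b) = eps V x (act (g x) a b)"
proof -
  note st = std[unfolded is_standard_clifford_action_def, rule_format, OF base_pt]
  have lin: "linear_fibre (ext V) x (ext V) x (c (kap V g x d))" if "d \<in> F" for d
    using st that by (auto simp: fibre_cl)
  have epsF: "eps V x d \<in> fibre (ext V) x" if "d \<in> F" for d
    using that by (auto simp: fibre_ext)
  have kapF: "kap V g x d \<in> fibre (cl V g) x" if "d \<in> F" for d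
    using that by (auto simp: fibre_cl)
  have vec: "c (kap V g x (bas [v])) (eps V x d) = eps V x (cliff (g x) v d)"
    if v: "v \<in> fibre V x" and d: "d \<in> F" for v d
    using d
  proof (induction rule: free_on_induct)
    have L: "linear_fibre (ext V) x (ext V) x (c (kap V g x (bas [v])))" using v by (intro lin) simp
    {
      case zero
      \<comment> \<open>\<open>linear_fibre\<close> has no clause for the zero vector; it is
        obtained as \<open>0\<close> times an element, once the image is known to be of the form
        \<open>eps V x d\<close>.\<close>
      have "c (kap V g x (bas [v])) (vscale (ext V) 0 (eps V x 0)) =
          vscale (ext V) 0 (c (kap V g x (bas [v])) (eps V x 0))"
        using L epsF[of 0] by (simp add: linear_fibre_def)
      moreover have "c (kap V g x (bas [v])) (eps V x 0) \<in> fibre (ext V) x"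
        using L epsF[of 0] unfolding linear_fibre_def by auto
      then obtain d where "c (kap V g x (bas [v])) (eps V x 0) = eps V x d"
        by (auto simp: fibre_ext)
      ultimately show ?case
        by (simp add: ext_simps vscale_tau linear_0[OF linear_altT] linear_0[OF linear_cliff] del: dsum_simps)
    next
      case (add k r d)
      have k: "bas k \<in> F" using add by simp
      have "c (kap V g x (bas [v])) (eps V x (bas k)) = eps V x (cliff (g x) v (bas k))"
      proof -
        have "set k \<subseteq> fibre V x" using add by auto
        moreover have "c (cl_vec V g v) (wedge V x k) = vadd (ext V) (wedge V x (v # k))
            (vscale (ext V) (- 1) (vsum (ext V) x
              (map (\<lambda>j. vscale (ext V) ((- 1) ^ j * g x v (k ! j))
                             (wedge V x (take j k @ drop (Suc j) k))) [0..<length k])))"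
          using st v \<open>set k \<subseteq> fibre V x\<close> by blast
        ultimately show ?thesis
          using clifford_vector_formula[OF v, of k] wedge_tau[OF add(1)] cl_vec_kap[OF v] by simp
      qed
      moreover have "c (kap V g x (bas [v])) (vadd (ext V) (vscale (ext V) r (eps V x (bas k))) (eps V x d))
          = vadd (ext V) (vscale (ext V) r (c (kap V g x (bas [v])) (eps V x (bas k)))) (c (kap V g x (bas [v])) (eps V x d))"
      proof -
        have sc: "vscale (ext V) r (eps V x (bas k)) \<in> fibre (ext V) x"
          using epsF[OF free_on_scale[OF k, of r]]
          by (simp add: ext_simps vscale_tau linear_scale[OF linear_altT] del: dsum_simps)
        have "c (kap V g x (bas [v])) (vscale (ext V) r (eps V x (bas k)))
            = vscale (ext V) r (c (kap V g x (bas [v])) (eps V x (bas k)))"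
          using L epsF[OF k] unfolding linear_fibre_def by blast
        moreover have "c (kap V g x (bas [v])) (vadd (ext V) (vscale (ext V) r (eps V x (bas k))) (eps V x d))
            = vadd (ext V) (c (kap V g x (bas [v])) (vscale (ext V) r (eps V x (bas k))))
                (c (kap V g x (bas [v])) (eps V x d))"
          using L sc epsF[OF add(2)] unfolding linear_fibre_def by blast
        ultimately show ?thesis by simp
      qed
      ultimately show ?case
        using add(3)
        by (simp add: ext_simps vscale_tau vadd_tau linear_scale[OF linear_altT] linear_add[OF linear_altT]
            linear_scale[OF linear_cliff] linear_add[OF linear_cliff] del: dsum_simps)
    }
  qed
  have word: "c (kap V g x (bas k)) (eps V x b) = eps V x (foldr (cliff (g x)) k b)"
    if "k \<in> lists (fibre V x)" for k
    using that
  proof (induction k)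
    case Nil
    have "c (cl_one V g x) (eps V x b) = eps V x b" using st epsF[OF assms(3)] by blast
    then show ?case by (simp add: cl_one_kap)
  next
    case (Cons v k)
    then have v: "bas [v] \<in> F" and k: "bas k \<in> F" by auto
    have "c (cl_mul V g (kap V g x (bas [v])) (kap V g x (bas k))) (eps V x b)
        = c (kap V g x (bas [v])) (c (kap V g x (bas k)) (eps V x b))"
      using st epsF[OF assms(3)] kapF[OF v] kapF[OF k] by blast
    then show ?case
      using Cons v k vec[of v "foldr (cliff (g x)) k b"] foldr_cliff_free_on[OF _ assms(3)]
      by (simp add: cl_mul_kap)
  qed
  show ?thesis using assms(2)
  proof (induction rule: free_on_induct)
    case zero
    have "c (vscale (cl V g) 0 (kap V g x 0)) (eps V x b) = vscale (ext V) 0 (c (kap V g x 0) (eps V x b))"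
      using st epsF[OF assms(3)] kapF[of 0] by simp
    moreover have "c (kap V g x 0) (eps V x b) \<in> fibre (ext V) x"
      using lin[of 0] epsF[OF assms(3)] unfolding linear_fibre_def by auto
    then obtain d where "c (kap V g x 0) (eps V x b) = eps V x d"
      by (auto simp: fibre_ext)
    ultimately show ?case
      by (simp add: ext_simps vscale_tau vscale_kap linear_0[OF linear_altT] linear_0[OF linear_act_left] del: dsum_simps)
  next
    case (add k r d)
    have k: "bas k \<in> F" using add by simp
    have "c (vadd (cl V g) (kap V g x (r *\<^sub>R bas k)) (kap V g x d)) (eps V x b)
        = vadd (ext V) (c (kap V g x (r *\<^sub>R bas k)) (eps V x b)) (c (kap V g x d) (eps V x b))"
      using st epsF[OF assms(3)] kapF[OF free_on_scale[OF k]] kapF[OF add(2)] by blast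
    moreover have "c (vscale (cl V g) r (kap V g x (bas k))) (eps V x b)
        = vscale (ext V) r (c (kap V g x (bas k)) (eps V x b))"
      using st epsF[OF assms(3)] kapF[OF k] by blast
    ultimately show ?case
      using add word[OF add(1)] k
      by (simp add: ext_simps vadd_kap vscale_kap vscale_tau vadd_tau free_on_scale linear_scale[OF linear_altT]
          linear_add[OF linear_altT] linear_scale[OF linear_act_left] linear_add[OF linear_act_left] del: dsum_simps)
  qed
qed

end

section \<open>Existence and naturality of the standard action\<close>

lemma std_act_standard:
  assumes "\<And>x. x \<in> points (base V) \<Longrightarrow> cfibre V x g"
  shows "is_standard_clifford_action V g (std_act V g)"
  unfolding is_standard_clifford_action_def
proof
  fix x assume "x \<in> points (base V)"
  then interpret cfibre V x g by (rule assms)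
  have lin: "linear_fibre (ext V) x (ext V) x (std_act V g C)" if C: "C \<in> fibre (cl V g) x" for C
  proof -
    obtain a where a: "a \<in> F" "C = kap V g x a" using C by (auto simp: fibre_cl)
    show ?thesis
      unfolding linear_fibre_def fibre_ext a(2)
      using a(1)
      by (auto simp: std_act_kap_eps act_free_on ext_simps vadd_tau vscale_tau free_on_add free_on_scale
          linear_add[OF linear_act_right] linear_scale[OF linear_act_right] simp del: dsum_simps
          simp flip: linear_add[OF linear_altT] linear_scale[OF linear_altT])
  qed
  have alg: "std_act V g (vadd (cl V g) C D) e = vadd (ext V) (std_act V g C e) (std_act V g D e) \<and>
      std_act V g (cl_mul V g C D) e = std_act V g C (std_act V g D e)"
    "std_act V g (vscale (cl V g) r C) e = vscale (ext V) r (std_act V g C e)"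
    "std_act V g (cl_one V g x) e = e"
    if CDe: "C \<in> fibre (cl V g) x" "D \<in> fibre (cl V g) x" "e \<in> fibre (ext V) x" for C D e r
  proof -
    obtain a b d where *: "a \<in> F" "C = kap V g x a" "b \<in> F" "D = kap V g x b" "d \<in> F" "e = eps V x d"
      using CDe by (auto simp: fibre_cl fibre_ext)
    show "std_act V g (vadd (cl V g) C D) e = vadd (ext V) (std_act V g C e) (std_act V g D e) \<and>
      std_act V g (cl_mul V g C D) e = std_act V g C (std_act V g D e)"
      "std_act V g (vscale (cl V g) r C) e = vscale (ext V) r (std_act V g C e)"
      "std_act V g (cl_one V g x) e = e"
      using * by (simp_all add: std_act_kap_eps vadd_kap cl_mul_kap vscale_kap cl_one_kap ext_simps vadd_tau vscale_tau
          free_on_add free_on_scale fmul_free_on act_fmul act_free_on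
          linear_add[OF linear_act_left] linear_scale[OF linear_act_left]
          linear_add[OF linear_altT] linear_scale[OF linear_altT] del: dsum_simps)
  qed
  \<comment> \<open>The joint lemma \<open>alg\<close> asks for two Clifford elements, while the
    clauses for scalars and for the unit mention one or none; the zero class fills the vacant
    places.\<close>
  have "kap V g x 0 \<in> fibre (cl V g) x" by (simp add: fibre_cl)
  note alg' = alg(2)[OF _ this] alg(3)[OF this this]
  have vec: "std_act V g (cl_vec V g v) (wedge V x vs) = vadd (ext V) (wedge V x (v # vs))
            (vscale (ext V) (- 1) (vsum (ext V) x
                (map (\<lambda>j. vscale (ext V) ((- 1) ^ j * g x v (vs ! j))
                             (wedge V x (take j vs @ drop (Suc j) vs))) [0..<length vs])))"
    if "v \<in> fibre V x" "set vs \<subseteq> fibre V x" for v vs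
  proof -
    have vs: "vs \<in> lists (fibre V x)" using that by auto
    show ?thesis
      unfolding clifford_vector_formula[OF that, symmetric] wedge_tau[OF vs] cl_vec_kap[OF that(1)]
      by (rule std_act_kap_eps) (use that vs in auto)
  qed
  show "(\<forall>C\<in>fibre (cl V g) x. linear_fibre (ext V) x (ext V) x (std_act V g C)) \<and>
     (\<forall>e\<in>fibre (ext V) x.
        (\<forall>C\<in>fibre (cl V g) x. \<forall>D\<in>fibre (cl V g) x.
           std_act V g (vadd (cl V g) C D) e = vadd (ext V) (std_act V g C e) (std_act V g D e) \<and>
           std_act V g (cl_mul V g C D) e = std_act V g C (std_act V g D e)) \<and>
        (\<forall>a. \<forall>C\<in>fibre (cl V g) x. std_act V g (vscale (cl V g) a C) e = vscale (ext V) a (std_act V g C e)) \<and>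
        std_act V g (cl_one V g x) e = e) \<and>
     (\<forall>v\<in>fibre V x. \<forall>vs. set vs \<subseteq> fibre V x \<longrightarrow>
        std_act V g (cl_vec V g v) (wedge V x vs) =
          vadd (ext V) (wedge V x (v # vs))
            (vscale (ext V) (- 1)
              (vsum (ext V) x
                (map (\<lambda>j. vscale (ext V) ((- 1) ^ j * g x v (vs ! j))
                             (wedge V x (take j vs @ drop (Suc j) vs))) [0..<length vs]))))"
    using lin alg vec alg' by (intro conjI ballI allI impI) blast+
qed

text \<open>\<open>clifford_action\<close> is chosen for all base points simultaneously, so that
  existence is required over every point before uniqueness can evaluate the choice at
  \<open>x\<close>.\<close>

lemma (in cfibre) clifford_action_kap_eps:
  assumes "\<And>x. x \<in> points (base V) \<Longrightarrow> cfibre V x g" "a \<in> F" "b \<in> F"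
  shows "clifford_action V g (kap V g x a) (eps V x b) = eps V x (act (g x) a b)"
  by (rule standard_action_unique[OF _ assms(2,3)])
    (use someI[of "is_standard_clifford_action V g", OF std_act_standard[OF assms(1)]]
     in \<open>simp add: clifford_action_def\<close>)

locale cfibre_map = A: cfibre V x g + B: cfibre W y g' + vfibre_map V x W y h
  for V :: "('v, 'x) pbundle" and x g and W :: "('w, 'y) pbundle" and y g' h +
  assumes isometry: "v \<in> fibre V x \<Longrightarrow> w \<in> fibre V x \<Longrightarrow> g' y (h v) (h w) = g x v w"
begin

lemma push_crels: "n \<in> crels V g x \<Longrightarrow> push h n \<in> crels W g' y"
proof (rule A.crels_into[OF linear_push B.subspace_crels])
  fix p q v w assume *: "p \<in> A.F" "q \<in> A.F" "v \<in> fibre V x" "w \<in> fibre V x"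
  have "push h (crel (g x) v w) = crel (g' y) (h v) (h w)"
    using isometry[OF *(3,4)] by (simp add: crel_def linear_add[OF linear_push] linear_scale[OF linear_push])
  then show "push h (fmul (fmul p (crel (g x) v w)) q) \<in> crels W g' y"
    using * by (simp add: push_fmul B.crelsI push_F map_closed)
qed (use push_rels B.rels_subset_crels in auto)

lemma cl_map_kap:
  assumes "a \<in> A.F"
  shows "cl_map V W g' h (kap V g x a) = kap W g' y (push h a)"
  unfolding cl_map_def
proof (rule A.UN_kap[OF assms])
  fix n assume n: "n \<in> crels V g x"
  have "kap W g' y (push h (a + n)) = kap W g' y (push h a)"
    using push_crels[OF n] assms A.crels_free[OF n]
    by (subst B.kap_eq_iff) (auto intro!: push_F free_on_add simp: linear_add[OF linear_push])
  then show "cl_eqv W g' `` {talg_map V W h (tau V x (a + n))} = kap W g' y (push h a)"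
    by (simp add: talg_map_tau kap_def)
qed

lemma cl_map_fibre: "C \<in> fibre (cl V g) x \<Longrightarrow> cl_map V W g' h C \<in> fibre (cl W g') y"
  by (auto simp: A.fibre_cl B.fibre_cl cl_map_kap intro: push_F)

lemma clifford_action_natural:
  assumes "\<And>x. x \<in> points (base V) \<Longrightarrow> cfibre V x g" "\<And>y. y \<in> points (base W) \<Longrightarrow> cfibre W y g'"
    and "C \<in> fibre (cl V g) x" "e \<in> fibre (ext V) x"
  shows "talg_map V W h (clifford_action V g C e) = clifford_action W g' (cl_map V W g' h C) (talg_map V W h e)"
proof -
  obtain a b where *: "a \<in> A.F" "C = kap V g x a" "b \<in> A.F" "e = eps V x b"
    using assms(3,4) by (auto simp: A.fibre_cl A.fibre_ext)
  have "push h (act (g x) a b) = act (g' y) (push h a) (push h b)"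
    by (rule push_act[OF *(1,3)]) (rule isometry)
  then show ?thesis
    using * by (simp add: A.clifford_action_kap_eps[OF assms(1)] B.clifford_action_kap_eps[OF assms(2)]
        talg_map_tau cl_map_kap push_altT push_F)
qed

end

lemma (in cfibre) clifford_action_fibre:
  assumes "\<And>x. x \<in> points (base V) \<Longrightarrow> cfibre V x g" "C \<in> fibre (cl V g) x" "e \<in> fibre (ext V) x"
  shows "clifford_action V g C e \<in> fibre (ext V) x"
  using assms(2,3) by (auto simp: fibre_cl fibre_ext clifford_action_kap_eps[OF assms(1)] intro: act_free_on)

section \<open>Bases of carrier-based vector spaces\<close>

lemma sum_list_map2_scaleR:
  "length cs = length us \<Longrightarrow> sum_list (map2 scaleR cs us) = (\<Sum>i<length us. cs ! i *\<^sub>R us ! i)"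
  by (simp add: sum_list_sum_nth atLeast0LessThan)

lemma sum_set_distinct:
  assumes "distinct us"
  shows "(\<Sum>u\<in>set us. f u *\<^sub>R u) = (\<Sum>i<length us. f (us ! i) *\<^sub>R us ! i)"
  using sum.reindex_bij_betw[OF bij_betw_nth[OF assms refl refl], of "\<lambda>u. f u *\<^sub>R u"] by simp

text \<open>Translates set-based independence into coordinate lists, the form used by
  \<open>is_basis\<close>; \<open>unique_coordinates_basis\<close> is the converse.\<close>

lemma unique_coordinates:
  fixes us :: "'b::real_vector list"
  assumes "distinct us" "independent (set us)" "u \<in> span (set us)"
  shows "\<exists>!cs. length cs = length us \<and> u = sum_list (map2 scaleR cs us)"
proof (rule ex_ex1I)
  from assms(3) obtain f where f: "u = (\<Sum>v\<in>set us. f v *\<^sub>R v)"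
    by (auto simp: span_finite)
  show "\<exists>cs. length cs = length us \<and> u = sum_list (map2 scaleR cs us)"
    by (rule exI[of _ "map f us"]) (simp add: f sum_list_map2_scaleR sum_set_distinct[OF assms(1)])
next
  fix cs ds
  assume *: "length cs = length us \<and> u = sum_list (map2 scaleR cs us)"
    "length ds = length us \<and> u = sum_list (map2 scaleR ds us)"
  \<comment> \<open>Reads the position back from the vector, turning the list of coefficient
    differences into a function on the set, as \<open>independentD\<close> expects.\<close>
  define idx where "idx = the_inv_into {..<length us} (nth us)"
  have idx: "idx (us ! i) = i" if "i < length us" for i
    unfolding idx_def by (rule the_inv_into_f_f) (use assms(1) that in \<open>auto simp: inj_on_nth\<close>)
  have "(\<Sum>v\<in>set us. (cs ! idx v - ds ! idx v) *\<^sub>R v) = (\<Sum>i<length us. (cs ! i - ds ! i) *\<^sub>R us ! i)"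
    unfolding sum_set_distinct[OF assms(1)] by (rule sum.cong) (auto simp: idx)
  also have "\<dots> = 0"
    using * by (simp add: sum_list_map2_scaleR scaleR_diff_left sum_subtractf)
  finally have "\<forall>v\<in>set us. cs ! idx v - ds ! idx v = 0"
    using independentD[OF assms(2) finite_set order_refl, of "\<lambda>v. cs ! idx v - ds ! idx v"] by blast
  then have "cs ! i = ds ! i" if "i < length us" for i
    using idx[OF that] nth_mem[OF that] by fastforce
  then show "cs = ds" using * by (auto intro: nth_equalityI)
qed

lemma unique_coordinates_basis:
  fixes us :: "'b::real_vector list"
  assumes T: "subspace T" "set us \<subseteq> T"
    and "\<And>u. u \<in> T \<Longrightarrow> \<exists>!cs. length cs = length us \<and> u = sum_list (map2 scaleR cs us)"
  shows "distinct us" "independent (set us)" "span (set us) = T"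
proof -
  have zero: "cs ! i = 0" if "length cs = length us" "(\<Sum>i<length us. cs ! i *\<^sub>R us ! i) = 0" "i < length us" for cs i
  proof -
    have "length cs = length us \<and> 0 = sum_list (map2 scaleR cs us)"
      using that by (simp add: sum_list_map2_scaleR)
    moreover have "length (replicate (length us) 0) = length us \<and> 0 = sum_list (map2 scaleR (replicate (length us) 0) us)"
      by (simp add: sum_list_map2_scaleR)
    ultimately have "cs = replicate (length us) 0" using assms(3)[OF subspace_0[OF T(1)]] by blast
    then show ?thesis using that by simp
  qed
  show d: "distinct us"
    unfolding distinct_conv_nth
  proof (intro allI impI notI)
    fix i j assume *: "i < length us" "j < length us" "i \<noteq> j" "us ! i = us ! j"
    \<comment> \<open>Coefficients \<open>1\<close> and \<open>- 1\<close> at two equal entries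
      would be nontrivial coordinates of zero.\<close>
    let ?f = "\<lambda>k. if k = i then 1 else if k = j then - 1 else (0::real)"
    let ?cs = "map ?f [0..<length us]"
    have "(\<Sum>k<length us. ?cs ! k *\<^sub>R us ! k)
        = (\<Sum>k<length us. (if k = i then us ! i else 0) - (if k = j then us ! j else 0))"
      by (rule sum.cong) (use * in auto)
    also have "\<dots> = 0" using * by (simp add: sum_subtractf)
    finally have "?cs ! i = 0" using * by (intro zero) simp_all
    then show False using * by simp
  qed
  show "independent (set us)"
    unfolding dependent_finite[OF finite_set]
  proof clarify
    fix f v assume *: "v \<in> set us" "f v \<noteq> 0" "(\<Sum>v\<in>set us. f v *\<^sub>R v) = 0"
    then obtain i where i: "i < length us" "v = us ! i" by (auto simp: in_set_conv_nth)
    have "map f us ! i = 0" by (rule zero) (use * i in \<open>simp_all add: sum_set_distinct[OF d]\<close>)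
    then show False using * i by simp
  qed
  show "span (set us) = T"
  proof
    show "span (set us) \<subseteq> T" by (rule span_minimal[OF T(2,1)])
    show "T \<subseteq> span (set us)"
    proof
      fix u assume "u \<in> T"
      from assms(3)[OF this] obtain cs where "length cs = length us" "u = sum_list (map2 scaleR cs us)" by blast
      then have u: "u = (\<Sum>i<length us. cs ! i *\<^sub>R us ! i)" by (simp add: sum_list_map2_scaleR)
      show "u \<in> span (set us)"
        unfolding u by (intro span_sum span_scale span_base) simp
    qed
  qed
qed

text \<open>A finite-dimensional fibre is compared with a subspace of a genuine real vector space by
  means of an injective linear coordinate map.\<close>

locale coordinates = vfibre W x for W :: "('w, 'x) pbundle" and x +
  fixes \<theta> :: "'w \<Rightarrow> 'b::real_vector" and B :: "'b set"
  assumes inj: "inj_on \<theta> (fibre W x)"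
    and coord_vadd: "v \<in> fibre W x \<Longrightarrow> w \<in> fibre W x \<Longrightarrow> \<theta> (vadd W v w) = \<theta> v + \<theta> w"
    and coord_vscale: "v \<in> fibre W x \<Longrightarrow> \<theta> (vscale W c v) = c *\<^sub>R \<theta> v"
    and coord_vzero: "\<theta> (vzero W x) = 0"
    and coord_span: "finite B" "\<theta> ` fibre W x \<subseteq> span B"
begin

definition subfibre :: "'w set \<Rightarrow> bool" where
  "subfibre S \<longleftrightarrow> S \<subseteq> fibre W x \<and> vzero W x \<in> S \<and> (\<forall>v\<in>S. \<forall>w\<in>S. vadd W v w \<in> S) \<and> (\<forall>c. \<forall>v\<in>S. vscale W c v \<in> S)"

lemma subspace_coord:
  assumes "subfibre S" shows "subspace (\<theta> ` S)"
proof (rule subspaceI)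
  show "0 \<in> \<theta> ` S" using assms coord_vzero by (metis image_eqI subfibre_def)
  show "a + b \<in> \<theta> ` S" if "a \<in> \<theta> ` S" "b \<in> \<theta> ` S" for a b
    using that assms coord_vadd unfolding subfibre_def by (smt (verit, best) imageE image_eqI subsetD)
  show "c *\<^sub>R a \<in> \<theta> ` S" if "a \<in> \<theta> ` S" for c a
    using that assms coord_vscale unfolding subfibre_def by (smt (verit, best) imageE image_eqI subsetD)
qed

lemma coord_vsum:
  assumes "set vs \<subseteq> fibre W x"
  shows "vsum W x vs \<in> fibre W x" "\<theta> (vsum W x vs) = sum_list (map \<theta> vs)"
proof -
  have "vsum W x vs \<in> fibre W x \<and> \<theta> (vsum W x vs) = sum_list (map \<theta> vs)"
    using assms unfolding vsum_def
  proof (induction vs)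
    case (Cons v vs)
    then show ?case using vadd_closed coord_vadd by simp
  qed (simp add: vzero_closed coord_vzero)
  then show "vsum W x vs \<in> fibre W x" "\<theta> (vsum W x vs) = sum_list (map \<theta> vs)" by auto
qed

lemma coord_combination:
  assumes "length cs = length bs" "set bs \<subseteq> fibre W x"
  shows "vsum W x (map2 (vscale W) cs bs) \<in> fibre W x"
    "\<theta> (vsum W x (map2 (vscale W) cs bs)) = sum_list (map2 scaleR cs (map \<theta> bs))"
proof -
  have sub: "set (map2 (vscale W) cs bs) \<subseteq> fibre W x"
    using assms(2) vscale_closed by (auto dest!: set_zip_rightD)
  show "vsum W x (map2 (vscale W) cs bs) \<in> fibre W x" by (rule coord_vsum(1)[OF sub])
  have "map \<theta> (map2 (vscale W) cs bs) = map2 scaleR cs (map \<theta> bs)"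
    using assms by (induction cs bs rule: list_induct2) (auto simp: coord_vscale)
  then show "\<theta> (vsum W x (map2 (vscale W) cs bs)) = sum_list (map2 scaleR cs (map \<theta> bs))"
    using coord_vsum(2)[OF sub] by simp
qed

lemma is_basis_iff:
  assumes S: "subfibre S" "set bs \<subseteq> S"
  shows "is_basis W x S bs \<longleftrightarrow>
    (\<forall>u\<in>\<theta> ` S. \<exists>!cs. length cs = length (map \<theta> bs) \<and> u = sum_list (map2 scaleR cs (map \<theta> bs)))"
proof -
  have bs: "set bs \<subseteq> fibre W x" and SW: "S \<subseteq> fibre W x" using S by (auto simp: subfibre_def)
  have eq: "v = vsum W x (map2 (vscale W) cs bs) \<longleftrightarrow> \<theta> v = sum_list (map2 scaleR cs (map \<theta> bs))"
    if "v \<in> S" "length cs = length bs" for v cs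
    using inj_on_eq_iff[OF inj subsetD[OF SW that(1)] coord_combination(1)[OF that(2) bs]]
      coord_combination(2)[OF that(2) bs] by auto
  have "(\<exists>!cs. length cs = length bs \<and> v = vsum W x (map2 (vscale W) cs bs)) \<longleftrightarrow>
      (\<exists>!cs. length cs = length (map \<theta> bs) \<and> \<theta> v = sum_list (map2 scaleR cs (map \<theta> bs)))" if "v \<in> S" for v
    using eq[OF that] by (metis length_map)
  then show ?thesis using S(2) by (simp add: is_basis_def)
qed

text \<open>\<open>vdim\<close> is a definite description: it needs a basis to exist, obtained by
  lifting one of the coordinate image, and all bases to have the same length, which holds since
  their images are bases there.\<close>

lemma vdim_eq:
  assumes S: "subfibre S"
  shows "vdim W x S = dim (\<theta> ` S)"
proof -
  have SW: "S \<subseteq> fibre W x" using S by (simp add: subfibre_def)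
  have len: "length bs = dim (\<theta> ` S)" if b: "is_basis W x S bs" for bs
  proof -
    have bs: "set bs \<subseteq> S" using b by (simp add: is_basis_def)
    have sub: "set (map \<theta> bs) \<subseteq> \<theta> ` S" using bs by auto
    have "\<exists>!cs. length cs = length (map \<theta> bs) \<and> u = sum_list (map2 scaleR cs (map \<theta> bs))" if "u \<in> \<theta> ` S" for u
      using is_basis_iff[OF S bs] b that by blast
    note ub = unique_coordinates_basis[OF subspace_coord[OF S] sub this]
    have "dim (\<theta> ` S) = card (set (map \<theta> bs))"
      using dim_unique[OF sub _ ub(2) refl] ub(3) by simp
    then show ?thesis using distinct_card[OF ub(1)] by simp
  qed
  obtain A where A: "A \<subseteq> \<theta> ` S" "independent A" "\<theta> ` S \<subseteq> span A"
    using maximal_independent_subset by blast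
  have "A \<subseteq> span B" using A(1) SW coord_span(2) by blast
  then have "finite A" using independent_span_bound[OF coord_span(1) A(2)] by blast
  then obtain us where us: "set us = A" "distinct us" using finite_distinct_list by blast
  define bs where "bs = map (inv_into S \<theta>) us"
  have \<theta>bs: "map \<theta> bs = us"
    unfolding bs_def using us A(1) by (auto intro!: map_idI simp: f_inv_into_f subset_iff)
  have bsS: "set bs \<subseteq> S" unfolding bs_def using us A(1) by (auto intro!: inv_into_into)
  have "is_basis W x S bs"
    unfolding is_basis_iff[OF S bsS] \<theta>bs
    using unique_coordinates[OF us(2)] us A by blast
  then show ?thesis unfolding vdim_def using len by (intro the_equality) auto
qed

text \<open>If \<open>S\<close> were proper, a basis of its image could be extended by
  \<open>d\<close> to an independent set inside the span of a basis of the whole image, against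
  equality of dimensions. All cardinalities are finite because everything lies in
  \<open>span B\<close>.\<close>

lemma subfibre_eqI:
  assumes "subfibre S" "vdim W x S = vdim W x (fibre W x)"
  shows "S = fibre W x"
proof -
  have full: "subfibre (fibre W x)"
    by (simp add: subfibre_def vzero_closed vadd_closed vscale_closed)
  have SW: "S \<subseteq> fibre W x" using assms(1) by (simp add: subfibre_def)
  obtain A where A: "A \<subseteq> \<theta> ` S" "independent A" "\<theta> ` S \<subseteq> span A"
    using maximal_independent_subset by blast
  have spanA: "span A = \<theta> ` S"
    using A span_minimal[OF A(1) subspace_coord[OF assms(1)]] by blast
  have "\<theta> ` fibre W x \<subseteq> \<theta> ` S"
  proof (rule ccontr)
    assume "\<not> \<theta> ` fibre W x \<subseteq> \<theta> ` S"
    then obtain d where d: "d \<in> \<theta> ` fibre W x" "d \<notin> span A" unfolding spanA by blast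
    obtain C where C: "C \<subseteq> \<theta> ` fibre W x" "independent C" "\<theta> ` fibre W x \<subseteq> span C"
      using maximal_independent_subset by blast
    have fin: "finite C" using independent_span_bound[OF coord_span(1) C(2)] C(1) coord_span(2) by blast
    have sub: "insert d A \<subseteq> span C" using d A(1) C(3) SW by blast
    have "independent (insert d A)" using A(2) d(2) by (simp add: independent_insertI)
    from independent_span_bound[OF fin this sub]
    have "card (insert d A) \<le> card C" "finite (insert d A)" by simp_all
    moreover have "d \<notin> A" using d(2) span_base by blast
    ultimately have "card A < card C" by simp
    moreover have "dim (\<theta> ` S) = card A" by (rule dim_unique[OF A(1,3,2) refl])
    moreover have "dim (\<theta> ` fibre W x) = card C" by (rule dim_unique[OF C(1,3,2) refl])
    ultimately show False using assms(2) by (simp add: vdim_eq[OF assms(1)] vdim_eq[OF full])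
  qed
  then show ?thesis using inj_on_image_mem_iff[OF inj _ SW] SW by blast
qed

end

section \<open>Dual fibres and dual metrics\<close>

text \<open>One clause of \<open>diffeological_space\<close>, kept separate because for a gluing it
  is immediate from the definition.\<close>

definition plots_open :: "'a dspace \<Rightarrow> bool" where
  "plots_open X \<longleftrightarrow> (\<forall>n U p. plot X n U p \<longrightarrow> openin (Euclidean_space n) U)"

text \<open>Elements of the dual without the tag by the base point and without extensionality, so
  that forms can be combined before they are restricted.\<close>

definition lin_form :: "('v, 'x) pbundle \<Rightarrow> 'x \<Rightarrow> ('v \<Rightarrow> real) \<Rightarrow> bool" where
  "lin_form V x \<phi> \<longleftrightarrow>
     (\<forall>v\<in>fibre V x. \<forall>w\<in>fibre V x. \<phi> (vadd V v w) = \<phi> v + \<phi> w) \<and>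
     (\<forall>a. \<forall>v\<in>fibre V x. \<phi> (vscale V a v) = a * \<phi> v) \<and>
     smooth_map (sub_dsp (tot V) (fibre V x)) real_dsp \<phi>"

lemma dual_simps [simp]:
  "base (dual V) = base V"
  "proj (dual V) = fst"
  "vadd (dual V) = (\<lambda>(x, \<phi>) (_, \<psi>). (x, restrict (\<lambda>v. \<phi> v + \<psi> v) (fibre V x)))"
  "vscale (dual V) = (\<lambda>a (x, \<phi>). (x, restrict (\<lambda>v. a * \<phi> v) (fibre V x)))"
  "vzero (dual V) = (\<lambda>x. (x, restrict (\<lambda>_. 0) (fibre V x)))"
  by (simp_all add: dual_def Let_def)

lemma fibre_dual:
  "x \<in> points (base V) \<Longrightarrow> fibre (dual V) x = {(x, \<phi>) |\<phi>. \<phi> \<in> extensional (fibre V x) \<and> lin_form V x \<phi>}"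
  by (auto simp: over_def dual_def Let_def lin_form_def)

locale dual_fibre = vfibre V x for V :: "('v, 'x) pbundle" and x +
  assumes plots_open: "plots_open (tot V)"
begin

lemma lin_form_cong:
  assumes "lin_form V x \<phi>" "\<And>v. v \<in> fibre V x \<Longrightarrow> \<psi> v = \<phi> v"
  shows "lin_form V x \<psi>"
proof -
  have "smooth_map (sub_dsp (tot V) (fibre V x)) real_dsp \<psi>"
    by (rule smooth_map_real_cong[of _ \<phi> "fibre V x"]) (use assms in \<open>auto simp: lin_form_def sub_dsp_def\<close>)
  then show ?thesis using assms vadd_closed vscale_closed by (simp add: lin_form_def)
qed

lemma restrict_in_dual: "lin_form V x \<phi> \<Longrightarrow> (x, restrict \<phi> (fibre V x)) \<in> fibre (dual V) x"
  unfolding fibre_dual[OF base_pt] using lin_form_cong[of \<phi> "restrict \<phi> (fibre V x)"] by simp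

lemma dual_fst: "\<phi> \<in> fibre (dual V) x \<Longrightarrow> fst \<phi> = x"
  unfolding fibre_dual[OF base_pt] by auto

lemma dual_lin_form: "\<phi> \<in> fibre (dual V) x \<Longrightarrow> lin_form V x (snd \<phi>)"
  unfolding fibre_dual[OF base_pt] by auto

lemma dual_eqI:
  assumes "\<phi> \<in> fibre (dual V) x" "\<psi> \<in> fibre (dual V) x" "\<And>v. v \<in> fibre V x \<Longrightarrow> snd \<phi> v = snd \<psi> v"
  shows "\<phi> = \<psi>"
  using assms unfolding fibre_dual[OF base_pt] by (auto intro: extensionalityI)

lemma lin_form_zero: "lin_form V x (\<lambda>_. 0)"
proof -
  have "smooth_map (sub_dsp (tot V) (fibre V x)) real_dsp (\<lambda>_. 0)"
  proof (rule smooth_map_real_zero)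
    fix n U p assume "plot (sub_dsp (tot V) (fibre V x)) n U p"
    then have "plot (tot V) n U p" by (simp add: sub_dsp_def)
    then show "openin (Euclidean_space n) U" using plots_open unfolding plots_open_def by blast
  qed
  then show ?thesis by (simp add: lin_form_def)
qed

lemma lin_form_add: "lin_form V x \<phi> \<Longrightarrow> lin_form V x \<psi> \<Longrightarrow> lin_form V x (\<lambda>v. \<phi> v + \<psi> v)"
  by (auto simp: lin_form_def distrib_left intro: smooth_map_real_add)

lemma lin_form_cmult: "lin_form V x \<phi> \<Longrightarrow> lin_form V x (\<lambda>v. c * \<phi> v)"
  by (auto simp: lin_form_def algebra_simps intro: smooth_map_real_cmult)

lemma lin_form_sum:
  "finite I \<Longrightarrow> (\<And>i. i \<in> I \<Longrightarrow> lin_form V x (\<phi> i)) \<Longrightarrow> lin_form V x (\<lambda>v. \<Sum>i\<in>I. \<phi> i v)"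
  by (induction I rule: finite_induct) (auto simp: lin_form_zero lin_form_add)

lemma snd_vadd_dual:
  "\<phi> \<in> fibre (dual V) x \<Longrightarrow> v \<in> fibre V x \<Longrightarrow> snd (vadd (dual V) \<phi> \<psi>) v = snd \<phi> v + snd \<psi> v"
  using dual_fst[of \<phi>] by (auto split: prod.splits)

lemma snd_vscale_dual:
  "\<phi> \<in> fibre (dual V) x \<Longrightarrow> v \<in> fibre V x \<Longrightarrow> snd (vscale (dual V) c \<phi>) v = c * snd \<phi> v"
  using dual_fst[of \<phi>] by (auto split: prod.splits)

lemma vfibre_dual: "vfibre (dual V) x"
proof
  show "x \<in> points (base (dual V))" using base_pt by simp
  show "vadd (dual V) \<phi> \<psi> \<in> fibre (dual V) x" if "\<phi> \<in> fibre (dual V) x" "\<psi> \<in> fibre (dual V) x" for \<phi> \<psi>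
    using dual_fst[OF that(1)] restrict_in_dual[OF lin_form_add[OF that[THEN dual_lin_form]]]
    by (auto split: prod.splits)
  show "vscale (dual V) c \<phi> \<in> fibre (dual V) x" if "\<phi> \<in> fibre (dual V) x" for c \<phi>
    using dual_fst[OF that] restrict_in_dual[OF lin_form_cmult[OF dual_lin_form[OF that]]]
    by (auto split: prod.splits)
  show "vzero (dual V) x \<in> fibre (dual V) x"
    using restrict_in_dual[OF lin_form_zero] by simp
qed

sublocale D: vfibre "dual V" x by (rule vfibre_dual)

end

lemma pseudo_bundle_plots_open:
  assumes "pseudo_bundle V" shows "plots_open (tot V)"
proof -
  have "diffeological_space (tot V)" using assms by (simp add: pseudo_bundle_def)
  from this[unfolded diffeological_space_def, THEN conjunct1]
  show ?thesis unfolding plots_open_def by blast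
qed

lemma pseudo_bundle_dual_fibre:
  assumes "pseudo_bundle V" "x \<in> points (base V)"
  shows "dual_fibre V x"
proof
  have "real_vector_space_on (fibre V x) (vadd V) (vscale V) (vzero V x)"
    using assms by (simp add: pseudo_bundle_def)
  note vs = this[unfolded real_vector_space_on_def]
  show "vadd V v w \<in> fibre V x" if "v \<in> fibre V x" "w \<in> fibre V x" for v w
    by (rule bspec[OF bspec[OF vs[THEN conjunct2, THEN conjunct1] that(1)] that(2)])
  show "vscale V c v \<in> fibre V x" if "v \<in> fibre V x" for c v
    by (rule vs[THEN conjunct2, THEN conjunct2, THEN conjunct1, THEN spec, THEN bspec]) (rule that)
  show "vzero V x \<in> fibre V x" by (rule vs[THEN conjunct1])
  show "plots_open (tot V)" by (rule pseudo_bundle_plots_open[OF assms(1)])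
qed (rule assms(2))

section \<open>Pseudo-metrics on a fibre and their duals\<close>

locale metric_fibre = dual_fibre V x for V :: "('v, 'x) pbundle" and x +
  fixes g :: "'x \<Rightarrow> 'v \<Rightarrow> 'v \<Rightarrow> real"
  assumes pbundle: "pseudo_bundle V" and bounded_dim: "bounded_fibre_dim V" and metric: "pseudo_metric V g"
begin

text \<open>A form is determined by its values on a basis \<open>bs\<close> of the fibre. Recording
  them at the positions \<open>i < length bs\<close> gives one target type for fibres of all
  dimensions, with a finite spanning set for the image.\<close>

lemma dual_coordinates:
  obtains \<theta> :: "'x \<times> ('v \<Rightarrow> real) \<Rightarrow> nat \<Rightarrow>\<^sub>0 real" and B where "coordinates (dual V) x \<theta> B"
proof -
  obtain bs where bs: "is_basis V x (fibre V x) bs"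
    using bounded_dim base_pt by (auto simp: bounded_fibre_dim_def)
  then have bsV: "set bs \<subseteq> fibre V x" by (simp add: is_basis_def)
  have vs: "real_vector_space_on (fibre V x) (vadd V) (vscale V) (vzero V x)"
    using pbundle base_pt by (simp add: pseudo_bundle_def)
  define \<theta> :: "'x \<times> ('v \<Rightarrow> real) \<Rightarrow> nat \<Rightarrow>\<^sub>0 real" where
    "\<theta> = (\<lambda>\<phi>. \<Sum>i<length bs. snd \<phi> (bs ! i) *\<^sub>R bas i)"
  have nth: "bs ! i \<in> fibre V x" if "i < length bs" for i using that bsV nth_mem by blast
  have look: "Poly_Mapping.lookup (\<theta> \<phi>) i = snd \<phi> (bs ! i)" if "i < length bs" for \<phi> i
    using that by (simp add: \<theta>_def lookup_sum lookup_scaleR lookup_single when_def if_distrib sum.delta cong: if_cong)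
  have zero: "snd \<phi> (vzero V x) = 0" if "\<phi> \<in> fibre (dual V) x" for \<phi>
  proof -
    have "vadd V (vzero V x) (vzero V x) = vzero V x" using vs by (simp add: real_vector_space_on_def)
    moreover have "snd \<phi> (vadd V (vzero V x) (vzero V x)) = snd \<phi> (vzero V x) + snd \<phi> (vzero V x)"
      using dual_lin_form[OF that] vzero_closed by (simp add: lin_form_def)
    ultimately show ?thesis by simp
  qed
  have vsum: "snd \<phi> (vsum V x vs) = sum_list (map (snd \<phi>) vs) \<and> vsum V x vs \<in> fibre V x"
    if "\<phi> \<in> fibre (dual V) x" "set vs \<subseteq> fibre V x" for \<phi> vs
    using that(2) dual_lin_form[OF that(1)] zero[OF that(1)] unfolding vsum_def
    by (induction vs) (auto simp: vzero_closed vadd_closed lin_form_def)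
  have "coordinates (dual V) x \<theta> (bas ` {..<length bs})"
  proof
    show "inj_on \<theta> (fibre (dual V) x)"
    proof (rule inj_onI, rule dual_eqI)
      fix \<phi> \<psi> v assume *: "\<phi> \<in> fibre (dual V) x" "\<psi> \<in> fibre (dual V) x" "\<theta> \<phi> = \<theta> \<psi>" "v \<in> fibre V x"
      then have eq: "snd \<phi> (bs ! i) = snd \<psi> (bs ! i)" if "i < length bs" for i using look[OF that] by metis
      obtain cs where cs: "length cs = length bs" "v = vsum V x (map2 (vscale V) cs bs)"
        using bs *(4) unfolding is_basis_def by blast
      have sub: "set (map2 (vscale V) cs bs) \<subseteq> fibre V x"
        using bsV vscale_closed by (auto dest!: set_zip_rightD)
      have "map (snd \<phi>) (map2 (vscale V) cs bs) = map (snd \<psi>) (map2 (vscale V) cs bs)"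
      proof (rule nth_equalityI)
        fix i assume "i < length (map (snd \<phi>) (map2 (vscale V) cs bs))"
        then have i: "i < length bs" using cs(1) by simp
        then show "map (snd \<phi>) (map2 (vscale V) cs bs) ! i = map (snd \<psi>) (map2 (vscale V) cs bs) ! i"
          using cs(1) eq[OF i] nth[OF i] dual_lin_form[OF *(1)] dual_lin_form[OF *(2)] by (simp add: lin_form_def)
      qed simp
      then show "snd \<phi> v = snd \<psi> v"
        using vsum[OF *(1) sub] vsum[OF *(2) sub] cs(2) by metis
    qed
    show "\<theta> (vadd (dual V) v w) = \<theta> v + \<theta> w" if "v \<in> fibre (dual V) x" "w \<in> fibre (dual V) x" for v w
      using snd_vadd_dual[OF that(1) nth]
      by (simp add: \<theta>_def scaleR_add_left sum.distrib del: dual_simps)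
    show "\<theta> (vscale (dual V) c v) = c *\<^sub>R \<theta> v" if "v \<in> fibre (dual V) x" for c v
      using snd_vscale_dual[OF that nth]
      by (simp add: \<theta>_def scaleR_sum_right del: dual_simps)
    show "\<theta> (vzero (dual V) x) = 0" using nth by (simp add: \<theta>_def)
    show "\<theta> ` fibre (dual V) x \<subseteq> span (bas ` {..<length bs})"
      unfolding \<theta>_def by (intro image_subsetI span_sum span_scale span_base) simp
  qed simp
  then show ?thesis by (rule that)
qed

text \<open>\<open>form_of\<close> describes a value by some representative of a coset; the sum can
  be used for a fixed \<open>a\<close> because evaluation on a pair of vectors is the same for all
  representatives.\<close>

lemma metric_representation:
  obtains a where "a \<in> free_on (tuples (dual V) x 2)"
    "\<And>v w. v \<in> fibre V x \<Longrightarrow> w \<in> fibre V x \<Longrightarrow>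
      g x v w = (\<Sum>k\<in>Poly_Mapping.keys a. Poly_Mapping.lookup a k * snd (k ! 0) v * snd (k ! 1) w)"
proof -
  obtain s where s: "smooth_map (base V) (tot (tpow (dual V) 2)) s"
    "proj (tpow (dual V) 2) (s x) = x"
    "\<And>v w. v \<in> fibre V x \<Longrightarrow> w \<in> fibre V x \<Longrightarrow> g x v w = form_of (s x) v w"
    using metric base_pt unfolding pseudo_metric_def by blast
  have "s x \<in> points (tot (tpow (dual V) 2))"
    using s(1) base_pt unfolding smooth_map_def by blast
  then have "s x \<in> fibre (tpow (dual V) 2) x" using s(2) by (simp add: over_def)
  then obtain a where a: "a \<in> free_on (tuples (dual V) x 2)" "s x = (x, tcoset (dual V) x 2 a)"
    unfolding D.fibre_tpow by blast
  define form where "form = (\<lambda>(a :: ('x \<times> ('v \<Rightarrow> real)) list \<Rightarrow>\<^sub>0 real) v w.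
    \<Sum>k\<in>Poly_Mapping.keys a. Poly_Mapping.lookup a k * snd (k ! 0) v * snd (k ! 1) w)"
  have form_lext: "form a v w = lext (\<lambda>k. snd (k ! 0) v * snd (k ! 1) w) a" for a v w
    by (simp add: form_def lext_def mult.assoc)
  have kill: "lext (\<lambda>k. snd (k ! 0) v * snd (k ! 1) w) (hcomp 2 r) = 0"
    if "r \<in> rels (dual V) x" and vw: "v \<in> fibre V x" "w \<in> fibre V x" for r v w
  proof -
    \<comment> \<open>\<open>rels\<close> contains relations of all lengths, but evaluation of the
      letters at \<open>0\<close> and \<open>1\<close> is multilinear only on words of length two.
      \<open>hcomp 2\<close> discards the others, and a slot is then the first or the second
      letter.\<close>
    let ?f = "\<lambda>r. lext (\<lambda>k. snd (k ! 0) v * snd (k ! 1) w) (hcomp 2 r)"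
    have lin: "linear ?f" using linear_compose[OF linear_hcomp linear_lext] by (simp add: comp_def)
    have two: "length us + Suc (length ws) \<noteq> 2 \<or> us = [] \<and> (\<exists>z. ws = [z]) \<or> (\<exists>z. us = [z]) \<and> ws = []"
      for us ws :: "('x \<times> ('v \<Rightarrow> real)) list"
      by (cases us; cases ws) auto
    have "?f r \<in> {0}"
    proof (rule D.rels_into[OF lin subspace_single_0 that(1)])
      fix us ws :: "('x \<times> ('v \<Rightarrow> real)) list"
      show "linear_mod (dual V) x {0} (\<lambda>p. ?f (bas (us @ p # ws)))"
        using snd_vadd_dual[OF _ vw(1)] snd_vadd_dual[OF _ vw(2)] snd_vscale_dual[OF _ vw(1)]
          snd_vscale_dual[OF _ vw(2)] two[of us ws]
        by (auto simp: linear_mod_def hcomp_bas linear_0[OF linear_lext] algebra_simps simp del: dual_simps)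
    qed
    then show ?thesis by simp
  qed
  have indep: "form b v w = form a v w"
    if b: "b \<in> tcoset (dual V) x 2 a" and vw: "v \<in> fibre V x" "w \<in> fibre V x" for b v w
  proof -
    have m: "b - a \<in> multilin_rels (dual V) x 2" using b by (simp add: mem_tcoset)
    have "form b v w - form a v w = lext (\<lambda>k. snd (k ! 0) v * snd (k ! 1) w) (b - a)"
      by (simp add: form_lext linear_diff[OF linear_lext])
    also have "\<dots> = 0"
      using kill[OF D.multilin_rels_subset(1)[OF m] vw] hcomp_eq_self[OF D.multilin_rels_subset(2)[OF m]] by simp
    finally show ?thesis by simp
  qed
  have mem: "a \<in> tcoset (dual V) x 2 a" by (simp add: mem_tcoset subspace_0[OF subspace_multilin_rels])
  have "form_of (s x) v w = form a v w" if vw: "v \<in> fibre V x" "w \<in> fibre V x" for v w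
  proof -
    have "form_of (s x) v w = (THE r. \<exists>b\<in>tcoset (dual V) x 2 a. r = form b v w)"
      by (simp only: form_of_def a(2) form_def snd_conv)
    also have "\<dots> = form a v w"
    proof (rule the_equality)
      show "\<exists>b\<in>tcoset (dual V) x 2 a. form a v w = form b v w" using mem by blast
      show "r = form a v w" if "\<exists>b\<in>tcoset (dual V) x 2 a. r = form b v w" for r
        using that indep[OF _ vw] by blast
    qed
    finally show ?thesis .
  qed
  then have "g x v w = form a v w" if "v \<in> fibre V x" "w \<in> fibre V x" for v w
    using s(3)[OF that] that by simp
  then show ?thesis unfolding form_def by (rule that[OF a(1)])
qed

lemma metric_sym: "v \<in> fibre V x \<Longrightarrow> w \<in> fibre V x \<Longrightarrow> g x v w = g x w v"
  using metric base_pt unfolding pseudo_metric_def by blast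

text \<open>The second letters of a representing tensor are elements of the dual, hence smooth
  forms, and \<open>g x v\<close> is a finite linear combination of them.\<close>

lemma metric_lin_form:
  assumes "v \<in> fibre V x"
  shows "lin_form V x (g x v)"
proof -
  obtain a where a: "a \<in> free_on (tuples (dual V) x 2)"
    "\<And>v w. v \<in> fibre V x \<Longrightarrow> w \<in> fibre V x \<Longrightarrow>
      g x v w = (\<Sum>k\<in>Poly_Mapping.keys a. Poly_Mapping.lookup a k * snd (k ! 0) v * snd (k ! 1) w)"
    by (rule metric_representation) (rule that)
  have "lin_form V x (\<lambda>w. \<Sum>k\<in>Poly_Mapping.keys a. Poly_Mapping.lookup a k * snd (k ! 0) v * snd (k ! 1) w)"
  proof (rule lin_form_sum[OF finite_keys lin_form_cmult], rule dual_lin_form)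
    fix k assume "k \<in> Poly_Mapping.keys a"
    then have "length k = 2" "set k \<subseteq> fibre (dual V) x" using a(1) by (auto simp: free_on_def tuples_def)
    then show "k ! 1 \<in> fibre (dual V) x" using nth_mem[of 1 k] by auto
  qed
  then show ?thesis by (rule lin_form_cong) (simp add: a(2) assms)
qed

lemma metric_vadd:
  "u \<in> fibre V x \<Longrightarrow> v \<in> fibre V x \<Longrightarrow> w \<in> fibre V x \<Longrightarrow> g x u (vadd V v w) = g x u v + g x u w"
  using metric_lin_form[of u] by (simp add: lin_form_def)

lemma metric_vscale: "u \<in> fibre V x \<Longrightarrow> v \<in> fibre V x \<Longrightarrow> g x u (vscale V c v) = c * g x u v"
  using metric_lin_form[of u] by (simp add: lin_form_def)

lemma Psi_eq: "v \<in> fibre V x \<Longrightarrow> Psi V g v = (x, restrict (g x v) (fibre V x))"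
  by (simp add: Psi_def over_def)

lemma Psi_in_dual: "v \<in> fibre V x \<Longrightarrow> Psi V g v \<in> fibre (dual V) x"
  by (simp add: Psi_eq restrict_in_dual metric_lin_form)

lemma snd_Psi: "v \<in> fibre V x \<Longrightarrow> w \<in> fibre V x \<Longrightarrow> snd (Psi V g v) w = g x v w"
  by (simp add: Psi_eq)

lemma Psi_vadd:
  assumes "v \<in> fibre V x" "w \<in> fibre V x"
  shows "Psi V g (vadd V v w) = vadd (dual V) (Psi V g v) (Psi V g w)"
proof (rule dual_eqI)
  fix u assume u: "u \<in> fibre V x"
  show "snd (Psi V g (vadd V v w)) u = snd (vadd (dual V) (Psi V g v) (Psi V g w)) u"
    using assms u metric_sym[of u] metric_vadd[OF u assms] vadd_closed[OF assms]
    by (simp add: snd_vadd_dual Psi_in_dual snd_Psi del: dual_simps)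
qed (simp_all add: assms Psi_in_dual vadd_closed D.vadd_closed del: dual_simps)

lemma Psi_vscale:
  assumes "v \<in> fibre V x"
  shows "Psi V g (vscale V c v) = vscale (dual V) c (Psi V g v)"
proof (rule dual_eqI)
  fix u assume u: "u \<in> fibre V x"
  show "snd (Psi V g (vscale V c v)) u = snd (vscale (dual V) c (Psi V g v)) u"
    using assms u metric_sym[of u] metric_vscale[OF u assms] vscale_closed[OF assms]
    by (simp add: snd_vscale_dual Psi_in_dual snd_Psi del: dual_simps)
qed (simp_all add: assms Psi_in_dual vscale_closed D.vscale_closed del: dual_simps)

text \<open>The image of \<open>Psi\<close> is closed under the operations and has the dimension of
  the dual by the rank condition, so it is the whole dual fibre.\<close>

lemma Psi_surj: "Psi V g ` fibre V x = fibre (dual V) x"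
proof -
  obtain \<theta> :: "'x \<times> ('v \<Rightarrow> real) \<Rightarrow> nat \<Rightarrow>\<^sub>0 real" and B where "coordinates (dual V) x \<theta> B"
    by (rule dual_coordinates)
  then interpret C: coordinates "dual V" x \<theta> B .
  have vs: "real_vector_space_on (fibre V x) (vadd V) (vscale V) (vzero V x)"
    using pbundle base_pt by (simp add: pseudo_bundle_def)
  have zero: "g x (vzero V x) u = 0" if u: "u \<in> fibre V x" for u
  proof -
    have "vadd V (vzero V x) (vzero V x) = vzero V x"
      using vs by (simp add: real_vector_space_on_def)
    then have "g x u (vzero V x) = 0" using metric_vadd[OF u vzero_closed vzero_closed] by simp
    then show ?thesis using metric_sym[OF u vzero_closed] by simp
  qed
  have "Psi V g (vzero V x) = vzero (dual V) x"
    using zero by (simp add: Psi_eq vzero_closed restrict_def fun_eq_iff)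
  then have "C.subfibre (Psi V g ` fibre V x)"
    unfolding C.subfibre_def using Psi_vadd[symmetric] Psi_vscale[symmetric]
    by (auto simp: Psi_in_dual vadd_closed vscale_closed simp del: dual_simps
        intro!: image_eqI[of _ _ "vzero V x"] vzero_closed)
  moreover have "vdim (dual V) x (Psi V g ` fibre V x) = vdim (dual V) x (fibre (dual V) x)"
    using metric base_pt unfolding pseudo_metric_def by blast
  ultimately show ?thesis by (rule C.subfibre_eqI)
qed

text \<open>\<open>g x v w\<close> depends on \<open>v\<close> only through \<open>Psi V g v\<close>
  and, by symmetry, on \<open>w\<close> only through \<open>Psi V g w\<close>; so the description
  picks a single value although \<open>Psi\<close> may have a kernel.\<close>

lemma dual_metric_Psi:
  assumes "v \<in> fibre V x" "w \<in> fibre V x"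
  shows "dual_metric V g x (Psi V g v) (Psi V g w) = g x v w"
  unfolding dual_metric_def
proof (rule the_equality)
  show "\<exists>v'\<in>fibre V x. \<exists>w'\<in>fibre V x. Psi V g v' = Psi V g v \<and> Psi V g w' = Psi V g w \<and> g x v w = g x v' w'"
    using assms by blast
  fix r assume "\<exists>v'\<in>fibre V x. \<exists>w'\<in>fibre V x. Psi V g v' = Psi V g v \<and> Psi V g w' = Psi V g w \<and> r = g x v' w'"
  then obtain v' w' where *: "v' \<in> fibre V x" "w' \<in> fibre V x" "Psi V g v' = Psi V g v" "Psi V g w' = Psi V g w"
    "r = g x v' w'" by blast
  have "g x v' w' = g x v w'" using snd_Psi[OF *(1,2)] snd_Psi[OF assms(1) *(2)] *(3) by simp
  also have "\<dots> = g x w' v" by (rule metric_sym[OF assms(1) *(2)])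
  also have "\<dots> = g x w v" using snd_Psi[OF *(2) assms(1)] snd_Psi[OF assms(2,1)] *(4) by simp
  also have "\<dots> = g x v w" by (rule metric_sym[OF assms(2,1)])
  finally show "r = g x v w" using *(5) by simp
qed

lemma cfibre_dual: "cfibre (dual V) x (dual_metric V g)"
proof
  fix \<phi> \<psi> \<zeta> c assume "\<phi> \<in> fibre (dual V) x" "\<psi> \<in> fibre (dual V) x"
  then obtain v w where *: "v \<in> fibre V x" "\<phi> = Psi V g v" "w \<in> fibre V x" "\<psi> = Psi V g w"
    using Psi_surj by blast
  show "dual_metric V g x \<phi> \<psi> = dual_metric V g x \<psi> \<phi>"
    using * by (simp add: dual_metric_Psi metric_sym[of v])
  show "dual_metric V g x \<phi> (vscale (dual V) c \<psi>) = c * dual_metric V g x \<phi> \<psi>"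
    using * by (simp add: dual_metric_Psi metric_vscale vscale_closed flip: Psi_vscale del: dual_simps)
  assume "\<zeta> \<in> fibre (dual V) x"
  then obtain u where "u \<in> fibre V x" "\<zeta> = Psi V g u" using Psi_surj by blast
  with * show "dual_metric V g x \<phi> (vadd (dual V) \<psi> \<zeta>) = dual_metric V g x \<phi> \<psi> + dual_metric V g x \<phi> \<zeta>"
    by (simp add: dual_metric_Psi metric_vadd vadd_closed flip: Psi_vadd del: dual_simps)
qed

end

section \<open>Gluing\<close>

text \<open>Normal form of a point of the disjoint union: points of the gluing domain move to the
  right-hand side, where they stay. Hence the equivalence closure in \<open>glue_rel\<close> is
  equality of normal forms, for injective and non-injective \<open>h\<close> alike.\<close>

fun canon :: "'a set \<Rightarrow> ('a \<Rightarrow> 'b) \<Rightarrow> 'a + 'b \<Rightarrow> 'a + 'b" where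
  "canon D h (Inl a) = (if a \<in> D then Inr (h a) else Inl a)"
| "canon D h (Inr b) = Inr b"

lemma glue_rel_eq:
  fixes h :: "'a \<Rightarrow> 'b"
  shows "glue_rel D h = {(u, v). canon D h u = canon D h v}"
proof -
  define r :: "(('a + 'b) \<times> ('a + 'b)) set" where "r = {(Inl a, Inr (h a)) |a. a \<in> D}"
  have gr: "glue_rel D h = (r \<union> r\<inverse>)\<^sup>*" by (simp add: glue_rel_def r_def Let_def)
  have "canon D h u = canon D h v" if "(u, v) \<in> (r \<union> r\<inverse>)\<^sup>*" for u v
    using that by (induction rule: rtrancl_induct) (auto simp: r_def)
  moreover have "(u, v) \<in> (r \<union> r\<inverse>)\<^sup>*" if eq: "canon D h u = canon D h v" for u v
  proof -
    have c: "(u, canon D h u) \<in> (r \<union> r\<inverse>)\<^sup>*" for u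
      by (cases u) (auto simp: r_def)
    have "sym ((r \<union> r\<inverse>)\<^sup>*)" by (rule sym_rtrancl) (auto simp: sym_def)
    then have "(canon D h v, v) \<in> (r \<union> r\<inverse>)\<^sup>*" using c[of v] by (rule symD)
    with c[of u, unfolded eq] show ?thesis by (rule rtrancl_trans)
  qed
  ultimately have "z \<in> (r \<union> r\<inverse>)\<^sup>* \<longleftrightarrow> z \<in> {(u, v). canon D h u = canon D h v}" for z
    by (cases z) blast
  then show ?thesis unfolding gr by (rule set_eqI)
qed

lemma glue_class: "glue_rel D h `` {u} = {v. canon D h v = canon D h u}"
  by (auto simp: glue_rel_eq)

lemma glue_class_eq_iff: "glue_rel D h `` {u} = glue_rel D h `` {v} \<longleftrightarrow> canon D h u = canon D h v"
  unfolding glue_class by auto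

lemma in1_outside: "a \<notin> D \<Longrightarrow> in1 D h a = {Inl a}"
proof -
  assume "a \<notin> D"
  then have "canon D h v = Inl a \<longleftrightarrow> v = Inl a" for v by (cases v) auto
  then show ?thesis using \<open>a \<notin> D\<close> unfolding in1_def glue_class by simp
qed

lemma in2_eq: "in2 D h b = insert (Inr b) (Inl ` {a \<in> D. h a = b})"
proof -
  have "canon D h v = Inr b \<longleftrightarrow> v = Inr b \<or> (\<exists>a\<in>D. v = Inl a \<and> h a = b)" for v by (cases v) auto
  then show ?thesis unfolding in2_def glue_class by auto
qed

lemma in1_inside: "a \<in> D \<Longrightarrow> in1 D h a = in2 D h (h a)"
  by (simp add: in1_def in2_def glue_class_eq_iff)

lemma in2_inj: "in2 D h b = in2 D h b' \<longleftrightarrow> b = b'"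
  by (simp add: in2_def glue_class_eq_iff)

lemma in1_inj: "a \<notin> D \<Longrightarrow> in1 D h a' = in1 D h a \<longleftrightarrow> a' = a"
  by (auto simp: in1_def glue_class_eq_iff)

lemma in1_neq_in2: "a \<notin> D \<Longrightarrow> in1 D h a \<noteq> in2 D h b"
  by (simp add: in1_def in2_def glue_class_eq_iff)

lemma in1_eq_in2: "in1 D h a = in2 D h b \<longleftrightarrow> a \<in> D \<and> h a = b"
  by (simp add: in1_def in2_def glue_class_eq_iff)

lemma out1_in1: "a \<in> S \<Longrightarrow> a \<notin> D \<Longrightarrow> out1 S D h (in1 D h a) = a"
  unfolding out1_def by (rule the_inv_into_f_f) (auto simp: inj_on_def in1_inj)

lemma out2_in2: "b \<in> S \<Longrightarrow> out2 S D h (in2 D h b) = b"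
  unfolding out2_def by (rule the_inv_into_f_f) (auto simp: inj_on_def in2_inj)

lemma glue_points:
  assumes "h ` D \<subseteq> points Y"
  shows "points (glue_dsp X Y D h) = in1 D h ` (points X - D) \<union> in2 D h ` points Y"
proof -
  have "points (glue_dsp X Y D h) = in1 D h ` points X \<union> in2 D h ` points Y"
    by (auto simp: glue_dsp_def quot_dsp_def sum_dsp_def quotient_def in1_def in2_def)
  also have "\<dots> = in1 D h ` (points X - D) \<union> in2 D h ` points Y"
  proof -
    have "in1 D h a \<in> in1 D h ` (points X - D) \<union> in2 D h ` points Y" if "a \<in> points X" for a
      using assms that in1_inside[of a D h] by (cases "a \<in> D") blast+
    then show ?thesis by blast
  qed
  finally show ?thesis .
qed

text \<open>Two local lifts are nested: through the quotient into the disjoint union, and on a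
  smaller neighbourhood into one summand.\<close>

lemma glue_plot_local:
  assumes "plot (glue_dsp X Y D h) n U p" "u \<in> U"
  obtains (left) W q where "W \<subseteq> U" "openin (Euclidean_space n) W" "u \<in> W" "plot X n W q"
      "\<And>w. w \<in> W \<Longrightarrow> p w = in1 D h (q w)"
    | (right) W q where "W \<subseteq> U" "openin (Euclidean_space n) W" "u \<in> W" "plot Y n W q"
      "\<And>w. w \<in> W \<Longrightarrow> p w = in2 D h (q w)"
proof -
  from assms obtain W q where W: "W \<subseteq> U" "openin (Euclidean_space n) W" "u \<in> W" "plot (sum_dsp X Y) n W q"
    "\<forall>w\<in>W. p w = glue_rel D h `` {q w}"
    unfolding glue_dsp_def quot_dsp_def by auto
  have "\<exists>W'\<subseteq>W. openin (Euclidean_space n) W' \<and> u \<in> W' \<and>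
      ((\<exists>q'. plot X n W' q' \<and> (\<forall>w\<in>W'. q w = Inl (q' w))) \<or> (\<exists>q'. plot Y n W' q' \<and> (\<forall>w\<in>W'. q w = Inr (q' w))))"
    using W(3,4) by (simp add: sum_dsp_def)
  then obtain W' where W': "W' \<subseteq> W" "openin (Euclidean_space n) W'" "u \<in> W'"
    "(\<exists>q'. plot X n W' q' \<and> (\<forall>w\<in>W'. q w = Inl (q' w))) \<or> (\<exists>q'. plot Y n W' q' \<and> (\<forall>w\<in>W'. q w = Inr (q' w)))"
    by (elim exE conjE) (rule that)
  have sub: "W' \<subseteq> U" using W' W by blast
  from W'(4) show ?thesis
  proof (elim disjE exE conjE)
    fix q' assume "plot X n W' q'" "\<forall>w\<in>W'. q w = Inl (q' w)"
    then show ?thesis using W(5) W'(1) by (intro left[OF sub W'(2,3)]) (auto simp: in1_def)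
  next
    fix q' assume "plot Y n W' q'" "\<forall>w\<in>W'. q w = Inr (q' w)"
    then show ?thesis using W(5) W'(1) by (intro right[OF sub W'(2,3)]) (auto simp: in2_def)
  qed
qed

lemma glue_plot_in1:
  assumes "plots_open X" "plot X n U p"
  shows "plot (glue_dsp X Y D h) n U (in1 D h \<circ> p)"
proof -
  have U: "openin (Euclidean_space n) U" using assms unfolding plots_open_def by blast
  have "plot (sum_dsp X Y) n U (Inl \<circ> p)"
    using U assms(2) unfolding sum_dsp_def by fastforce
  then show ?thesis using U unfolding glue_dsp_def quot_dsp_def by (fastforce simp: in1_def)
qed

lemma glue_plot_in2:
  assumes "plots_open Y" "plot Y n U p"
  shows "plot (glue_dsp X Y D h) n U (in2 D h \<circ> p)"
proof -
  have U: "openin (Euclidean_space n) U" using assms unfolding plots_open_def by blast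
  have "plot (sum_dsp X Y) n U (Inr \<circ> p)"
    using U assms(2) unfolding sum_dsp_def by fastforce
  then show ?thesis using U unfolding glue_dsp_def quot_dsp_def by (fastforce simp: in2_def)
qed

lemma glue_plots_open: "plots_open (glue_dsp X Y D h)"
  by (simp add: plots_open_def glue_dsp_def quot_dsp_def)

section \<open>Glued pseudo-bundles and their fibres\<close>

lemma pb_glue_simps:
  "tot (pb_glue V W D f F) = glue_dsp (tot V) (tot W) (over V D) F"
  "base (pb_glue V W D f F) = glue_dsp (base V) (base W) D f"
  by (simp_all add: pb_glue_def Let_def)

lemma pb_glue_proj:
  "proj (pb_glue V W D f F) c = the_elem ((\<lambda>z. glue_rel D f `` {map_sum (proj V) (proj W) z}) ` c)"
  by (simp add: pb_glue_def Let_def)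

text \<open>Formulated through base points alone, so that it applies uniformly to vector bundles,
  duals, tensor powers, exterior and Clifford algebras.\<close>

locale gluing =
  fixes V :: "('v, 'x) pbundle" and W :: "('w, 'y) pbundle"
    and D :: "'x set" and f :: "'x \<Rightarrow> 'y" and F :: "'v \<Rightarrow> 'w"
  assumes glued_base: "f ` D \<subseteq> points (base W)"
    and glued_tot: "v \<in> over V D \<Longrightarrow> F v \<in> points (tot W) \<and> proj W (F v) = f (proj V v)"
begin

abbreviation "P \<equiv> pb_glue V W D f F"
abbreviation "j1 \<equiv> pb_in1 V D F"
abbreviation "j2 \<equiv> pb_in2 V D F"

lemma points_P: "points (tot P) = j1 ` (points (tot V) - over V D) \<union> j2 ` points (tot W)"
  unfolding pb_glue_simps by (rule glue_points) (use glued_tot in auto)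

lemma base_P: "points (base P) = in1 D f ` (points (base V) - D) \<union> in2 D f ` points (base W)"
  unfolding pb_glue_simps by (rule glue_points) (rule glued_base)

lemma proj_j1: "v \<notin> over V D \<Longrightarrow> proj P (j1 v) = in1 D f (proj V v)"
  unfolding pb_glue_proj in1_outside by (simp add: in1_def)

text \<open>The class of \<open>w\<close> also contains all \<open>v\<close> in the gluing domain
  with \<open>F v = w\<close>. As \<open>F\<close> covers \<open>f\<close>, their base points lie in
  the same class, so the projection sees a singleton.\<close>

lemma proj_j2: "proj P (j2 w) = in2 D f (proj W w)"
proof -
  have "glue_rel D f `` {Inl (proj V v)} = in2 D f (proj W (F v))" if "v \<in> over V D" for v
    using that glued_tot[OF that] in1_inside[of "proj V v" D f] by (simp add: over_def in1_def)
  then have "(\<lambda>z. glue_rel D f `` {map_sum (proj V) (proj W) z}) ` j2 w = {in2 D f (proj W w)}"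
    unfolding in2_eq[of "over V D"] image_insert image_image map_sum.simps
    by (auto simp del: Image_singleton_iff simp: in2_def)
  then show ?thesis unfolding pb_glue_proj by simp
qed

lemma not_over: "x \<notin> D \<Longrightarrow> v \<in> fibre V x \<Longrightarrow> v \<in> points (tot V) \<and> v \<notin> over V D"
  by (auto simp: over_def)

lemma fibre_j1:
  assumes "x \<in> points (base V)" "x \<notin> D"
  shows "fibre P (in1 D f x) = j1 ` fibre V x"
proof (intro subset_antisym subsetI)
  fix c assume c: "c \<in> fibre P (in1 D f x)"
  then have "c \<in> points (tot P)" "proj P c = in1 D f x" by (auto simp: over_def)
  then consider v where "v \<in> points (tot V)" "v \<notin> over V D" "c = j1 v" "in1 D f (proj V v) = in1 D f x"
    | w where "c = j2 w" "in2 D f (proj W w) = in1 D f x"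
    unfolding points_P using proj_j1 proj_j2 by fastforce
  then show "c \<in> j1 ` fibre V x"
  proof cases
    case 1
    then show ?thesis using assms(2) by (auto simp: in1_inj over_def)
  next
    case 2
    then show ?thesis using in1_neq_in2[OF assms(2)] by metis
  qed
next
  fix c assume "c \<in> j1 ` fibre V x"
  then obtain v where v: "v \<in> fibre V x" "c = j1 v" by auto
  have v': "v \<in> points (tot V)" "v \<notin> over V D" using not_over[OF assms(2) v(1)] by simp_all
  have "c \<in> points (tot P)" unfolding points_P v(2) using v' by blast
  moreover have "proj V v = x" using v(1) by (simp add: over_def)
  then have "proj P c = in1 D f x" unfolding v(2) proj_j1[OF v'(2)] by simp
  ultimately show "c \<in> fibre P (in1 D f x)" by (simp add: over_def)
qed

lemma fibre_j2: "fibre P (in2 D f y) = j2 ` fibre W y"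
proof (intro subset_antisym subsetI)
  fix c assume c: "c \<in> fibre P (in2 D f y)"
  then have "c \<in> points (tot P)" "proj P c = in2 D f y" by (auto simp: over_def)
  then consider v where "v \<in> points (tot V)" "v \<notin> over V D" "in1 D f (proj V v) = in2 D f y"
    | w where "w \<in> points (tot W)" "c = j2 w" "in2 D f (proj W w) = in2 D f y"
    unfolding points_P using proj_j1 proj_j2 by fastforce
  then show "c \<in> j2 ` fibre W y"
  proof cases
    case 1
    then show ?thesis by (auto simp: in1_eq_in2 over_def)
  next
    case 2
    then show ?thesis by (auto simp: in2_inj over_def)
  qed
next
  fix c assume "c \<in> j2 ` fibre W y"
  then obtain w where w: "w \<in> fibre W y" "c = j2 w" by auto
  have "w \<in> points (tot W)" "proj W w = y" using w(1) by (simp_all add: over_def)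
  then have "c \<in> points (tot P)" "proj P c = in2 D f y" unfolding points_P w(2) proj_j2 by blast+
  then show "c \<in> fibre P (in2 D f y)" by (simp add: over_def)
qed

lemma ops_j1:
  assumes "v \<in> points (tot V) - over V D" "w \<in> points (tot V) - over V D"
  shows "vadd P (j1 v) (j1 w) = j1 (vadd V v w)" "vscale P c (j1 v) = j1 (vscale V c v)"
  using assms by (auto simp: pb_glue_def Let_def out1_in1)

lemma ops_j2:
  assumes "v \<in> points (tot W)" "w \<in> points (tot W)"
  shows "vadd P (j2 v) (j2 w) = j2 (vadd W v w)" "vscale P c (j2 v) = j2 (vscale W c v)"
proof -
  have "j2 v \<notin> j1 ` (points (tot V) - over V D)" using in1_neq_in2[of _ "over V D" F v] by fastforce
  then show "vadd P (j2 v) (j2 w) = j2 (vadd W v w)" "vscale P c (j2 v) = j2 (vscale W c v)"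
    using assms by (auto simp: pb_glue_def Let_def out2_in2)
qed

lemma zero_j1: "x \<in> points (base V) - D \<Longrightarrow> vzero P (in1 D f x) = j1 (vzero V x)"
  by (simp add: pb_glue_def Let_def out1_in1)

lemma zero_j2: "y \<in> points (base W) \<Longrightarrow> vzero P (in2 D f y) = j2 (vzero W y)"
proof -
  assume y: "y \<in> points (base W)"
  have "in2 D f y \<notin> in1 D f ` (points (base V) - D)" using in1_neq_in2[of _ D f y] by fastforce
  then show ?thesis using y by (simp add: pb_glue_def Let_def out2_in2)
qed

lemma iso_j1:
  assumes "vfibre V x" "x \<notin> D"
  shows "vfibre_iso V x P (in1 D f x) j1"
proof -
  interpret A: vfibre V x by fact
  note fib = fibre_j1[OF A.base_pt assms(2)]
  have mem: "v \<in> points (tot V) - over V D" if "v \<in> fibre V x" for v using not_over[OF assms(2) that] by simp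
  show ?thesis
  proof
    show "in1 D f x \<in> points (base P)" using A.base_pt assms(2) by (simp add: base_P)
    show "vadd P v w \<in> fibre P (in1 D f x)" if "v \<in> fibre P (in1 D f x)" "w \<in> fibre P (in1 D f x)" for v w
      using that A.vadd_closed unfolding fib by (auto simp: ops_j1(1)[OF mem mem])
    show "vscale P c v \<in> fibre P (in1 D f x)" if "v \<in> fibre P (in1 D f x)" for c v
      using that A.vscale_closed unfolding fib by (auto simp: ops_j1(2)[OF mem mem])
    show "vzero P (in1 D f x) \<in> fibre P (in1 D f x)"
      using A.vzero_closed A.base_pt assms(2) unfolding fib by (simp add: zero_j1)
    show "linear_fibre V x P (in1 D f x) j1"
      unfolding linear_fibre_def fib by (auto simp: ops_j1(1)[OF mem mem] ops_j1(2)[OF mem mem])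
    show "bij_betw j1 (fibre V x) (fibre P (in1 D f x))"
      unfolding fib bij_betw_def using mem by (auto simp: inj_on_def in1_inj)
  qed
qed

lemma iso_j2:
  assumes "vfibre W y"
  shows "vfibre_iso W y P (in2 D f y) j2"
proof -
  interpret A: vfibre W y by fact
  note fib = fibre_j2[of y]
  have mem: "w \<in> points (tot W)" if "w \<in> fibre W y" for w using that by (simp add: over_def)
  show ?thesis
  proof
    show "in2 D f y \<in> points (base P)" using A.base_pt by (simp add: base_P)
    show "vadd P v w \<in> fibre P (in2 D f y)" if "v \<in> fibre P (in2 D f y)" "w \<in> fibre P (in2 D f y)" for v w
      using that A.vadd_closed unfolding fib by (auto simp: ops_j2(1)[OF mem mem])
    show "vscale P c v \<in> fibre P (in2 D f y)" if "v \<in> fibre P (in2 D f y)" for c v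
      using that A.vscale_closed unfolding fib by (auto simp: ops_j2(2)[OF mem mem])
    show "vzero P (in2 D f y) \<in> fibre P (in2 D f y)"
      using A.vzero_closed A.base_pt unfolding fib by (simp add: zero_j2)
    show "linear_fibre W y P (in2 D f y) j2"
      unfolding linear_fibre_def fib by (auto simp: ops_j2(1)[OF mem mem] ops_j2(2)[OF mem mem])
    show "bij_betw j2 (fibre W y) (fibre P (in2 D f y))"
      unfolding fib bij_betw_def by (auto simp: inj_on_def in2_inj)
  qed
qed

end

lemma vfibre_iso_comp:
  assumes "vfibre_iso V x W y h" "vfibre_iso W y U z k" "\<And>v. v \<in> fibre V x \<Longrightarrow> m v = k (h v)"
  shows "vfibre_iso V x U z m"
proof -
  interpret A: vfibre_iso V x W y h by fact
  interpret B: vfibre_iso W y U z k by fact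
  show ?thesis
  proof
    show "linear_fibre V x U z m"
      unfolding linear_fibre_def
      by (auto simp: assms(3) A.A.vadd_closed A.A.vscale_closed A.map_vadd A.map_vscale B.map_vadd B.map_vscale
          A.map_closed B.map_closed)
    have "bij_betw (k \<circ> h) (fibre V x) (fibre U z)" by (rule bij_betw_trans[OF A.bij B.bij])
    then show "bij_betw m (fibre V x) (fibre U z)"
      by (subst bij_betw_cong[of _ _ "k \<circ> h"]) (simp_all add: assms(3))
  qed
qed

section \<open>Pulling back linear forms\<close>

lemma precomp_map:
  assumes "dual_fibre A a" "dual_fibre B b" "linear_fibre A a B b k"
    and "\<And>n U p. plot (tot A) n U p \<Longrightarrow> p ` U \<subseteq> fibre A a \<Longrightarrow> plot (tot B) n U (k \<circ> p)"
  shows "vfibre_map (dual B) b (dual A) a (precomp A a k)"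
proof -
  interpret A: dual_fibre A a by fact
  interpret B: dual_fibre B b by fact
  have k: "k v \<in> fibre B b" if "v \<in> fibre A a" for v using assms(3) that by (auto simp: linear_fibre_def)
  have lf: "lin_form A a (snd \<xi> \<circ> k)" if "\<xi> \<in> fibre (dual B) b" for \<xi>
  proof -
    have sm: "smooth_map (sub_dsp (tot A) (fibre A a)) real_dsp (snd \<xi> \<circ> k)"
    proof (rule smooth_map_realI)
      fix n U p assume "plot (sub_dsp (tot A) (fibre A a)) n U p"
      then have p: "plot (tot A) n U p" "p ` U \<subseteq> fibre A a" by (auto simp: sub_dsp_def)
      then have "plot (sub_dsp (tot B) (fibre B b)) n U (k \<circ> p)"
        using assms(4)[OF p] k by (auto simp: sub_dsp_def)
      then show "openin (Euclidean_space n) U \<and> smooth_fun n U ((snd \<xi> \<circ> k) \<circ> p)"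
        using smooth_map_realD[of "sub_dsp (tot B) (fibre B b)" "snd \<xi>"] B.dual_lin_form[OF that]
        by (simp add: lin_form_def comp_assoc)
    qed
    then show ?thesis
      using B.dual_lin_form[OF that] assms(3) k by (simp add: lin_form_def linear_fibre_def)
  qed
  have mem: "precomp A a k \<xi> \<in> fibre (dual A) a" if "\<xi> \<in> fibre (dual B) b" for \<xi>
    unfolding precomp_def by (rule A.restrict_in_dual[OF lf[OF that]])
  have snd: "snd (precomp A a k \<xi>) v = snd \<xi> (k v)" if "v \<in> fibre A a" for \<xi> v
    using that by (simp add: precomp_def)
  show ?thesis
  proof
    show "linear_fibre (dual B) b (dual A) a (precomp A a k)"
      unfolding linear_fibre_def
    proof (intro conjI ballI allI)
      show "precomp A a k ` fibre (dual B) b \<subseteq> fibre (dual A) a" using mem by auto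
      show "precomp A a k (vadd (dual B) \<xi> \<eta>) = vadd (dual A) (precomp A a k \<xi>) (precomp A a k \<eta>)"
        if "\<xi> \<in> fibre (dual B) b" "\<eta> \<in> fibre (dual B) b" for \<xi> \<eta>
        by (rule A.dual_eqI)
          (simp_all add: that mem A.D.vadd_closed B.D.vadd_closed A.snd_vadd_dual B.snd_vadd_dual snd k del: dual_simps)
      show "precomp A a k (vscale (dual B) c \<xi>) = vscale (dual A) c (precomp A a k \<xi>)"
        if "\<xi> \<in> fibre (dual B) b" for \<xi> c
        by (rule A.dual_eqI)
          (simp_all add: that mem A.D.vscale_closed B.D.vscale_closed A.snd_vscale_dual B.snd_vscale_dual snd k del: dual_simps)
    qed
  qed
qed

text \<open>For surjectivity a form on the fibre of \<open>A\<close> is transported along the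
  inverse of \<open>k\<close>. The result is smooth because, by \<open>lift\<close>, a plot in the
  fibre of \<open>B\<close> is locally \<open>k\<close> composed with a plot in the fibre of
  \<open>A\<close>.\<close>

lemma precomp_iso:
  assumes A: "dual_fibre A a" and B: "dual_fibre B b" and k: "vfibre_iso A a B b k"
    and "\<And>n U p. plot (tot A) n U p \<Longrightarrow> p ` U \<subseteq> fibre A a \<Longrightarrow> plot (tot B) n U (k \<circ> p)"
    and lift: "\<And>n U p u. plot (tot B) n U p \<Longrightarrow> p ` U \<subseteq> fibre B b \<Longrightarrow> u \<in> U \<Longrightarrow>
      \<exists>W\<subseteq>U. \<exists>q. openin (Euclidean_space n) W \<and> u \<in> W \<and> plot (tot A) n W q \<and>
        (\<forall>w\<in>W. q w \<in> fibre A a \<and> p w = k (q w))"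
  shows "vfibre_iso (dual B) b (dual A) a (precomp A a k)"
proof -
  interpret K: vfibre_iso A a B b k by fact
  interpret A: dual_fibre A a by fact
  interpret B: dual_fibre B b by fact
  interpret M: vfibre_map "dual B" b "dual A" a "precomp A a k"
    by (rule precomp_map[OF A B K.lin assms(4)])
  have snd: "snd (precomp A a k \<xi>) v = snd \<xi> (k v)" if "v \<in> fibre A a" for \<xi> v
    using that by (simp add: precomp_def)
  let ?S = "sub_dsp (tot B) (fibre B b)"
  have smooth: "smooth_map ?S real_dsp (\<phi> \<circ> K.inverse_map)" if \<phi>: "lin_form A a \<phi>" for \<phi>
  proof (rule smooth_map_real_local)
    fix n U p assume "plot ?S n U p"
    then have p: "plot (tot B) n U p" "p ` U \<subseteq> fibre B b" by (auto simp: sub_dsp_def)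
    show "openin (Euclidean_space n) U" using p(1) B.plots_open unfolding plots_open_def by blast
    fix u assume "u \<in> U"
    from lift[OF p this] obtain W q where W: "W \<subseteq> U" "openin (Euclidean_space n) W" "u \<in> W" "plot (tot A) n W q"
      "\<forall>w\<in>W. q w \<in> fibre A a \<and> p w = k (q w)"
      by (elim exE conjE) (rule that)
    have "plot (sub_dsp (tot A) (fibre A a)) n W q" using W(4,5) by (auto simp: sub_dsp_def)
    then have "smooth_fun n W (\<phi> \<circ> q)" using \<phi> smooth_map_realD(2) unfolding lin_form_def by blast
    moreover have "\<forall>w\<in>W. (\<phi> \<circ> K.inverse_map) (p w) = (\<phi> \<circ> q) w"
      using W(5) by (simp add: K.inverse_left)
    ultimately show "\<exists>W\<subseteq>U. \<exists>q. openin (Euclidean_space n) W \<and> u \<in> W \<and> smooth_fun n W q \<and>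
        (\<forall>w\<in>W. (\<phi> \<circ> K.inverse_map) (p w) = q w)"
      using W(1-3) by blast
  qed
  have "inj_on (precomp A a k) (fibre (dual B) b)"
  proof (rule inj_onI, rule B.dual_eqI)
    fix \<xi> \<eta> w assume *: "precomp A a k \<xi> = precomp A a k \<eta>" "w \<in> fibre B b"
    then show "snd \<xi> w = snd \<eta> w"
      using snd[OF K.inverse_closed[OF *(2)]] K.inverse_right[OF *(2)] by metis
  qed
  moreover have "\<phi> \<in> precomp A a k ` fibre (dual B) b" if \<phi>: "\<phi> \<in> fibre (dual A) a" for \<phi>
  proof
    interpret I: vfibre_map B b A a K.inverse_map by (rule K.inverse_vfibre_map)
    let ?\<psi> = "snd \<phi> \<circ> K.inverse_map"
    have "lin_form B b ?\<psi>"
      using smooth[OF A.dual_lin_form[OF \<phi>]] A.dual_lin_form[OF \<phi>]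
      by (simp add: lin_form_def I.map_vadd I.map_vscale I.map_closed)
    then show mem: "(b, restrict ?\<psi> (fibre B b)) \<in> fibre (dual B) b" by (rule B.restrict_in_dual)
    show "\<phi> = precomp A a k (b, restrict ?\<psi> (fibre B b))"
      by (rule A.dual_eqI[OF \<phi> M.map_closed[OF mem]]) (simp add: snd K.map_closed K.inverse_left)
  qed
  ultimately have "bij_betw (precomp A a k) (fibre (dual B) b) (fibre (dual A) a)"
    unfolding bij_betw_def using M.map_closed by blast
  then show ?thesis by unfold_locales
qed

section \<open>The glued pseudo-bundles of the theorem\<close>

lemma linear_fibre_cong:
  assumes "linear_fibre V x W y h" "vfibre V x" "\<And>v. v \<in> fibre V x \<Longrightarrow> h' v = h v"
  shows "linear_fibre V x W y h'"
proof -
  interpret vfibre V x by fact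
  show ?thesis using assms(1,3) vadd_closed vscale_closed by (auto simp: linear_fibre_def)
qed

lemma cfibre_iso:
  assumes "vfibre_iso V x W y h" "cfibre V x g"
    and iso: "\<And>v w. v \<in> fibre V x \<Longrightarrow> w \<in> fibre V x \<Longrightarrow> g' y (h v) (h w) = g x v w"
  shows "cfibre W y g'" "cfibre_map V x g W y g' h"
proof -
  interpret H: vfibre_iso V x W y h by fact
  interpret C: cfibre V x g by fact
  show "cfibre W y g'"
  proof
    fix v w u c assume "v \<in> fibre W y" "w \<in> fibre W y"
    then obtain v' w' where *: "v' \<in> fibre V x" "v = h v'" "w' \<in> fibre V x" "w = h w'"
      using H.bij unfolding bij_betw_def by blast
    show "g' y v w = g' y w v" using * iso C.form_sym by simp
    show "g' y v (vscale W c w) = c * g' y v w"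
      using * by (simp add: iso C.form_vscale H.A.vscale_closed flip: H.map_vscale)
    assume "u \<in> fibre W y"
    then obtain u' where "u' \<in> fibre V x" "u = h u'" using H.bij unfolding bij_betw_def by blast
    then show "g' y v (vadd W w u) = g' y v w + g' y v u"
      using * by (simp add: iso C.form_vadd H.A.vadd_closed flip: H.map_vadd)
  qed
  then interpret C': cfibre W y g' .
  show "cfibre_map V x g W y g' h" by unfold_locales (rule iso)
qed

locale compatible_gluing =
  fixes V1 :: "('v1, 'x1) pbundle" and V2 :: "('v2, 'x2) pbundle"
    and Y :: "'x1 set" and f :: "'x1 \<Rightarrow> 'x2" and F :: "'v1 \<Rightarrow> 'v2"
    and g1 :: "'x1 \<Rightarrow> 'v1 \<Rightarrow> 'v1 \<Rightarrow> real" and g2 :: "'x2 \<Rightarrow> 'v2 \<Rightarrow> 'v2 \<Rightarrow> real"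
  assumes pb1: "pseudo_bundle V1" "bounded_fibre_dim V1"
    and pb2: "pseudo_bundle V2" "bounded_fibre_dim V2"
    and gl: "is_gluing V1 V2 Y f F"
    and diff_f: "diffeomorphism (sub_dsp (base V1) Y) (sub_dsp (base V2) (f ` Y)) f"
    and diff_F: "diffeomorphism (sub_dsp (tot (dual V2)) (over (dual V2) (f ` Y)))
           (sub_dsp (tot (dual V1)) (Fstar V1 Y f F ` over (dual V2) (f ` Y)))
           (Fstar V1 Y f F)"
    and pm1: "pseudo_metric V1 g1" and pm2: "pseudo_metric V2 g2"
    and comp: "compatible V1 Y f F g1 g2"
begin

abbreviation "X1 \<equiv> points (base V1)"
abbreviation "X2 \<equiv> points (base V2)"
abbreviation "fi \<equiv> the_inv_into Y f"
abbreviation "Fs \<equiv> Fstar V1 Y f F"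
abbreviation "D1 \<equiv> dual V1"
abbreviation "D2 \<equiv> dual V2"
abbreviation "h1 \<equiv> dual_metric V1 g1"
abbreviation "h2 \<equiv> dual_metric V2 g2"
abbreviation "G \<equiv> glued V1 V2 Y f F"
abbreviation "GD \<equiv> glued_duals V1 V2 Y f F"
abbreviation "gm \<equiv> glued_dual_metric V1 V2 Y f F g1 g2"

lemma Y_sub: "Y \<subseteq> X1"
  using gl by (simp add: is_gluing_def)

lemma inj_f: "inj_on f Y"
  using diff_f Y_sub by (simp add: diffeomorphism_def bij_betw_def sub_dsp_def Int_absorb1)

lemma fi_f: "y \<in> Y \<Longrightarrow> fi (f y) = y"
  by (rule the_inv_into_f_f[OF inj_f])

lemma f_base: "y \<in> Y \<Longrightarrow> f y \<in> X2"
  using gl Y_sub by (auto simp: is_gluing_def smooth_map_def sub_dsp_def)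

lemma F_linear: "y \<in> Y \<Longrightarrow> linear_fibre V1 y V2 (f y) F"
  using gl by (simp add: is_gluing_def)

lemma F_closed: "y \<in> Y \<Longrightarrow> v \<in> fibre V1 y \<Longrightarrow> F v \<in> fibre V2 (f y)"
  using F_linear[of y] unfolding linear_fibre_def by blast

lemma metric1: "x \<in> X1 \<Longrightarrow> metric_fibre V1 x g1"
  using pseudo_bundle_dual_fibre[OF pb1(1)] pb1 pm1 by (simp add: metric_fibre_def metric_fibre_axioms_def)

lemma metric2: "x \<in> X2 \<Longrightarrow> metric_fibre V2 x g2"
  using pseudo_bundle_dual_fibre[OF pb2(1)] pb2 pm2 by (simp add: metric_fibre_def metric_fibre_axioms_def)

lemma dual1: "x \<in> X1 \<Longrightarrow> dual_fibre V1 x" by (rule pseudo_bundle_dual_fibre[OF pb1(1)])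
lemma dual2: "x \<in> X2 \<Longrightarrow> dual_fibre V2 x" by (rule pseudo_bundle_dual_fibre[OF pb2(1)])

lemma vfib1: "x \<in> X1 \<Longrightarrow> vfibre V1 x" by (rule dual_fibre.axioms(1)[OF dual1])
lemma vfib2: "x \<in> X2 \<Longrightarrow> vfibre V2 x" by (rule dual_fibre.axioms(1)[OF dual2])
lemma vfibD1: "x \<in> X1 \<Longrightarrow> vfibre D1 x" by (rule dual_fibre.vfibre_dual[OF dual1])
lemma vfibD2: "x \<in> X2 \<Longrightarrow> vfibre D2 x" by (rule dual_fibre.vfibre_dual[OF dual2])
lemma cfibD1: "x \<in> X1 \<Longrightarrow> cfibre D1 x h1" by (rule metric_fibre.cfibre_dual[OF metric1])
lemma cfibD2: "x \<in> X2 \<Longrightarrow> cfibre D2 x h2" by (rule metric_fibre.cfibre_dual[OF metric2])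

lemma open1: "plots_open (tot V1)"
  by (rule pseudo_bundle_plots_open[OF pb1(1)])

lemma open2: "plots_open (tot V2)"
  by (rule pseudo_bundle_plots_open[OF pb2(1)])

lemma F_plot: "plot (tot V1) n U p \<Longrightarrow> p ` U \<subseteq> over V1 Y \<Longrightarrow> plot (tot V2) n U (F \<circ> p)"
  using gl unfolding is_gluing_def smooth_map_def sub_dsp_def by simp

lemma Fs_precomp: "y \<in> Y \<Longrightarrow> \<xi> \<in> fibre D2 (f y) \<Longrightarrow> Fs \<xi> = precomp V1 y F \<xi>"
  using fi_f by (simp add: Fstar_def over_def)

lemma Fs_Psi:
  assumes y: "y \<in> Y" and v: "v \<in> fibre V1 y"
  shows "Fs (Psi V2 g2 (F v)) = Psi V1 g1 v"
proof -
  interpret M1: metric_fibre V1 y g1 using metric1 y Y_sub by blast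
  interpret M2: metric_fibre V2 "f y" g2 by (rule metric2[OF f_base[OF y]])
  have Fv: "F w \<in> fibre V2 (f y)" if "w \<in> fibre V1 y" for w
    by (rule F_closed[OF y that])
  have "g1 y v w = g2 (f y) (F v) (F w)" if "w \<in> fibre V1 y" for w
    using comp y v that unfolding compatible_def by blast
  then show ?thesis
    unfolding Fs_precomp[OF y M2.Psi_in_dual[OF Fv[OF v]]]
    using Fv v by (auto simp: precomp_def M1.Psi_eq M2.snd_Psi restrict_def fun_eq_iff)
qed

lemma Fs_map: "y \<in> Y \<Longrightarrow> vfibre_map D2 (f y) D1 y Fs"
proof -
  assume y: "y \<in> Y"
  then have y1: "y \<in> X1" using Y_sub by blast
  interpret P: vfibre_map D2 "f y" D1 y "precomp V1 y F"
  proof (rule precomp_map[OF dual1[OF y1] dual2[OF f_base[OF y]] F_linear[OF y]])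
    fix n U p assume "plot (tot V1) n U p" "p ` U \<subseteq> fibre V1 y"
    then show "plot (tot V2) n U (F \<circ> p)" using y by (intro F_plot) (auto simp: over_def)
  qed
  show "vfibre_map D2 (f y) D1 y Fs"
    by unfold_locales (rule linear_fibre_cong[OF P.lin vfibD2[OF f_base[OF y]] Fs_precomp[OF y]])
qed

lemma Fs_inj: "inj_on Fs (over D2 (f ` Y))"
proof -
  have "inj_on Fs (points (tot D2) \<inter> over D2 (f ` Y))"
    using diff_F by (simp add: diffeomorphism_def bij_betw_def sub_dsp_def)
  moreover have "points (tot D2) \<inter> over D2 (f ` Y) = over D2 (f ` Y)" by (auto simp: over_def)
  ultimately show ?thesis by simp
qed

text \<open>Surjectivity is forced by compatibility: both metrics have the rank of the respective dual,
  so every form on a fibre of \<open>V\<^sub>1\<close> over \<open>Y\<close> is \<open>g\<^sub>1(v, \<cdot>) = F\<^sup>*(g\<^sub>2(F v, \<cdot>))\<close> for some \<open>v\<close>.\<close>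

lemma Fs_iso: "y \<in> Y \<Longrightarrow> vfibre_iso D2 (f y) D1 y Fs"
proof -
  assume y: "y \<in> Y"
  interpret P: vfibre_map D2 "f y" D1 y Fs by (rule Fs_map[OF y])
  interpret M1: metric_fibre V1 y g1 using metric1 y Y_sub by blast
  interpret M2: metric_fibre V2 "f y" g2 by (rule metric2[OF f_base[OF y]])
  have "inj_on Fs (fibre D2 (f y))"
    by (rule inj_on_subset[OF Fs_inj]) (use y in \<open>auto simp: over_def\<close>)
  moreover have "fibre D1 y \<subseteq> Fs ` fibre D2 (f y)"
  proof
    fix \<phi> assume "\<phi> \<in> fibre D1 y"
    then obtain v where v: "v \<in> fibre V1 y" "\<phi> = Psi V1 g1 v" using M1.Psi_surj by blast
    have "F v \<in> fibre V2 (f y)" by (rule F_closed[OF y v(1)])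
    then show "\<phi> \<in> Fs ` fibre D2 (f y)" using Fs_Psi[OF y v(1)] M2.Psi_in_dual v(2) by (metis imageI)
  qed
  ultimately have "bij_betw Fs (fibre D2 (f y)) (fibre D1 y)"
    unfolding bij_betw_def using P.map_closed by blast
  then show "vfibre_iso D2 (f y) D1 y Fs" by unfold_locales
qed

text \<open>Injectivity of \<open>Fs\<close> forces every form over \<open>f y\<close> to be
  \<open>Psi V2 g2 (F v)\<close> for some \<open>v\<close>, with pull-back
  \<open>Psi V1 g1 v\<close>. The two dual metrics then reduce to the two sides of the compatibility
  condition.\<close>

lemma Fs_isometry:
  assumes y: "y \<in> Y" and "\<phi> \<in> fibre D2 (f y)" "\<psi> \<in> fibre D2 (f y)"
  shows "h1 y (Fs \<phi>) (Fs \<psi>) = h2 (f y) \<phi> \<psi>"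
proof -
  interpret P: vfibre_iso D2 "f y" D1 y Fs by (rule Fs_iso[OF y])
  interpret M1: metric_fibre V1 y g1 using metric1 y Y_sub by blast
  interpret M2: metric_fibre V2 "f y" g2 by (rule metric2[OF f_base[OF y]])
  have F: "F v \<in> fibre V2 (f y)" if "v \<in> fibre V1 y" for v
    by (rule F_closed[OF y that])
  have rep: "\<exists>v\<in>fibre V1 y. \<phi> = Psi V2 g2 (F v) \<and> Fs \<phi> = Psi V1 g1 v" if \<phi>: "\<phi> \<in> fibre D2 (f y)" for \<phi>
  proof -
    have "Fs \<phi> \<in> Psi V1 g1 ` fibre V1 y" unfolding M1.Psi_surj by (rule P.map_closed[OF \<phi>])
    then obtain v where v: "v \<in> fibre V1 y" "Fs \<phi> = Psi V1 g1 v" by blast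
    then have "Fs \<phi> = Fs (Psi V2 g2 (F v))" using Fs_Psi[OF y v(1)] by simp
    then have "\<phi> = Psi V2 g2 (F v)"
      using P.bij \<phi> M2.Psi_in_dual[OF F[OF v(1)]] by (auto simp: bij_betw_def dest: inj_onD)
    then show ?thesis using v by blast
  qed
  obtain v w where vw: "v \<in> fibre V1 y" "\<phi> = Psi V2 g2 (F v)" "Fs \<phi> = Psi V1 g1 v"
    "w \<in> fibre V1 y" "\<psi> = Psi V2 g2 (F w)" "Fs \<psi> = Psi V1 g1 w"
    using rep[OF assms(2)] rep[OF assms(3)] by blast
  have "g1 y v w = g2 (f y) (F v) (F w)"
    using comp y vw(1,4) unfolding compatible_def by blast
  then show ?thesis
    unfolding vw(3,6) M1.dual_metric_Psi[OF vw(1,4)]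
    unfolding vw(2,5) M2.dual_metric_Psi[OF F[OF vw(1)] F[OF vw(4)]] .
qed

lemma Fs_cmap: "y \<in> Y \<Longrightarrow> cfibre_map D2 (f y) h2 D1 y h1 Fs"
  by (rule cfibre_iso(2)[where g' = h1, OF Fs_iso cfibD2[OF f_base]]) (auto intro: Fs_isometry)

subsection \<open>The individual gluings\<close>

text \<open>The gluings of the duals and of all algebras built on them go in the opposite direction
  and cover the inverse of \<open>f\<close>; only the fibrewise map varies.\<close>

lemma gluing_over_fi:
  assumes "base W = base V1" "\<And>y v. y \<in> Y \<Longrightarrow> v \<in> fibre V (f y) \<Longrightarrow> H v \<in> fibre W y"
  shows "gluing V W (f ` Y) fi H"
proof
  show "fi ` f ` Y \<subseteq> points (base W)" using Y_sub fi_f assms(1) by auto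
  fix v assume "v \<in> over V (f ` Y)"
  then obtain y where y: "y \<in> Y" "v \<in> fibre V (f y)" by (auto simp: over_def)
  then have "H v \<in> fibre W y" "proj V v = f y" using assms(2) by (auto simp: over_def)
  then show "H v \<in> points (tot W) \<and> proj W (H v) = fi (proj V v)" using fi_f[OF y(1)] by (simp add: over_def)
qed

lemma glueG: "gluing V1 V2 Y f F"
proof
  show "f ` Y \<subseteq> X2" using f_base by auto
  fix v assume "v \<in> over V1 Y"
  then have "proj V1 v \<in> Y" "v \<in> fibre V1 (proj V1 v)" by (auto simp: over_def)
  then have "F v \<in> fibre V2 (f (proj V1 v))" by (rule F_closed)
  then show "F v \<in> points (tot V2) \<and> proj V2 (F v) = f (proj V1 v)" by (simp add: over_def)
qed

lemma glueD: "gluing D2 D1 (f ` Y) fi Fs"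
  by (rule gluing_over_fi) (auto intro: vfibre_map.map_closed[OF Fs_map])

lemma glueT: "gluing (tpow D2 n) (tpow D1 n) (f ` Y) fi (F_tpow V1 V2 Y f F n)"
proof (rule gluing_over_fi)
  fix y t assume y: "y \<in> Y" and t: "t \<in> fibre (tpow D2 n) (f y)"
  interpret P: vfibre_map D2 "f y" D1 y Fs by (rule Fs_map[OF y])
  show "F_tpow V1 V2 Y f F n t \<in> fibre (tpow D1 n) y"
    unfolding F_tpow_def by (rule P.tpow_map_fibre[OF t])
qed simp

lemma glueE: "gluing (ext D2) (ext D1) (f ` Y) fi (F_ext V1 V2 Y f F)"
  by (rule gluing_over_fi) (auto simp: F_ext_def ext_simps intro: vfibre_map.talg_map_ext[OF Fs_map])

lemma glueC: "gluing (cl D2 h2) (cl D1 h1) (f ` Y) fi (F_cl V1 V2 Y f F g1)"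
  by (rule gluing_over_fi) (auto simp: F_cl_def cl_simps intro: cfibre_map.cl_map_fibre[OF Fs_cmap])

interpretation gG: gluing V1 V2 Y f F by (rule glueG)
interpretation gD: gluing D2 D1 "f ` Y" fi Fs by (rule glueD)

lemma G_eq: "G = pb_glue V1 V2 Y f F" by (simp add: glued_def)
lemma GD_eq: "GD = pb_glue D2 D1 (f ` Y) fi Fs" by (simp add: glued_duals_def)

abbreviation "b1 \<equiv> in1 (f ` Y) fi"
abbreviation "b2 \<equiv> in2 (f ` Y) fi"
abbreviation "k1 \<equiv> pb_in1 D2 (f ` Y) Fs"
abbreviation "k2 \<equiv> pb_in2 D2 (f ` Y) Fs"

text \<open>In \<open>G\<close> the common part \<open>Y\<close> is counted with the right-hand
  factor, in \<open>GD\<close> with that of \<open>X1\<close>. Regrouping the base of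
  \<open>G\<close> makes its two parts correspond to those of \<open>GD\<close>.\<close>

lemma base_G: "points (base G) = in1 Y f ` X1 \<union> in2 Y f ` (X2 - f ` Y)"
proof -
  have eq: "in1 Y f ` Y = in2 Y f ` f ` Y"
    unfolding image_image by (rule image_cong[OF refl in1_inside])
  have X: "(X1 - Y) \<union> Y = X1" "(X2 - f ` Y) \<union> f ` Y = X2" using Y_sub f_base by auto
  have "in1 Y f ` X1 = in1 Y f ` (X1 - Y) \<union> in2 Y f ` f ` Y"
    unfolding eq[symmetric] image_Un[symmetric] X ..
  moreover have "in2 Y f ` X2 = in2 Y f ` (X2 - f ` Y) \<union> in2 Y f ` f ` Y"
    unfolding image_Un[symmetric] X ..
  ultimately have "in1 Y f ` (X1 - Y) \<union> in2 Y f ` X2 = in1 Y f ` X1 \<union> in2 Y f ` (X2 - f ` Y)"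
    by (simp only: Un_ac)
  then show ?thesis unfolding G_eq gG.base_P .
qed

lemma base_GD: "points (base GD) = b1 ` (X2 - f ` Y) \<union> b2 ` X1"
  unfolding GD_eq gD.base_P by simp

lemma on_left_b1: "z \<in> X2 \<Longrightarrow> z \<notin> f ` Y \<Longrightarrow> on_left V2 Y f (b1 z)"
  by (simp add: on_left_def)

lemma on_left_b2: "\<not> on_left V2 Y f (b2 x)"
proof
  assume "on_left V2 Y f (b2 x)"
  then obtain z where "z \<notin> f ` Y" "b2 x = b1 z" unfolding on_left_def by blast
  then show False using in1_neq_in2[of z "f ` Y" fi x] by simp
qed

lemma iso_k1: "z \<in> X2 \<Longrightarrow> z \<notin> f ` Y \<Longrightarrow> vfibre_iso D2 z GD (b1 z) k1"
  unfolding GD_eq by (rule gD.iso_j1[OF vfibD2])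

lemma iso_k2: "x \<in> X1 \<Longrightarrow> vfibre_iso D1 x GD (b2 x) k2"
  unfolding GD_eq by (rule gD.iso_j2[OF vfibD1])

lemma isometry_k1:
  assumes "z \<in> X2" "z \<notin> f ` Y" "\<phi> \<in> fibre D2 z" "\<psi> \<in> fibre D2 z"
  shows "gm (b1 z) (k1 \<phi>) (k1 \<psi>) = h2 z \<phi> \<psi>"
  using gD.not_over[OF assms(2,3)] gD.not_over[OF assms(2,4)] on_left_b1[OF assms(1,2)] assms(1,2)
  by (simp add: glued_dual_metric_def out1_in1)

lemma isometry_k2:
  assumes "x \<in> X1" "\<phi> \<in> fibre D1 x" "\<psi> \<in> fibre D1 x"
  shows "gm (b2 x) (k2 \<phi>) (k2 \<psi>) = h1 x \<phi> \<psi>"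
proof -
  have "\<phi> \<in> points (tot D1)" "\<psi> \<in> points (tot D1)" using assms by (auto simp: over_def)
  then show ?thesis using on_left_b2[of x] assms(1) by (simp add: glued_dual_metric_def out2_in2)
qed

lemma cfib_k1:
  assumes "z \<in> X2" "z \<notin> f ` Y"
  shows "cfibre GD (b1 z) gm" "cfibre_map D2 z h2 GD (b1 z) gm k1"
  by (rule cfibre_iso[where g' = gm, OF iso_k1[OF assms] cfibD2[OF assms(1)]], erule isometry_k1[OF assms], assumption)+

lemma cfib_k2:
  assumes "x \<in> X1"
  shows "cfibre GD (b2 x) gm" "cfibre_map D1 x h1 GD (b2 x) gm k2"
  by (rule cfibre_iso[where g' = gm, OF iso_k2[OF assms] cfibD1[OF assms]], erule isometry_k2[OF assms], assumption)+

text \<open>Required over every point of the base, since the action on \<open>GD\<close> is a single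
  choice for the whole bundle.\<close>

lemma cfibGD: "b \<in> points (base GD) \<Longrightarrow> cfibre GD b gm"
  unfolding base_GD by (elim UnE imageE) (simp_all add: cfib_k1 cfib_k2)

subsection \<open>The map of duals is a fibrewise isomorphism\<close>

lemma openG: "plots_open (tot G)"
  unfolding G_eq pb_glue_simps by (rule glue_plots_open)

lemma dualG_in1: "x \<in> X1 \<Longrightarrow> x \<notin> Y \<Longrightarrow> dual_fibre G (in1 Y f x)"
proof -
  assume "x \<in> X1" "x \<notin> Y"
  then interpret H: vfibre_iso V1 x G "in1 Y f x" "pb_in1 V1 Y F" unfolding G_eq by (rule gG.iso_j1[OF vfib1])
  show ?thesis by unfold_locales (rule openG)
qed

lemma dualG_in2: "z \<in> X2 \<Longrightarrow> dual_fibre G (in2 Y f z)"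
proof -
  assume "z \<in> X2"
  then interpret H: vfibre_iso V2 z G "in2 Y f z" "pb_in2 V1 Y F" unfolding G_eq by (rule gG.iso_j2[OF vfib2])
  show ?thesis by unfold_locales (rule openG)
qed

lemma precomp_in1:
  assumes x: "x \<in> X1" "x \<notin> Y"
  shows "vfibre_iso (dual G) (in1 Y f x) D1 x (precomp V1 x (pb_in1 V1 Y F))"
proof (rule precomp_iso[OF dual1[OF x(1)] dualG_in1[OF x]])
  show "vfibre_iso V1 x G (in1 Y f x) (pb_in1 V1 Y F)"
    unfolding G_eq by (rule gG.iso_j1[OF vfib1[OF x(1)] x(2)])
  show "plot (tot G) n U (pb_in1 V1 Y F \<circ> p)" if "plot (tot V1) n U p" for n U p
    unfolding G_eq pb_glue_simps by (rule glue_plot_in1[OF open1 that])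
  have fib: "fibre G (in1 Y f x) = pb_in1 V1 Y F ` fibre V1 x"
    unfolding G_eq by (rule gG.fibre_j1[OF x])
  fix n U p u assume p: "plot (tot G) n U p" "p ` U \<subseteq> fibre G (in1 Y f x)" and u: "u \<in> U"
  from p(1)[unfolded G_eq pb_glue_simps] u
  show "\<exists>W\<subseteq>U. \<exists>q. openin (Euclidean_space n) W \<and> u \<in> W \<and> plot (tot V1) n W q \<and>
      (\<forall>w\<in>W. q w \<in> fibre V1 x \<and> p w = pb_in1 V1 Y F (q w))"
  proof (cases rule: glue_plot_local)
    case (left W q)
    have "q w \<in> fibre V1 x" if "w \<in> W" for w
    proof -
      have "pb_in1 V1 Y F (q w) \<in> pb_in1 V1 Y F ` fibre V1 x"
        using left(5)[OF that] p(2) subsetD[OF left(1) that] unfolding fib by (metis image_subset_iff)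
      then obtain v where "v \<in> fibre V1 x" "pb_in1 V1 Y F (q w) = pb_in1 V1 Y F v" by blast
      then show ?thesis using gG.not_over[OF x(2)] in1_inj[of v "over V1 Y" F "q w"] by auto
    qed
    then show ?thesis using left by blast
  next
    case (right W q)
    \<comment> \<open>This case cannot occur: over a point outside \<open>Y\<close> no class comes
      from \<open>V2\<close>.\<close>
    have "pb_in2 V1 Y F (q u) \<in> pb_in1 V1 Y F ` fibre V1 x"
      using right(5)[OF right(3)] p(2) u unfolding fib by (metis image_subset_iff)
    then show ?thesis using gG.not_over[OF x(2)] in1_neq_in2[of _ "over V1 Y" F "q u"] by fastforce
  qed
qed

lemma precomp_in2:
  assumes z: "z \<in> X2"
  shows "vfibre_iso (dual G) (in2 Y f z) D2 z (precomp V2 z (pb_in2 V1 Y F))"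
proof (rule precomp_iso[OF dual2[OF z] dualG_in2[OF z]])
  show "vfibre_iso V2 z G (in2 Y f z) (pb_in2 V1 Y F)"
    unfolding G_eq by (rule gG.iso_j2[OF vfib2[OF z]])
  show "plot (tot G) n U (pb_in2 V1 Y F \<circ> p)" if "plot (tot V2) n U p" for n U p
    unfolding G_eq pb_glue_simps by (rule glue_plot_in2[OF open2 that])
  have fib: "fibre G (in2 Y f z) = pb_in2 V1 Y F ` fibre V2 z"
    unfolding G_eq by (rule gG.fibre_j2)
  fix n U p u assume p: "plot (tot G) n U p" "p ` U \<subseteq> fibre G (in2 Y f z)" and u: "u \<in> U"
  have mem: "p w \<in> pb_in2 V1 Y F ` fibre V2 z" if "w \<in> U" for w
    using p(2) that unfolding fib by blast
  from p(1)[unfolded G_eq pb_glue_simps] u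
  show "\<exists>W\<subseteq>U. \<exists>q. openin (Euclidean_space n) W \<and> u \<in> W \<and> plot (tot V2) n W q \<and>
      (\<forall>w\<in>W. q w \<in> fibre V2 z \<and> p w = pb_in2 V1 Y F (q w))"
  proof (cases rule: glue_plot_local)
    case (left W q)
    have q: "q w \<in> over V1 Y" "F (q w) \<in> fibre V2 z" if "w \<in> W" for w
      using mem[OF subsetD[OF left(1) that]] left(5)[OF that] by (auto simp: in1_eq_in2)
    \<comment> \<open>A local lift to \<open>V1\<close> stays over \<open>Y\<close>, where each
      point is identified with its image; composing with the smooth map \<open>F\<close> turns it
      into a lift to \<open>V2\<close>.\<close>
    have "plot (tot V2) n W (F \<circ> q)" by (rule F_plot[OF left(4)]) (use q in auto)
    moreover have "\<forall>w\<in>W. (F \<circ> q) w \<in> fibre V2 z \<and> p w = pb_in2 V1 Y F ((F \<circ> q) w)"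
      using left(5) in1_inside[OF q(1), of _ F] q(2) by (intro ballI) simp
    ultimately show ?thesis using left(1-3) by blast
  next
    case (right W q)
    have "q w \<in> fibre V2 z" if "w \<in> W" for w
      using mem[OF subsetD[OF right(1) that]] right(5)[OF that] by (auto simp: in2_inj)
    then show ?thesis using right by blast
  qed
qed

lemma Phi_dual_left:
  assumes z: "z \<in> X2" "z \<notin> f ` Y"
  shows "vfibre_iso (dual G) (in2 Y f z) GD (b1 z) (Phi_dual V1 V2 Y f F)"
proof (rule vfibre_iso_comp[OF precomp_in2[OF z(1)] iso_k1[OF z]])
  fix \<xi> assume "\<xi> \<in> fibre (dual G) (in2 Y f z)"
  then have fst: "fst \<xi> = in2 Y f z" by (simp add: over_def)
  have "in2 Y f z \<notin> in1 Y f ` (X1 - Y)" using in1_neq_in2[of _ Y f z] by fastforce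
  then show "Phi_dual V1 V2 Y f F \<xi> = k1 (precomp V2 z (pb_in2 V1 Y F) \<xi>)"
    using z by (simp add: Phi_dual_def Let_def fst out2_in2)
qed

text \<open>Over \<open>Y\<close> forms on \<open>G\<close> are first read on \<open>V2\<close>,
  where the common part lives in \<open>G\<close>, and \<open>Fs\<close> then carries them to
  \<open>V1\<close>, where it lives in \<open>GD\<close>.\<close>

lemma Phi_dual_right:
  assumes x: "x \<in> X1"
  shows "vfibre_iso (dual G) (in1 Y f x) GD (b2 x) (Phi_dual V1 V2 Y f F)"
proof (cases "x \<in> Y")
  case True
  have eq: "in1 Y f x = in2 Y f (f x)" by (rule in1_inside[OF True])
  have nin: "in2 Y f (f x) \<notin> in1 Y f ` (X1 - Y)" using in1_neq_in2[of _ Y f "f x"] by fastforce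
  show ?thesis
    unfolding eq
  proof (rule vfibre_iso_comp[OF vfibre_iso_comp[OF precomp_in2[OF f_base[OF True]] Fs_iso[OF True] refl] iso_k2[OF x]])
    fix \<xi> assume "\<xi> \<in> fibre (dual G) (in2 Y f (f x))"
    then have fst: "fst \<xi> = in2 Y f (f x)" by (simp add: over_def)
    show "Phi_dual V1 V2 Y f F \<xi> = k2 (Fs (precomp V2 (f x) (pb_in2 V1 Y F) \<xi>))"
      using f_base[OF True] True nin by (simp add: Phi_dual_def Let_def fst out2_in2)
  qed
next
  case False
  show ?thesis
  proof (rule vfibre_iso_comp[OF precomp_in1[OF x False] iso_k2[OF x]])
    fix \<xi> assume "\<xi> \<in> fibre (dual G) (in1 Y f x)"
    then have fst: "fst \<xi> = in1 Y f x" by (simp add: over_def)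
    show "Phi_dual V1 V2 Y f F \<xi> = k2 (precomp V1 x (pb_in1 V1 Y F) \<xi>)"
      using x False by (simp add: Phi_dual_def Let_def fst out1_in1)
  qed
qed

end

section \<open>The identification of exterior algebras and the theorem\<close>

context compatible_gluing
begin

abbreviation "PD \<equiv> Phi_dual V1 V2 Y f F"
abbreviation "FE \<equiv> F_ext V1 V2 Y f F"
abbreviation "FT \<equiv> F_tpow V1 V2 Y f F"
abbreviation "FC \<equiv> F_cl V1 V2 Y f F g1"
abbreviation "e1 \<equiv> pb_in1 (ext D2) (f ` Y) FE"
abbreviation "e2 \<equiv> pb_in2 (ext D2) (f ` Y) FE"

abbreviation "EG \<equiv> ext (dual G)"
abbreviation "EP \<equiv> points (tot (ext_glued V1 V2 Y f F))"
abbreviation "PE \<equiv> Phi_ext V1 V2 Y f F"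
abbreviation "PDE \<equiv> Phi_dual_ext V1 V2 Y f F"
abbreviation "PT \<equiv> Phi_tens V1 V2 Y f F"
abbreviation "PC \<equiv> Phi_cl V1 V2 Y f F g1 g2"
abbreviation "GTP \<equiv> glued_tpows V1 V2 Y f F"
abbreviation "GC \<equiv> glued_cls V1 V2 Y f F g1 g2"
abbreviation "GE \<equiv> glued_exts V1 V2 Y f F"
abbreviation "GA \<equiv> glued_action V1 V2 Y f F g1 g2"
abbreviation "LD \<equiv> talg_map (dual G) GD PD"
abbreviation "L1 \<equiv> talg_map D2 GD k1"
abbreviation "L2 \<equiv> talg_map D1 GD k2"
abbreviation "T1 n \<equiv> tpow_map D2 GD n k1"
abbreviation "T2 n \<equiv> tpow_map D1 GD n k2"
abbreviation "u1 n \<equiv> pb_in1 (tpow D2 n) (f ` Y) (FT n)"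
abbreviation "u2 n \<equiv> pb_in2 (tpow D2 n) (f ` Y) (FT n)"

section \<open>Evaluating the two maps on the exterior algebra of the glued dual\<close>

lemma fibre_talg_component: "s \<in> fibre (talg V) x \<Longrightarrow> snd s n \<in> fibre (tpow V n) x"
  by (auto simp: over_def)

lemma inj_tpow_k1: "inj_on (T1 n) (over (tpow D2 n) (X2 - f ` Y))"
  by (rule tpow_map_inj_on[where \<beta> = b1]) (auto simp: iso_k1 in1_inj inj_on_def)

lemma inj_tpow_k2: "inj_on (T2 n) (points (tot (tpow D1 n)))"
proof -
  have "inj_on (T2 n) (over (tpow D1 n) X1)"
    by (rule tpow_map_inj_on[where \<beta> = b2]) (auto simp: iso_k2 in2_inj inj_on_def)
  moreover have "over (tpow D1 n) X1 = points (tot (tpow D1 n))" by (auto simp: over_def)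
  ultimately show ?thesis by simp
qed

lemma Phi_tens_k1:
  assumes z: "z \<in> X2" "z \<notin> f ` Y" and t: "t \<in> fibre (tpow D2 n) z"
  shows "PT n (T1 n t) = u1 n t"
proof -
  interpret K: vfibre_iso D2 z GD "b1 z" k1 by (rule iso_k1[OF z])
  have "proj (tpow GD n) (T1 n t) = b1 z"
    using K.tpow_map_fibre[OF t] by (simp add: over_def)
  moreover have "t \<in> over (tpow D2 n) (X2 - f ` Y)" using t z by (auto simp: over_def)
  ultimately show ?thesis
    using on_left_b1[OF z] the_inv_into_f_f[OF inj_tpow_k1] by (simp add: Phi_tens_def)
qed

lemma Phi_tens_k2:
  assumes x: "x \<in> X1" and t: "t \<in> fibre (tpow D1 n) x"
  shows "PT n (T2 n t) = u2 n t"
proof -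
  interpret K: vfibre_iso D1 x GD "b2 x" k2 by (rule iso_k2[OF x])
  have "proj (tpow GD n) (T2 n t) = b2 x"
    using K.tpow_map_fibre[OF t] by (simp add: over_def)
  moreover have "t \<in> points (tot (tpow D1 n))" using t by (auto simp: over_def)
  ultimately show ?thesis
    using on_left_b2[of x] the_inv_into_f_f[OF inj_tpow_k2] by (simp add: Phi_tens_def)
qed

text \<open>The class of \<open>s\<close> consists of \<open>s\<close> and its preimages under
  \<open>FE\<close> in the gluing domain. Both domains give the same preimages: \<open>FE\<close> is
  injective on each tensor algebra fibre and already maps the exterior fibre onto the exterior
  fibre.\<close>

lemma in2_talg_ext:
  assumes x: "x \<in> X1" and s: "s \<in> fibre (ext D1) x"
  shows "pb_in2 (talg D2) (f ` Y) FE s = e2 s"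
proof -
  have "a \<in> over (talg D2) (f ` Y) \<longleftrightarrow> a \<in> over (ext D2) (f ` Y)" if "FE a = s" for a
  proof
    assume "a \<in> over (ext D2) (f ` Y)"
    then obtain y where y: "y \<in> Y" "a \<in> fibre (ext D2) (f y)" by (auto simp: over_def)
    then show "a \<in> over (talg D2) (f ` Y)"
      using vfibre.fibre_ext_subset[OF vfibD2[OF f_base[OF y(1)]]] by (auto simp: over_def)
  next
    assume "a \<in> over (talg D2) (f ` Y)"
    then obtain y where y: "y \<in> Y" "a \<in> fibre (talg D2) (f y)" by (auto simp: over_def)
    interpret P: vfibre_iso D2 "f y" D1 y Fs by (rule Fs_iso[OF y(1)])
    have FE: "FE = talg_map D2 D1 Fs" by (simp add: F_ext_def)
    have "FE a \<in> fibre (talg D1) y" unfolding FE by (rule P.talg_map_talg[OF y(2)])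
    then have "y = x" using s \<open>FE a = s\<close> by (simp add: over_def ext_simps)
    with s have "s \<in> FE ` fibre (ext D2) (f y)" unfolding FE P.talg_map_ext_surj by simp
    then obtain a' where a': "a' \<in> fibre (ext D2) (f y)" "s = FE a'" by (rule imageE) (rule that)
    have "a = a'"
    proof (rule inj_onD[OF bij_betw_imp_inj_on[OF P.talg_map_bij] _ y(2)])
      show "talg_map D2 D1 Fs a = talg_map D2 D1 Fs a'" using \<open>FE a = s\<close> a'(2) unfolding FE by (simp only:)
      show "a' \<in> fibre (talg D2) (f y)" by (rule subsetD[OF P.A.fibre_ext_subset a'(1)])
    qed
    then show "a \<in> over (ext D2) (f ` Y)" using a' y(1) by (auto simp: over_def)
  qed
  then have "{a \<in> over (talg D2) (f ` Y). FE a = s} = {a \<in> over (ext D2) (f ` Y). FE a = s}"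
    by (intro Collect_cong) metis
  then show ?thesis unfolding in2_eq by (rule arg_cong)
qed

text \<open>The hypothesis \<open>LD t = L1 s\<close> says that the image of \<open>t\<close> comes
  from \<open>s\<close> in every degree. \<open>PT n\<close> returns the class of the component of
  \<open>s\<close>, and \<open>Phi_sum\<close> reassembles these components.\<close>

lemma Phi_ext_left:
  assumes z: "z \<in> X2" "z \<notin> f ` Y" and s: "s \<in> fibre (ext D2) z"
    and t: "t \<in> fibre EG (in2 Y f z)"
    and eq: "LD t = L1 s"
  shows "PE t = e1 s" "PDE t = L1 s"
proof -
  interpret K: vfibre_iso D2 z GD "b1 z" k1 by (rule iso_k1[OF z])
  interpret Q: vfibre_iso "dual G" "in2 Y f z" GD "b1 z" PD by (rule Phi_dual_left[OF z])
  have t': "t \<in> EP" using t by (simp add: ext_glued_def over_def)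
  have s': "s \<in> fibre (talg D2) z" using s K.A.fibre_ext_subset by blast
  have fs: "fst s = z" using s' by (simp add: over_def)
  note sn = fibre_talg_component[OF s']
  have comp: "PT n (tpow_map (dual G) GD n PD (snd t n)) = u1 n (snd s n)" for n
    using Phi_tens_k1[OF z sn, of n] Q.talg_map_snd[of n t] K.talg_map_snd[of n s] eq by simp
  have out: "snd s n \<in> points (tot (tpow D2 n))" "snd s n \<notin> over (tpow D2 n) (f ` Y)" "fst (snd s n) = z" for n
    using sn[of n] z by (auto simp: over_def)
  have o: "pb_out1 (tpow D2 n) (f ` Y) (FT n) (u1 n (snd s n)) = snd s n" for n
    by (rule out1_in1[OF out(1,2)])
  have b: "proj (GTP 0) (u1 0 (snd s 0)) = b1 z"
    unfolding glued_tpows_def using gluing.proj_j1[OF glueT[of 0] out(2)[of 0]] out(3)[of 0] by simp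
  have "PE t = pb_in1 (talg D2) (f ` Y) FE s"
    using t' z on_left_b1[OF z] fs prod.collapse[of s]
    by (simp add: Phi_ext_def dsum_map_def split_beta comp b Phi_sum_def out1_in1 o del: tpow_simps(1))
  \<comment> \<open>Outside either gluing domain the class of \<open>s\<close> is the singleton of
    \<open>Inl s\<close>, so the gluings of tensor and exterior algebras give the same
    class.\<close>
  also have "\<dots> = e1 s"
    using z s fs by (subst (1 2) in1_outside) (auto simp: over_def)
  finally show "PE t = e1 s" .
  show "PDE t = L1 s"
    using t' eq by (simp add: Phi_dual_ext_def)
qed

lemma Phi_ext_right:
  assumes x: "x \<in> X1" and s: "s \<in> fibre (ext D1) x"
    and t: "t \<in> fibre EG (in1 Y f x)"
    and eq: "LD t = L2 s"
  shows "PE t = e2 s" "PDE t = L2 s"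
proof -
  interpret K: vfibre_iso D1 x GD "b2 x" k2 by (rule iso_k2[OF x])
  interpret Q: vfibre_iso "dual G" "in1 Y f x" GD "b2 x" PD by (rule Phi_dual_right[OF x])
  have t': "t \<in> EP" using t by (simp add: ext_glued_def over_def)
  have s': "s \<in> fibre (talg D1) x" using s K.A.fibre_ext_subset by blast
  have fs: "fst s = x" using s' by (simp add: over_def)
  note sn = fibre_talg_component[OF s']
  have comp: "PT n (tpow_map (dual G) GD n PD (snd t n)) = u2 n (snd s n)" for n
    using Phi_tens_k2[OF x sn, of n] Q.talg_map_snd[of n t] K.talg_map_snd[of n s] eq by simp
  have out: "snd s n \<in> points (tot (tpow D1 n))" "fst (snd s n) = x" for n
    using sn[of n] by (auto simp: over_def)
  have o: "pb_out2 (tpow D2 n) (tpow D1 n) (f ` Y) (FT n) (u2 n (snd s n)) = snd s n" for n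
    by (rule out2_in2[OF out(1)])
  have b: "proj (GTP 0) (u2 0 (snd s 0)) = b2 x"
    unfolding glued_tpows_def using gluing.proj_j2[OF glueT[of 0]] out(2)[of 0] by simp
  have "PE t = pb_in2 (talg D2) (f ` Y) FE s"
    using t' x on_left_b2[of x] fs prod.collapse[of s]
    by (simp add: Phi_ext_def dsum_map_def split_beta comp b Phi_sum_def out2_in2 o del: tpow_simps(1))
  also have "\<dots> = e2 s" by (rule in2_talg_ext[OF x s])
  finally show "PE t = e2 s" .
  show "PDE t = L2 s"
    using t' eq by (simp add: Phi_dual_ext_def)
qed

text \<open>Over each base point both \<open>PD\<close> and the inclusion of one dual bundle are
  isomorphisms onto the same fibre of \<open>GD\<close>, so \<open>t\<close> is matched with an
  element \<open>s\<close> of one piece. Points over \<open>Y\<close> fall under the second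
  case.\<close>

lemma ext_glued_cases:
  assumes "t \<in> EP"
  obtains (left) z s where "z \<in> X2" "z \<notin> f ` Y" "s \<in> fibre (ext D2) z" "t \<in> fibre EG (in2 Y f z)"
      "LD t = L1 s"
    | (right) x s where "x \<in> X1" "s \<in> fibre (ext D1) x" "t \<in> fibre EG (in1 Y f x)"
      "LD t = L2 s"
proof -
  have t: "t \<in> points (tot EG)" using assms by (simp add: ext_glued_def)
  then have tf: "t \<in> fibre EG (fst t)" by (simp add: over_def ext_simps)
  have "fst t \<in> points (base G)" using t by (auto simp: ext_def)
  then consider z where "z \<in> X2" "z \<notin> f ` Y" "fst t = in2 Y f z" | x where "x \<in> X1" "fst t = in1 Y f x"
    unfolding base_G by blast
  then show ?thesis
  proof cases
    case 1
    interpret K: vfibre_iso D2 z GD "b1 z" k1 by (rule iso_k1[OF 1(1,2)])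
    interpret Q: vfibre_iso "dual G" "in2 Y f z" GD "b1 z" PD by (rule Phi_dual_left[OF 1(1,2)])
    have t2: "t \<in> fibre EG (in2 Y f z)" using tf 1(3) by simp
    then have "LD t \<in> L1 ` fibre (ext D2) z"
      unfolding K.talg_map_ext_surj by (rule Q.talg_map_ext)
    then show ?thesis using left[OF 1(1,2) _ t2] by blast
  next
    case 2
    interpret K: vfibre_iso D1 x GD "b2 x" k2 by (rule iso_k2[OF 2(1)])
    interpret Q: vfibre_iso "dual G" "in1 Y f x" GD "b2 x" PD by (rule Phi_dual_right[OF 2(1)])
    have t2: "t \<in> fibre EG (in1 Y f x)" using tf 2(2) by simp
    then have "LD t \<in> L2 ` fibre (ext D1) x"
      unfolding K.talg_map_ext_surj by (rule Q.talg_map_ext)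
    then show ?thesis using right[OF 2(1) _ t2] by blast
  qed
qed

lemma ext_not_over: "z \<notin> f ` Y \<Longrightarrow> s \<in> fibre (ext D2) z \<Longrightarrow> s \<notin> over (ext D2) (f ` Y)"
  by (auto simp: over_def)

text \<open>\<open>PE t\<close> determines the side and the element \<open>s\<close>; this
  determines the base point and \<open>LD t\<close>, and \<open>LD\<close> is injective on each
  fibre.\<close>

lemma Phi_ext_inj: "inj_on (PE) (EP)"
proof (rule inj_onI)
  fix t t' assume t: "t \<in> EP" and t': "t' \<in> EP"
    and eq: "PE t = PE t'"
  from t show "t = t'"
  proof (cases rule: ext_glued_cases)
    case (left z s)
    note L = left
    from t' show ?thesis
    proof (cases rule: ext_glued_cases)
      case (left z' s')
      have "e1 s = e1 s'" using eq Phi_ext_left(1)[OF L] Phi_ext_left(1)[OF left] by simp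
      then have ss: "s = s'" using in1_inj[OF ext_not_over[OF left(2,3)]] by metis
      then have eq': "z = z'" using L(3) left(3) by (simp add: over_def)
      interpret Q: vfibre_iso "dual G" "in2 Y f z" GD "b1 z" PD by (rule Phi_dual_left[OF L(1,2)])
      have "inj_on LD (fibre EG (in2 Y f z))"
        using Q.talg_map_bij Q.A.fibre_ext_subset unfolding bij_betw_def by (blast intro: inj_on_subset)
      from inj_onD[OF this _ L(4), of t'] show ?thesis
        using L(5) left(4,5) ss eq' by simp
    next
      case (right x s')
      have "e1 s = e2 s'" using eq Phi_ext_left(1)[OF L] Phi_ext_right(1)[OF right] by simp
      then show ?thesis using in1_neq_in2[OF ext_not_over[OF L(2,3)]] by metis
    qed
  next
    case (right x s)
    note R = right
    from t' show ?thesis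
    proof (cases rule: ext_glued_cases)
      case (left z s')
      have "e1 s' = e2 s" using eq Phi_ext_left(1)[OF left] Phi_ext_right(1)[OF R] by simp
      then show ?thesis using in1_neq_in2[OF ext_not_over[OF left(2,3)]] by metis
    next
      case (right x' s')
      have "e2 s = e2 s'" using eq Phi_ext_right(1)[OF R] Phi_ext_right(1)[OF right] by simp
      then have ss: "s = s'" by (simp add: in2_inj)
      then have eq': "x = x'" using R(2) right(2) by (simp add: over_def)
      interpret Q: vfibre_iso "dual G" "in1 Y f x" GD "b2 x" PD by (rule Phi_dual_right[OF R(1)])
      have "inj_on LD (fibre EG (in1 Y f x))"
        using Q.talg_map_bij Q.A.fibre_ext_subset unfolding bij_betw_def by (blast intro: inj_on_subset)
      from inj_onD[OF this _ R(3), of t'] show ?thesis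
        using R(4) right(3,4) ss eq' by simp
    qed
  qed
qed

abbreviation "Theta \<equiv> PDE \<circ>
  the_inv_into (EP) (PE)"

text \<open>\<open>PE\<close> sends the element \<open>t\<close> matched with \<open>s\<close> to
  the class of \<open>s\<close>, and \<open>PDE\<close> sends it to \<open>L1 s\<close>. In the
  composite \<open>t\<close> disappears, and only the map induced by the inclusion \<open>k1\<close>
  is left.\<close>

lemma Theta_left:
  assumes z: "z \<in> X2" "z \<notin> f ` Y" and s: "s \<in> fibre (ext D2) z"
  shows "Theta (e1 s) = L1 s"
proof -
  interpret K: vfibre_iso D2 z GD "b1 z" k1 by (rule iso_k1[OF z])
  interpret Q: vfibre_iso "dual G" "in2 Y f z" GD "b1 z" PD by (rule Phi_dual_left[OF z])
  have "L1 s \<in> LD ` fibre EG (in2 Y f z)"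
    unfolding Q.talg_map_ext_surj by (rule K.talg_map_ext[OF s])
  then obtain t where t: "t \<in> fibre EG (in2 Y f z)" "LD t = L1 s"
    by (rule imageE) (rule that, assumption, rule sym, assumption)
  then have "t \<in> EP" by (simp add: ext_glued_def over_def)
  from the_inv_into_f_f[OF Phi_ext_inj this] show ?thesis
    using Phi_ext_left[OF z s t] by simp
qed

lemma Theta_right:
  assumes x: "x \<in> X1" and s: "s \<in> fibre (ext D1) x"
  shows "Theta (e2 s) = L2 s"
proof -
  interpret K: vfibre_iso D1 x GD "b2 x" k2 by (rule iso_k2[OF x])
  interpret Q: vfibre_iso "dual G" "in1 Y f x" GD "b2 x" PD by (rule Phi_dual_right[OF x])
  have "L2 s \<in> LD ` fibre EG (in1 Y f x)"
    unfolding Q.talg_map_ext_surj by (rule K.talg_map_ext[OF s])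
  then obtain t where t: "t \<in> fibre EG (in1 Y f x)" "LD t = L2 s"
    by (rule imageE) (rule that, assumption, rule sym, assumption)
  then have "t \<in> EP" by (simp add: ext_glued_def over_def)
  from the_inv_into_f_f[OF Phi_ext_inj this] show ?thesis
    using Phi_ext_right[OF x s t] by simp
qed

text \<open>Over each part of the base all maps involved are induced by one inclusion,
  \<open>k1\<close> or \<open>k2\<close>, which preserves the forms; the claim is then naturality of
  the action under it.\<close>

theorem actions_agree:
  assumes v: "v \<in> points (tot (GC))"
    and e: "e \<in> points (tot (GE))"
    and same: "proj (GC) v = proj (GE) e"
  shows "Theta (GA v e) =
    clifford_action GD gm (PC v) (Theta e)"
proof -
  interpret E: gluing "ext D2" "ext D1" "f ` Y" fi FE by (rule glueE)
  interpret C: gluing "cl D2 h2" "cl D1 h1" "f ` Y" fi FC by (rule glueC)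
  have all2: "cfibre D2 x h2" if "x \<in> points (base D2)" for x using that cfibD2 by simp
  have all1: "cfibre D1 x h1" if "x \<in> points (base D1)" for x using that cfibD1 by simp
  have pC: "GC = C.P" by (simp add: glued_cls_def)
  have pE: "GE = E.P" by (simp add: glued_exts_def)
  from e[unfolded pE E.points_P] show ?thesis
  proof (elim UnE imageE)
    fix s assume s: "s \<in> points (tot (ext D2)) - over (ext D2) (f ` Y)" and es: "e = e1 s"
    define z where "z = fst s"
    have z: "z \<in> X2" "z \<notin> f ` Y" using s by (auto simp: z_def ext_def over_def)
    have sf: "s \<in> fibre (ext D2) z" using s by (simp add: z_def over_def ext_simps)
    have pe: "proj E.P e = b1 z" using E.proj_j1[of s] s by (simp add: es z_def ext_simps)
    have "v \<in> fibre C.P (b1 z)" using v same pe by (simp add: pC pE over_def)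
    moreover have "fibre C.P (b1 z) = C.j1 ` fibre (cl D2 h2) z"
      by (rule C.fibre_j1) (use z in \<open>simp_all add: cl_simps\<close>)
    ultimately obtain A where A: "A \<in> fibre (cl D2 h2) z" "v = C.j1 A" by blast
    have A': "A \<in> points (tot (cl D2 h2))" "A \<notin> over (cl D2 h2) (f ` Y)"
      using C.not_over[OF z(2) A(1)] by simp_all
    have pv: "on_left V2 Y f (proj C.P v)" using same pe on_left_b1[OF z] by (simp add: pC pE)
    interpret K: cfibre_map D2 z h2 GD "b1 z" gm k1 by (rule cfib_k1(2)[OF z])
    have act: "GA v e = e1 (clifford_action D2 h2 A s)"
      using pv s A' unfolding glued_action_def pC by (simp add: A(2) es out1_in1)
    have Phi: "PC v = cl_map D2 GD gm k1 A"
      using pv A' unfolding Phi_cl_def pC by (simp add: A(2) out1_in1)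
    have mem: "clifford_action D2 h2 A s \<in> fibre (ext D2) z"
      by (rule K.A.clifford_action_fibre[OF all2 A(1) sf])
    show ?thesis
      unfolding act Phi unfolding es Theta_left[OF z mem] Theta_left[OF z sf]
      by (rule K.clifford_action_natural[OF all2 cfibGD A(1) sf])
  next
    fix s assume s: "s \<in> points (tot (ext D1))" and es: "e = e2 s"
    define x where "x = fst s"
    have x: "x \<in> X1" using s by (auto simp: x_def ext_def)
    have sf: "s \<in> fibre (ext D1) x" using s by (simp add: x_def over_def ext_simps)
    have pe: "proj E.P e = b2 x" using E.proj_j2[of s] by (simp add: es x_def ext_simps)
    have "v \<in> fibre C.P (b2 x)" using v same pe by (simp add: pC pE over_def)
    then obtain A where A: "A \<in> fibre (cl D1 h1) x" "v = C.j2 A" unfolding C.fibre_j2 by blast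
    have A': "A \<in> points (tot (cl D1 h1))" using A(1) by (simp add: over_def)
    have pv: "\<not> on_left V2 Y f (proj C.P v)" using same pe on_left_b2 by (simp add: pC pE)
    interpret K: cfibre_map D1 x h1 GD "b2 x" gm k2 by (rule cfib_k2(2)[OF x])
    have act: "GA v e = e2 (clifford_action D1 h1 A s)"
      using pv s A' unfolding glued_action_def pC by (simp add: A(2) es out2_in2)
    have Phi: "PC v = cl_map D1 GD gm k2 A"
      using pv A' unfolding Phi_cl_def pC by (simp add: A(2) out2_in2)
    have mem: "clifford_action D1 h1 A s \<in> fibre (ext D1) x"
      by (rule K.A.clifford_action_fibre[OF all1 A(1) sf])
    show ?thesis
      unfolding act Phi unfolding es Theta_right[OF x mem] Theta_right[OF x sf]
      by (rule K.clifford_action_natural[OF all1 cfibGD A(1) sf])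
  qed
qed

end

theorem theorem8p5:
  fixes V1 :: "('v1, 'x1) pbundle" and V2 :: "('v2, 'x2) pbundle"
    and Y :: "'x1 set" and f :: "'x1 \<Rightarrow> 'x2" and F :: "'v1 \<Rightarrow> 'v2"
    and g1 :: "'x1 \<Rightarrow> 'v1 \<Rightarrow> 'v1 \<Rightarrow> real" and g2 :: "'x2 \<Rightarrow> 'v2 \<Rightarrow> 'v2 \<Rightarrow> real"
  assumes "pseudo_bundle V1" "locally_trivial V1" "bounded_fibre_dim V1"
    and "pseudo_bundle V2" "locally_trivial V2" "bounded_fibre_dim V2"
    and "is_gluing V1 V2 Y f F"
    and "diffeomorphism (sub_dsp (base V1) Y) (sub_dsp (base V2) (f ` Y)) f"
    and "diffeomorphism (sub_dsp (tot (dual V2)) (over (dual V2) (f ` Y)))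
           (sub_dsp (tot (dual V1)) (Fstar V1 Y f F ` over (dual V2) (f ` Y)))
           (Fstar V1 Y f F)"
    and "pseudo_metric V1 g1" "pseudo_metric V2 g2"
    and "compatible V1 Y f F g1 g2"
    and "v \<in> points (tot (glued_cls V1 V2 Y f F g1 g2))"
    and "e \<in> points (tot (glued_exts V1 V2 Y f F))"
    and "proj (glued_cls V1 V2 Y f F g1 g2) v = proj (glued_exts V1 V2 Y f F) e"
  shows
    "(Phi_dual_ext V1 V2 Y f F \<circ>
        the_inv_into (points (tot (ext_glued V1 V2 Y f F))) (Phi_ext V1 V2 Y f F))
       (glued_action V1 V2 Y f F g1 g2 v e) =
     clifford_action (glued_duals V1 V2 Y f F) (glued_dual_metric V1 V2 Y f F g1 g2)
       (Phi_cl V1 V2 Y f F g1 g2 v)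
       ((Phi_dual_ext V1 V2 Y f F \<circ>
           the_inv_into (points (tot (ext_glued V1 V2 Y f F))) (Phi_ext V1 V2 Y f F)) e)"
proof -
  interpret compatible_gluing V1 V2 Y f F g1 g2
    by (rule compatible_gluing.intro) (rule assms)+
  show ?thesis by (rule actions_agree[OF assms(13-15)])
qed

end
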